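(* Let $\lambda\neq 0$ and let $\{g_n(\omega)\}_{n\ge1}$ be independent real random variables with $\mathbb{E}[g_n]=0$, $\mathbb{E}[g_n^2]=\lambda^2$, $\sum_{n\ge1}\mathbb{E}[g_n^4]n^{-2}<\infty$, and $\mathbb{P}[\lim_{n\to\infty}g_nn^{-1/4}=0]=1$. Fix $F>0$, $E\in\mathbb{R}$ and $\theta_+,\theta_-\in[0,\pi)$ with $\theta_+\ne\theta_-$. Let $\psi_\pm$ be the solutions of the generalized eigenvalue equation on $(0,\infty)$ with couplings $g_n(\omega)$ and $\psi_\pm(0)=\sin\theta_\pm$, $\psi_\pm'(0^+)=\cos\theta_\pm$, with Prüfer radii $R_\pm$. Then almost surely there is $\varrho_\infty\in(0,\infty)$ such that $$\limsup_{n\to\infty}\frac{\log\bigl|R_+(n)/R_-(n)-\varrho_\infty\bigr|}{\log n}\le-\frac{\lambda^2}{4F}.$$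
   Context: Generalized eigenvalue equation on $(0,\infty)$: $-\psi''-Fx\psi=E\psi$ on $(0,\infty)\setminus\mathbb{Z}$, $\psi$ continuous at each $n\ge1$, and $\lim_{\epsilon\to0^+}(\psi'(n+\epsilon)-\psi'(n-\epsilon))=g_n\psi(n)$ for $n\ge1$. Reference solution: $\zeta(x)=(\pi/F^{1/3})^{1/2}(i\,\mathrm{Ai}(-F^{1/3}(x+E/F))+\mathrm{Bi}(-F^{1/3}(x+E/F)))$ (Airy functions), which has no real zeros. Prüfer radius: for a real-valued solution $\psi$ and each $n\ge1$ there is a unique $\alpha(n)\in\mathbb{C}$ with $\psi(x)=\alpha(n)\zeta(x)+\overline{\alpha(n)}\,\overline{\zeta(x)}$ for $x\in(n-1,n)$; set $R(n)=2|\alpha(n)|$. *)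

theory Defs
  imports "HOL-Probability.Probability"
begin

section \<open>Airy functions (power series definition, Abramowitz--Stegun 10.4.2--10.4.3)\<close>

definition airy_f :: "real \<Rightarrow> real" where
  "airy_f x = (\<Sum>k. 3 ^ k * pochhammer (1/3) k * x ^ (3*k) / fact (3*k))"

definition airy_g :: "real \<Rightarrow> real" where
  "airy_g x = (\<Sum>k. 3 ^ k * pochhammer (2/3) k * x ^ (3*k+1) / fact (3*k+1))"

definition airy_c1 :: real where
  "airy_c1 = 1 / (3 powr (2/3) * Gamma (2/3))"

definition airy_c2 :: real where
  "airy_c2 = 1 / (3 powr (1/3) * Gamma (1/3))"

definition Ai :: "real \<Rightarrow> real" where
  "Ai x = airy_c1 * airy_f x - airy_c2 * airy_g x"

definition Bi :: "real \<Rightarrow> real" where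
  "Bi x = sqrt 3 * (airy_c1 * airy_f x + airy_c2 * airy_g x)"

definition zeta :: "real \<Rightarrow> real \<Rightarrow> real \<Rightarrow> complex" where
  "zeta F E x = complex_of_real (sqrt (pi / F powr (1/3))) *
     (\<i> * complex_of_real (Ai (- (F powr (1/3)) * (x + E / F)))
        + complex_of_real (Bi (- (F powr (1/3)) * (x + E / F))))"

definition pruefer_radius :: "real \<Rightarrow> real \<Rightarrow> (real \<Rightarrow> real) \<Rightarrow> nat \<Rightarrow> real" where
  "pruefer_radius F E \<psi> n = 2 * cmod (THE \<alpha>. \<forall>x\<in>{real n - 1<..<real n}.
      complex_of_real (\<psi> x) = \<alpha> * zeta F E x + cnj \<alpha> * cnj (zeta F E x))"

definition gen_eig_sol ::
  "real \<Rightarrow> real \<Rightarrow> (nat \<Rightarrow> real) \<Rightarrow> real \<Rightarrow> (real \<Rightarrow> real) \<Rightarrow> bool" where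
  "gen_eig_sol F E g \<theta> \<psi> \<longleftrightarrow>
     continuous_on {0..} \<psi> \<and>
     (\<forall>n::nat. \<forall>x\<in>{real n<..<real n + 1}.
        (\<psi> has_real_derivative deriv \<psi> x) (at x) \<and>
        (deriv \<psi> has_real_derivative (- F * x * \<psi> x - E * \<psi> x)) (at x)) \<and>
     (\<forall>n::nat. n \<ge> 1 \<longrightarrow>
        ((\<lambda>\<epsilon>. deriv \<psi> (real n + \<epsilon>) - deriv \<psi> (real n - \<epsilon>)) \<longlongrightarrow> g n * \<psi> (real n))
          (at_right 0)) \<and>
     \<psi> 0 = sin \<theta> \<and>
     (deriv \<psi> \<longlongrightarrow> cos \<theta>) (at_right 0)"

definition log_ratio :: "real \<Rightarrow> nat \<Rightarrow> ereal" where
  "log_ratio d n = (if d = 0 then -\<infinity> else ereal (ln \<bar>d\<bar> / ln (real n)))"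

end

theory Submission
  imports Defs "HOL-Real_Asymp.Real_Asymp"
begin

text \<open>
  Put \<open>\<zeta>\<^sub>1 = \<zeta> / \<surd>\<kappa>\<close> with \<open>\<kappa> = Im (cnj \<zeta> \<zeta>')\<close>, and write a solution on \<open>(n, n + 1)\<close> as
  \<open>Re (a\<^sub>n \<zeta>\<^sub>1)\<close>, so that the Pruefer radius is \<open>\<bar>a\<^sub>n\<bar>\<close> up to a constant factor. With \<open>z\<^sub>n = \<zeta>\<^sub>1(n + 1)\<close> the jump
  condition reads \<open>a\<^sub>n\<^sub>+\<^sub>1 = a\<^sub>n - i g Re (a\<^sub>n z\<^sub>n) cnj z\<^sub>n\<close>. For two solutions with amplitudes \<open>a, b\<close> the
  quantity \<open>K = Im (b cnj a)\<close> is conserved, and the ratio \<open>a / b\<close> changes at each step by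
  \<open>g K (cnj z\<^sub>n)\<^sup>2 / (b\<^sub>n b\<^sub>n\<^sub>+\<^sub>1)\<close>. Up to second order this is a martingale difference of size
  \<open>n powr (-1/2) / \<bar>b\<^sub>n\<bar>\<^sup>2\<close>, so a lower bound on the growth of \<open>\<bar>b\<^sub>n\<bar>\<close> gives convergence of \<open>a / b\<close> with
  the rate of \<open>\<bar>b\<^sub>n\<bar> powr (-2)\<close>; applying this to \<open>b / a\<close> as well shows that the limit is not \<open>0\<close>.

  For the growth, \<open>ln \<bar>b\<^sub>n\<bar>\<^sup>2\<close> has increments \<open>g S + g\<^sup>2 U + O(\<bar>g\<bar>\<^sup>3 \<bar>z\<^sub>n\<bar>\<^sup>6)\<close> with predictable \<open>S, U\<close>, where \<open>U\<close> equals
  \<open>\<bar>z\<^sub>n\<bar>\<^sup>4 / 4 \<sim> 1 / (4 F n)\<close> plus terms oscillating with the WKB phase \<open>\<xi>(n) \<sim> (2/3) \<surd>F n powr (3/2)\<close>. These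
  average out by van der Corput's inequality, because the differences \<open>\<xi>(n + h) - \<xi>(n)\<close> are slowly varying
  and the phase of \<open>b\<^sub>n\<close> moves by \<open>o(1)\<close>. Hence \<open>ln \<bar>b\<^sub>n\<bar>\<^sup>2 \<sim> \<lambda>\<^sup>2 / (4 F) ln n\<close>. The asymptotics of the Airy
  functions are not used: every solution pair is asymptotic to a fixed real-linear image of the WKB pair,
  and the recursion for the amplitudes commutes with such changes of the reference solution.
\<close>

section \<open>Martingale convergence for predictable weights\<close>

text \<open>Each assumption on the couplings pays for one error term. Centering makes the
  first-order part of the logarithm a martingale with variances of order \<open>1 / n\<close>, so
  its sum is almost surely \<open>o(ln n)\<close>. The fourth moment condition makes the sum of
  \<open>(g^2 - lam^2) * U\<close> converge. The bound \<open>g = o(n powr (1/4))\<close> reduces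
  the cubic remainder to \<open>g^2 * n powr (-5/4)\<close>, which has a finite expected sum. The
  obstacle is that the oscillating part of the drift contains the random direction of the amplitude,
  which depends on all earlier couplings. The averaging is therefore done along a single path, and
  all that is asked of the path is that this direction moves by \<open>o(1)\<close> per step. Growth
  is known only as a limit of \<open>ln\<close>-ratios, with limit
  \<open>L = lam^2 / (4 * F)\<close>. So a power bound with exponent \<gamma>' is available for each
  \<gamma>' < L, and summability of the tails costs a further gap \<gamma> < \<gamma>'. The full
  exponent appears only in the limsup, where \<gamma> increases to L along a countable sequence that
  a single almost sure event can serve.\<close>

definition past :: "'a measure \<Rightarrow> (nat \<Rightarrow> 'a \<Rightarrow> real) \<Rightarrow> nat \<Rightarrow> 'a measure" where
  "past M X k = vimage_algebra (space M) (\<lambda>\<omega>. \<lambda>i\<in>{..<k}. X i \<omega>) (Pi\<^sub>M {..<k} (\<lambda>_. borel))"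

lemma space_past [simp]: "space (past M X k) = space M"
  by (simp add: past_def)

lemma past_coordinate_measurable:
  assumes "i < k"
  shows "X i \<in> borel_measurable (past M X k)"
proof -
  have "(\<lambda>\<omega>. \<lambda>i\<in>{..<k}. X i \<omega>) \<in> measurable (past M X k) (Pi\<^sub>M {..<k} (\<lambda>_. borel))"
    unfolding past_def by (intro measurable_vimage_algebra1) (auto simp: space_PiM)
  from measurable_compose[OF this measurable_component_singleton[of i]] assms
  show ?thesis by simp
qed

lemma measurable_past_mono:
  assumes "Y \<in> measurable (past M X j) N" "j \<le> k"
  shows "Y \<in> measurable (past M X k) N"
proof -
  have "(\<lambda>\<omega>. \<omega>) \<in> measurable (past M X k) (past M X j)"
    unfolding past_def[of _ _ j] using assms(2)
    by (intro measurable_vimage_algebra2 measurable_restrict past_coordinate_measurable) auto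
  from measurable_compose[OF this assms(1)] show ?thesis .
qed

lemma measurable_from_past:
  assumes "Y \<in> measurable (past M X k) N" "\<And>i. X i \<in> borel_measurable M"
  shows "Y \<in> measurable M N"
proof -
  have "(\<lambda>\<omega>. \<omega>) \<in> measurable M (past M X k)"
    unfolding past_def using assms(2)
    by (intro measurable_vimage_algebra2 measurable_restrict) auto
  from measurable_compose[OF this assms(1)] show ?thesis .
qed

locale independent_noise = prob_space +
  fixes X :: "nat \<Rightarrow> 'a \<Rightarrow> real"
  assumes indep: "indep_vars (\<lambda>_. borel) X UNIV"
begin

lemma X_measurable [measurable]: "X i \<in> borel_measurable M"
  using indep by (auto simp: indep_vars_def)

text \<open>\<open>past M X k\<close> is generated by the coordinates with index strictly below
  \<open>k\<close>, so the blocks \<open>{k}\<close> and \<open>{..<k}\<close> are disjoint and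
  hence independent. Independence passes to sub-sigma-algebras, so \<open>Y\<close> never has to be
  written as a function of the coordinates.\<close>

lemma indep_var_past:
  assumes \<phi> [measurable]: "\<phi> \<in> borel_measurable borel" and Y: "Y \<in> borel_measurable (past M X k)"
  shows "indep_var borel (\<lambda>\<omega>. \<phi> (X k \<omega> :: real) :: real) borel (Y :: _ \<Rightarrow> real)"
proof -
  let ?f = "\<lambda>A \<omega>. \<lambda>i\<in>A. X i \<omega>" and ?P = "\<lambda>A. Pi\<^sub>M A (\<lambda>_::nat. borel :: real measure)"
  let ?V = "\<lambda>A. vimage_algebra (space M) (?f A) (?P A)"
  have i: "indep_var (?P {k}) (?f {k}) (?P {..<k}) (?f {..<k})"
    using indep by (rule indep_var_restrict) auto
  have sub: "sigma_sets (space M) {Z -` A \<inter> space M |A. A \<in> sets borel}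
      \<subseteq> sigma_sets (space M) {?f B -` A \<inter> space M |A. A \<in> sets (?P B)}"
    if "Z \<in> borel_measurable (?V B)" for Z :: "'a \<Rightarrow> real" and B
  proof (rule sigma_sets_mono)
    have "{Z -` A \<inter> space M |A. A \<in> sets borel} \<subseteq> sets (?V B)"
      using measurable_sets[OF that] by auto
    then show "{Z -` A \<inter> space M |A. A \<in> sets borel}
        \<subseteq> sigma_sets (space M) {?f B -` A \<inter> space M |A. A \<in> sets (?P B)}"
      by (simp add: sets_vimage_algebra)
  qed
  have "?f {k} \<in> measurable (?V {k}) (?P {k})"
    by (intro measurable_vimage_algebra1) (auto simp: space_PiM)
  from measurable_compose[OF this measurable_component_singleton[of k]]
  have "(\<lambda>\<omega>. \<phi> (X k \<omega>)) \<in> borel_measurable (?V {k})"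
    using measurable_compose[OF _ \<phi>] by auto
  from sub[OF this] sub[of Y "{..<k}"] Y
  have "sigma_sets (space M) {(\<lambda>\<omega>. \<phi> (X k \<omega>)) -` A \<inter> space M |A. A \<in> sets borel}
      \<subseteq> sigma_sets (space M) {?f {k} -` A \<inter> space M |A. A \<in> sets (?P {k})}"
    and "sigma_sets (space M) {Y -` A \<inter> space M |A. A \<in> sets borel}
      \<subseteq> sigma_sets (space M) {?f {..<k} -` A \<inter> space M |A. A \<in> sets (?P {..<k})}"
    by (auto simp only: past_def)
  moreover have "Y \<in> borel_measurable M" using measurable_from_past[OF Y] by simp
  moreover have "(\<lambda>\<omega>. \<phi> (X k \<omega>)) \<in> borel_measurable M" by measurable
  ultimately show ?thesis
    using i unfolding indep_var_eq indep_sets2_eq by (metis (no_types, lifting) subset_iff)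
qed

lemma expectation_past_mult:
  fixes \<phi> :: "real \<Rightarrow> real" and Y :: "'a \<Rightarrow> real"
  assumes "\<phi> \<in> borel_measurable borel" "Y \<in> borel_measurable (past M X k)"
    and "integrable M (\<lambda>\<omega>. \<phi> (X k \<omega>))" "integrable M Y"
  shows "integrable M (\<lambda>\<omega>. \<phi> (X k \<omega>) * Y \<omega>)"
    and "expectation (\<lambda>\<omega>. \<phi> (X k \<omega>) * Y \<omega>) = expectation (\<lambda>\<omega>. \<phi> (X k \<omega>)) * expectation Y"
  using indep_var_integrable indep_var_lebesgue_integral indep_var_past[OF assms(1,2)] assms(3,4)
  by auto

context
  fixes \<phi> :: "nat \<Rightarrow> real \<Rightarrow> real" and Y :: "nat \<Rightarrow> 'a \<Rightarrow> real" and b :: "nat \<Rightarrow> real"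
  assumes \<phi> [measurable]: "\<And>k. \<phi> k \<in> borel_measurable borel"
    and sq: "\<And>k. integrable M (\<lambda>\<omega>. (\<phi> k (X k \<omega>))\<^sup>2)"
    and centred: "\<And>k. expectation (\<lambda>\<omega>. \<phi> k (X k \<omega>)) = 0"
    and Y: "\<And>k. Y k \<in> borel_measurable (past M X k)"
    and b: "\<And>k \<omega>. \<omega> \<in> space M \<Longrightarrow> \<bar>Y k \<omega>\<bar> \<le> b k"
begin

lemma martingale_past_measurable: "(\<lambda>\<omega>. (\<Sum>k<n. \<phi> k (X k \<omega>) * Y k \<omega>)) \<in> borel_measurable (past M X n)"
proof (intro borel_measurable_sum borel_measurable_times)
  fix k assume "k \<in> {..<n}"
  then show "(\<lambda>\<omega>. \<phi> k (X k \<omega>)) \<in> borel_measurable (past M X n)" "Y k \<in> borel_measurable (past M X n)"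
    using measurable_compose[OF past_coordinate_measurable \<phi>] measurable_past_mono[OF Y[of k]] by auto
qed

text \<open>Increments are orthogonal: the cross term in the square is a centred function of
  \<open>X n\<close> times a \<open>past\<close>-measurable factor, so its expectation vanishes. The
  deterministic bounds \<open>b\<close> supply the integrability.\<close>

lemma martingale_L2:
  "integrable M (\<lambda>\<omega>. ((\<Sum>k<n. \<phi> k (X k \<omega>) * Y k \<omega>))\<^sup>2) \<and> expectation (\<lambda>\<omega>. ((\<Sum>k<n. \<phi> k (X k \<omega>) * Y k \<omega>))\<^sup>2) \<le> (\<Sum>k<n. expectation (\<lambda>\<omega>. (\<phi> k (X k \<omega>))\<^sup>2) * (b k)\<^sup>2)"
proof (induction n)
  case 0 show ?case by simp
next
  case (Suc n)
  let ?S = "\<lambda>n \<omega>. (\<Sum>k<n. \<phi> k (X k \<omega>) * Y k \<omega>)" and ?v = "\<lambda>k. expectation (\<lambda>\<omega>. (\<phi> k (X k \<omega>))\<^sup>2)"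
  have Sm: "(\<lambda>\<omega>. ?S n \<omega>) \<in> borel_measurable (past M X n)" by (rule martingale_past_measurable)
  have [measurable]: "(\<lambda>\<omega>. ?S n \<omega>) \<in> borel_measurable M" "Y n \<in> borel_measurable M"
    using measurable_from_past[OF Sm] measurable_from_past[OF Y] by auto
  have iS: "integrable M (\<lambda>\<omega>. ?S n \<omega>)"
    by (rule square_integrable_imp_integrable) (use Suc in auto)
  have iN: "integrable M (\<lambda>\<omega>. \<phi> n (X n \<omega>))"
    by (rule square_integrable_imp_integrable) (use sq in auto)
  have iZ: "integrable M (\<lambda>\<omega>. 2 * ?S n \<omega> * Y n \<omega>)"
  proof (rule Bochner_Integration.integrable_bound)
    show "integrable M (\<lambda>\<omega>. 2 * b n * \<bar>?S n \<omega>\<bar>)" using iS by auto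
    have "norm (2 * ?S n \<omega> * Y n \<omega>) \<le> norm (2 * b n * \<bar>?S n \<omega>\<bar>)" if "\<omega> \<in> space M" for \<omega>
    proof -
      have "\<bar>Y n \<omega>\<bar> * \<bar>2 * (\<Sum>k<n. \<phi> k (X k \<omega>) * Y k \<omega>)\<bar> \<le> b n * \<bar>2 * (\<Sum>k<n. \<phi> k (X k \<omega>) * Y k \<omega>)\<bar>"
        by (rule mult_right_mono[OF b[OF that, of n]]) simp
      also have "\<dots> \<le> \<bar>2 * b n * (\<Sum>k<n. \<phi> k (X k \<omega>) * Y k \<omega>)\<bar>" by (simp add: abs_mult mult_right_mono)
      finally show ?thesis by (simp add: abs_mult ac_simps)
    qed
    then show "AE \<omega> in M. norm (2 * ?S n \<omega> * Y n \<omega>) \<le> norm (2 * b n * \<bar>?S n \<omega>\<bar>)" by auto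
  qed measurable
  have Zm: "(\<lambda>\<omega>. 2 * ?S n \<omega> * Y n \<omega>) \<in> borel_measurable (past M X n)"
    using Sm Y[of n] by (intro borel_measurable_times) auto
  have c1: "integrable M (\<lambda>\<omega>. \<phi> n (X n \<omega>) * (2 * ?S n \<omega> * Y n \<omega>))"
    and c2: "expectation (\<lambda>\<omega>. \<phi> n (X n \<omega>) * (2 * ?S n \<omega> * Y n \<omega>)) = 0"
    using expectation_past_mult[OF \<phi> Zm iN iZ] centred by auto
  have bd: "(\<phi> n (X n \<omega>))\<^sup>2 * (Y n \<omega>)\<^sup>2 \<le> (\<phi> n (X n \<omega>))\<^sup>2 * (b n)\<^sup>2" if "\<omega> \<in> space M" for \<omega>
    using b[OF that, of n] by (intro mult_left_mono) (auto simp: abs_le_square_iff[symmetric])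
  have d1: "integrable M (\<lambda>\<omega>. (\<phi> n (X n \<omega>))\<^sup>2 * (Y n \<omega>)\<^sup>2)"
  proof (rule Bochner_Integration.integrable_bound)
    show "integrable M (\<lambda>\<omega>. (\<phi> n (X n \<omega>))\<^sup>2 * (b n)\<^sup>2)" using sq by auto
  qed (use bd in auto)
  have d2: "expectation (\<lambda>\<omega>. (\<phi> n (X n \<omega>))\<^sup>2 * (Y n \<omega>)\<^sup>2) \<le> ?v n * (b n)\<^sup>2"
  proof -
    have "expectation (\<lambda>\<omega>. (\<phi> n (X n \<omega>))\<^sup>2 * (Y n \<omega>)\<^sup>2) \<le> expectation (\<lambda>\<omega>. (\<phi> n (X n \<omega>))\<^sup>2 * (b n)\<^sup>2)"
      using sq by (intro integral_mono d1 bd) auto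
    then show ?thesis by simp
  qed
  have e: "(\<lambda>\<omega>. (?S (Suc n) \<omega>)\<^sup>2) = (\<lambda>\<omega>. (?S n \<omega>)\<^sup>2 + \<phi> n (X n \<omega>) * (2 * ?S n \<omega> * Y n \<omega>)
      + (\<phi> n (X n \<omega>))\<^sup>2 * (Y n \<omega>)\<^sup>2)"
    by (auto simp: power2_eq_square algebra_simps)
  show ?case unfolding e using Suc c1 c2 d1 d2 by simp
qed

end

text \<open>Proved by stopping: the weights are switched off once the deviation reaches \<epsilon>,
  and Markov's inequality is applied to the square of the stopped sum, which is again a martingale
  transform covered by \<open>martingale_L2\<close>.\<close>

lemma Kolmogorov_maximal:
  fixes \<phi> :: "nat \<Rightarrow> real \<Rightarrow> real" and Y :: "nat \<Rightarrow> 'a \<Rightarrow> real" and b :: "nat \<Rightarrow> real"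
  assumes \<phi> [measurable]: "\<And>k. \<phi> k \<in> borel_measurable borel"
    and sq: "\<And>k. integrable M (\<lambda>\<omega>. (\<phi> k (X k \<omega>))\<^sup>2)"
    and centred: "\<And>k. expectation (\<lambda>\<omega>. \<phi> k (X k \<omega>)) = 0"
    and Y: "\<And>k. Y k \<in> borel_measurable (past M X k)"
    and b: "\<And>k \<omega>. \<omega> \<in> space M \<Longrightarrow> \<bar>Y k \<omega>\<bar> \<le> b k"
    and "\<epsilon> > 0" and "m \<le> n"
  defines "S \<equiv> \<lambda>n \<omega>. (\<Sum>k<n. \<phi> k (X k \<omega>) * Y k \<omega>)"
  shows "prob {\<omega>\<in>space M. \<exists>k\<in>{m..n}. \<epsilon> \<le> \<bar>S k \<omega> - S m \<omega>\<bar>}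
    \<le> (\<Sum>k=m..<n. expectation (\<lambda>\<omega>. (\<phi> k (X k \<omega>))\<^sup>2) * (b k)\<^sup>2) / \<epsilon>\<^sup>2"
proof -
  \<comment> \<open>\<open>Y' k\<close> inspects \<open>S j\<close> for \<open>j \<le> k\<close>
    only, hence noise with index below \<open>k\<close>; stopping keeps the weights
    predictable.\<close>
  define Y' where "Y' = (\<lambda>k \<omega>. if m \<le> k \<and> (\<forall>j\<in>{m..k}. \<bar>S j \<omega> - S m \<omega>\<bar> < \<epsilon>) then Y k \<omega> else 0)"
  define b' where "b' = (\<lambda>k. if m \<le> k then b k else 0)"
  have Spast: "S j \<in> borel_measurable (past M X k)" if "j \<le> k" for j k
    unfolding S_def using martingale_past_measurable[OF assms(1-5)] measurable_past_mono that by blast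
  have Y'past: "Y' k \<in> borel_measurable (past M X k)" for k
  proof (cases "m \<le> k")
    case True
    have "{\<omega> \<in> space (past M X k). \<forall>j\<in>{m..k}. \<bar>S j \<omega> - S m \<omega>\<bar> < \<epsilon>} \<in> sets (past M X k)"
    proof (rule sets.sets_Collect_finite_All)
      fix j assume "j \<in> {m..k}"
      then have "S j \<in> borel_measurable (past M X k)" "S m \<in> borel_measurable (past M X k)"
        using Spast True by auto
      then show "{\<omega> \<in> space (past M X k). \<bar>S j \<omega> - S m \<omega>\<bar> < \<epsilon>} \<in> sets (past M X k)"
        by measurable
    qed simp
    then show ?thesis unfolding Y'_def using True Y[of k]
      by (intro measurable_If) (auto simp: pred_def)
  next
    case False then show ?thesis by (simp add: Y'_def)
  qed
  have Y'b: "\<bar>Y' k \<omega>\<bar> \<le> b' k" if "\<omega> \<in> space M" for k \<omega>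
    using b[OF that, of k] by (auto simp: Y'_def b'_def)
  let ?S' = "\<lambda>\<omega>. (\<Sum>k<n. \<phi> k (X k \<omega>) * Y' k \<omega>)"
  have L2: "integrable M (\<lambda>\<omega>. (?S' \<omega>)\<^sup>2)"
    "expectation (\<lambda>\<omega>. (?S' \<omega>)\<^sup>2) \<le> (\<Sum>k<n. expectation (\<lambda>\<omega>. (\<phi> k (X k \<omega>))\<^sup>2) * (b' k)\<^sup>2)"
    using martingale_L2[OF \<phi> sq centred Y'past Y'b] by auto
  \<comment> \<open>At the first passage time \<open>k0\<close> the stopped sum freezes at
    \<open>S k0 - S m\<close>, so an excursion anywhere in \<open>{m..n}\<close> is still visible at
    time \<open>n\<close>.\<close>
  have stopped: "\<epsilon> \<le> \<bar>?S' \<omega>\<bar>" if w: "k \<in> {m..n}" "\<epsilon> \<le> \<bar>S k \<omega> - S m \<omega>\<bar>" for k \<omega>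
  proof -
    let ?P = "\<lambda>k. m \<le> k \<and> \<epsilon> \<le> \<bar>S k \<omega> - S m \<omega>\<bar>"
    define k0 where "k0 = (LEAST k. ?P k)"
    have k0: "?P k0" unfolding k0_def by (rule LeastI[of ?P k]) (use w in auto)
    have le: "k0 \<le> n" using Least_le[of ?P k] w by (auto simp: k0_def)
    have less: "\<bar>S j \<omega> - S m \<omega>\<bar> < \<epsilon>" if "m \<le> j" "j < k0" for j
      using not_less_Least[of j ?P] that by (auto simp: k0_def)
    have "?S' \<omega> = (\<Sum>k\<in>{m..<k0}. \<phi> k (X k \<omega>) * Y k \<omega>)"
    proof (rule sum.mono_neutral_cong_right)
      show "\<forall>i\<in>{..<n} - {m..<k0}. \<phi> i (X i \<omega>) * Y' i \<omega> = 0"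
        using k0 by (force simp: Y'_def not_less)
      show "\<phi> i (X i \<omega>) * Y' i \<omega> = \<phi> i (X i \<omega>) * Y i \<omega>" if "i \<in> {m..<k0}" for i
        using that less by (force simp: Y'_def)
    qed (use le in auto)
    also have "\<dots> = S k0 \<omega> - S m \<omega>"
      unfolding S_def using k0 sum_diff_nat_ivl[of 0 m k0 "\<lambda>k. \<phi> k (X k \<omega>) * Y k \<omega>"]
      by (simp add: lessThan_atLeast0)
    finally show ?thesis using k0 by simp
  qed
  have Y'M [measurable]: "Y' k \<in> borel_measurable M" for k
    using measurable_from_past[OF Y'past] by simp
  have YM [measurable]: "Y k \<in> borel_measurable M" for k
    using measurable_from_past[OF Y] by simp
  have SM [measurable]: "S k \<in> borel_measurable M" for k
    unfolding S_def by measurable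
  have "prob {\<omega>\<in>space M. \<exists>k\<in>{m..n}. \<epsilon> \<le> \<bar>S k \<omega> - S m \<omega>\<bar>} \<le> prob {\<omega>\<in>space M. (?S' \<omega>)\<^sup>2 \<ge> \<epsilon>\<^sup>2}"
  proof (rule finite_measure_mono)
    show "{\<omega>\<in>space M. \<exists>k\<in>{m..n}. \<epsilon> \<le> \<bar>S k \<omega> - S m \<omega>\<bar>} \<subseteq> {\<omega>\<in>space M. (?S' \<omega>)\<^sup>2 \<ge> \<epsilon>\<^sup>2}"
    proof safe
      fix \<omega> k assume "k \<in> {m..n}" "\<epsilon> \<le> \<bar>S k \<omega> - S m \<omega>\<bar>"
      from stopped[OF this] show "\<epsilon>\<^sup>2 \<le> (?S' \<omega>)\<^sup>2" using \<open>\<epsilon> > 0\<close>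
        by (simp add: abs_le_square_iff[symmetric])
    qed
  qed measurable
  also have "\<dots> \<le> expectation (\<lambda>\<omega>. (?S' \<omega>)\<^sup>2) / \<epsilon>\<^sup>2"
    using L2 \<open>\<epsilon> > 0\<close> by (intro integral_Markov_inequality_measure[where A="{}"]) auto
  also have "\<dots> \<le> (\<Sum>k<n. expectation (\<lambda>\<omega>. (\<phi> k (X k \<omega>))\<^sup>2) * (b' k)\<^sup>2) / \<epsilon>\<^sup>2"
    using L2 by (intro divide_right_mono) auto
  also have "(\<Sum>k<n. expectation (\<lambda>\<omega>. (\<phi> k (X k \<omega>))\<^sup>2) * (b' k)\<^sup>2)
      = (\<Sum>k=m..<n. expectation (\<lambda>\<omega>. (\<phi> k (X k \<omega>))\<^sup>2) * (b k)\<^sup>2)"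
    by (rule sum.mono_neutral_cong_right) (auto simp: b'_def)
  finally show ?thesis .
qed

text \<open>By the maximal inequality, the probability that the partial sums ever move by
  \<open>e\<close> after time \<open>m\<close> is at most a tail of the variance series over
  \<open>e^2\<close>, which tends to 0. Countably many \<open>e\<close> give the Cauchy
  property.\<close>

lemma AE_summable_martingale:
  fixes \<phi> :: "nat \<Rightarrow> real \<Rightarrow> real" and Y :: "nat \<Rightarrow> 'a \<Rightarrow> real" and b :: "nat \<Rightarrow> real"
  assumes \<phi> [measurable]: "\<And>k. \<phi> k \<in> borel_measurable borel"
    and sq: "\<And>k. integrable M (\<lambda>\<omega>. (\<phi> k (X k \<omega>))\<^sup>2)"
    and centred: "\<And>k. expectation (\<lambda>\<omega>. \<phi> k (X k \<omega>)) = 0"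
    and Y: "\<And>k. Y k \<in> borel_measurable (past M X k)"
    and b: "\<And>k \<omega>. \<omega> \<in> space M \<Longrightarrow> \<bar>Y k \<omega>\<bar> \<le> b k"
    and sum: "summable (\<lambda>k. expectation (\<lambda>\<omega>. (\<phi> k (X k \<omega>))\<^sup>2) * (b k)\<^sup>2)"
  shows "AE \<omega> in M. summable (\<lambda>k. \<phi> k (X k \<omega>) * Y k \<omega>)"
proof -
  define S where "S = (\<lambda>n \<omega>. (\<Sum>k<n. \<phi> k (X k \<omega>) * Y k \<omega>))"
  define t where "t = (\<lambda>k. expectation (\<lambda>\<omega>. (\<phi> k (X k \<omega>))\<^sup>2) * (b k)\<^sup>2)"
  have t0: "t k \<ge> 0" for k by (auto simp: t_def)
  have YM [measurable]: "Y k \<in> borel_measurable M" for k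
    using measurable_from_past[OF Y] by simp
  have SM [measurable]: "S k \<in> borel_measurable M" for k
    unfolding S_def by measurable
  have st: "summable t" using sum by (simp add: t_def)
  have tail: "(\<lambda>m. \<Sum>k. t (k + m)) \<longlonglongrightarrow> 0" using st by (rule suminf_exist_split2)
  have small: "AE \<omega> in M. \<exists>m. \<forall>k\<ge>m. \<bar>S k \<omega> - S m \<omega>\<bar> < e" if "e > 0" for e
  proof -
    define B where "B = (\<lambda>m. {\<omega>\<in>space M. \<exists>k\<ge>m. e \<le> \<bar>S k \<omega> - S m \<omega>\<bar>})"
    have [measurable]: "B m \<in> events" for m unfolding B_def by measurable
    have Bm: "prob (B m) \<le> (\<Sum>k. t (k + m)) / e\<^sup>2" for m
    proof -
      \<comment> \<open>The maximal inequality covers finite windows; the events \<open>?A i\<close>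
        increase to \<open>B m\<close>, and continuity from below carries the bound over.\<close>
      let ?A = "\<lambda>i. {\<omega>\<in>space M. \<exists>k\<in>{m..m+i}. e \<le> \<bar>S k \<omega> - S m \<omega>\<bar>}"
      have "(\<lambda>i. prob (?A i)) \<longlonglongrightarrow> prob (\<Union>i. ?A i)"
      proof (rule finite_Lim_measure_incseq)
        show "range ?A \<subseteq> events" by auto
        show "incseq ?A" by (rule incseq_SucI) force
      qed
      moreover have "(\<Union>i. ?A i) = B m"
        unfolding B_def by (auto) (metis atLeastAtMost_iff le_add_diff_inverse order_refl)
      moreover have "prob (?A i) \<le> (\<Sum>k. t (k + m)) / e\<^sup>2" for i
      proof -
        have "prob (?A i) \<le> (\<Sum>k=m..<m+i. t k) / e\<^sup>2"
          unfolding S_def t_def using Kolmogorov_maximal[OF \<phi> sq centred Y b \<open>e > 0\<close>, of m "m+i"] by simp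
        also have "(\<Sum>k=m..<m+i. t k) = (\<Sum>k<i. t (k + m))"
          using sum.shift_bounds_nat_ivl[of t 0 m i] by (simp add: lessThan_atLeast0 add.commute)
        also have "\<dots> \<le> (\<Sum>k. t (k + m))"
          using st t0 by (intro sum_le_suminf) (auto simp: summable_iff_shift)
        finally show ?thesis by (simp add: divide_right_mono)
      qed
      ultimately show ?thesis by (intro LIMSEQ_le_const2[of "\<lambda>i. prob (?A i)"]) auto
    qed
    have "(\<Inter>m. B m) \<in> events" by auto
    moreover have "prob (\<Inter>m. B m) \<le> 0"
    proof (rule LIMSEQ_le_const)
      show "(\<lambda>m. (\<Sum>k. t (k + m)) / e\<^sup>2) \<longlonglongrightarrow> 0" using tendsto_divide[OF tail tendsto_const[of "e\<^sup>2"]] that by simp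
      have "prob (\<Inter>m. B m) \<le> prob (B m)" for m by (intro finite_measure_mono) auto
      then show "\<exists>N. \<forall>n\<ge>N. prob (\<Inter>m. B m) \<le> (\<Sum>k. t (k + n)) / e\<^sup>2"
        using Bm by (meson order_trans)
    qed
    ultimately have "(\<Inter>m. B m) \<in> null_sets M"
      by (simp add: measure_le_0_iff emeasure_eq_measure null_sets_def)
    from AE_not_in[OF this] AE_space show ?thesis
    proof eventually_elim
      case (elim \<omega>)
      then obtain m where "\<omega> \<notin> B m" by auto
      with elim(2) have "\<forall>k\<ge>m. \<bar>S k \<omega> - S m \<omega>\<bar> < e" unfolding B_def by (force simp: not_le)
      then show ?case by blast
    qed
  qed
  have "AE \<omega> in M. \<forall>i. \<exists>m. \<forall>k\<ge>m. \<bar>S k \<omega> - S m \<omega>\<bar> < inverse (real (Suc i))"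
    unfolding AE_all_countable by (intro allI small) auto
  then show ?thesis
  proof eventually_elim
    case (elim \<omega>)
    have "Cauchy (\<lambda>n. S n \<omega>)"
    proof (rule metric_CauchyI)
      fix e :: real assume "e > 0"
      then obtain i where i: "inverse (real (Suc i)) < e / 2" using reals_Archimedean half_gt_zero by blast
      from elim obtain m where m: "\<And>k. k\<ge>m \<Longrightarrow> \<bar>S k \<omega> - S m \<omega>\<bar> < inverse (real (Suc i))" by blast
      have "dist (S k \<omega>) (S l \<omega>) < e" if "k \<ge> m" "l \<ge> m" for k l
        using m[OF that(1)] m[OF that(2)] i by (simp add: dist_real_def)
      then show "\<exists>M. \<forall>m\<ge>M. \<forall>n\<ge>M. dist (S m \<omega>) (S n \<omega>) < e" by blast
    qed
    then show ?case by (simp add: summable_iff_convergent S_def Cauchy_convergent_iff)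
  qed
qed

lemma AE_summable_nonneg:
  fixes N :: "nat \<Rightarrow> 'a \<Rightarrow> real"
  assumes int: "\<And>k. integrable M (N k)" and nn: "\<And>k \<omega>. N k \<omega> \<ge> 0"
    and sum: "summable (\<lambda>k. expectation (N k))"
  shows "AE \<omega> in M. summable (\<lambda>k. N k \<omega>)"
proof -
  have [measurable]: "N k \<in> borel_measurable M" for k using int by auto
  have e0: "expectation (N k) \<ge> 0" for k using nn by auto
  have "(\<integral>\<^sup>+\<omega>. (\<Sum>k. ennreal (N k \<omega>)) \<partial>M) = (\<Sum>k. \<integral>\<^sup>+\<omega>. ennreal (N k \<omega>) \<partial>M)"
    by (rule nn_integral_suminf) measurable
  also have "\<dots> = (\<Sum>k. ennreal (expectation (N k)))"
    using int nn by (intro arg_cong[where f=suminf] ext nn_integral_eq_integral) auto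
  also have "\<dots> = ennreal (\<Sum>k. expectation (N k))"
    by (rule suminf_ennreal2[OF e0 sum])
  finally have "(\<integral>\<^sup>+\<omega>. (\<Sum>k. ennreal (N k \<omega>)) \<partial>M) \<noteq> \<infinity>" by simp
  then have "AE \<omega> in M. (\<Sum>k. ennreal (N k \<omega>)) \<noteq> \<infinity>"
    by (intro nn_integral_noteq_infinite) measurable
  then show ?thesis
  proof eventually_elim
    case (elim \<omega>)
    then show ?case using nn by (intro summable_suminf_not_top) auto
  qed
qed

end

section \<open>Summation by parts and averages of oscillating sequences\<close>

text \<open>Recovers the size of a sum from a bounded sum in which increasing weights were divided
  out, as in Kronecker's lemma. The boundary term contributes \<open>B * a n\<close>, the
  telescoping increments of \<open>a\<close> at most as much again.\<close>

lemma Abel_summation_bound: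
  fixes x :: "nat \<Rightarrow> 'a::real_normed_vector" and a :: "nat \<Rightarrow> real"
  assumes a: "\<And>k. a k \<ge> 0" "incseq a" and B: "\<And>n. norm (\<Sum>k<n. x k) \<le> B"
  shows "norm (\<Sum>k<n. a k *\<^sub>R x k) \<le> 2 * B * a n"
proof -
  let ?X = "\<lambda>n. \<Sum>k<n. x k"
  have "(\<Sum>k<n. a k *\<^sub>R x k) = a n *\<^sub>R ?X n - (\<Sum>k<n. (a (Suc k) - a k) *\<^sub>R ?X (Suc k))"
    by (induction n) (simp_all add: algebra_simps)
  also have "norm \<dots> \<le> norm (a n *\<^sub>R ?X n) + norm (\<Sum>k<n. (a (Suc k) - a k) *\<^sub>R ?X (Suc k))"
    by (rule norm_triangle_ineq4)
  also have "norm (\<Sum>k<n. (a (Suc k) - a k) *\<^sub>R ?X (Suc k)) \<le> (\<Sum>k<n. (a (Suc k) - a k) * B)"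
  proof (rule sum_norm_le)
    fix k
    have "a (Suc k) - a k \<ge> 0" using a(2) by (simp add: incseq_SucD)
    then show "norm ((a (Suc k) - a k) *\<^sub>R ?X (Suc k)) \<le> (a (Suc k) - a k) * B"
      using B[of "Suc k"] by (simp only: norm_scaleR abs_of_nonneg mult_left_mono)
  qed
  also have "\<dots> = (a n - a 0) * B"
    by (simp add: sum_distrib_right[symmetric] sum_lessThan_telescope)
  also have "norm (a n *\<^sub>R ?X n) \<le> a n * B"
    using a B[of n] by (simp add: mult_left_mono)
  also have "a n * B + (a n - a 0) * B \<le> 2 * B * a n"
    using a(1)[of 0] B[of 0] by (simp add: algebra_simps)
  finally show ?thesis by simp
qed

text \<open>The reverse direction: bounded sums with growing weights force small tails. Each
  weighted block is a difference of two partial sums, hence at most \<open>2 * B\<close>, and the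
  decreasing factors \<open>1 / a k\<close> telescope to \<open>1 / a n\<close>; the constant 4
  leaves room.\<close>

lemma Abel_tail_bound:
  fixes d :: "nat \<Rightarrow> 'a::real_normed_vector" and a :: "nat \<Rightarrow> real"
  assumes a: "\<And>k. a k > 0" "incseq a" and B: "\<And>n. norm (\<Sum>k<n. a k *\<^sub>R d k) \<le> B" and "n \<le> m"
  shows "norm (\<Sum>k=n..<m. d k) \<le> 4 * B / a n"
proof -
  let ?X = "\<lambda>m. \<Sum>k=n..<m. a k *\<^sub>R d k"
  have X: "norm (?X m) \<le> 2 * B" for m
  proof (cases "n \<le> m")
    case True
    then have "?X m = (\<Sum>k<m. a k *\<^sub>R d k) - (\<Sum>k<n. a k *\<^sub>R d k)"
      using sum_diff_nat_ivl[of 0 n m "\<lambda>k. a k *\<^sub>R d k"] by (simp add: lessThan_atLeast0)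
    then show ?thesis using norm_triangle_ineq4[of "\<Sum>k<m. a k *\<^sub>R d k" "\<Sum>k<n. a k *\<^sub>R d k"] B[of n] B[of m]
      by (metis (no_types, lifting) add_mono mult_2 order_trans)
  next
    case False
    then show ?thesis using B[of 0] by simp
  qed
  have dec: "1 / a (Suc k) \<le> 1 / a k" for k
    using a(1)[of k] incseq_SucD[OF a(2), of k] by (simp add: frac_le)
  have "(\<Sum>k=n..<m. d k) = (1 / a m) *\<^sub>R ?X m + (\<Sum>k=n..<m. (1 / a k - 1 / a (Suc k)) *\<^sub>R ?X (Suc k))
     \<and> (\<Sum>k=n..<m. (1 / a k - 1 / a (Suc k)) * (2 * B)) = (1 / a n - 1 / a m) * (2 * B)"
    using \<open>n \<le> m\<close>
  proof (induction m rule: dec_induct)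
    case base then show ?case by simp
  next
    case (step m)
    have "a m \<noteq> 0" using a(1)[of m] by simp
    then have "d m = (1 / a m) *\<^sub>R (?X (Suc m) - ?X m)" using step by simp
    then show ?case using step by (simp add: algebra_simps)
  qed
  then have e: "(\<Sum>k=n..<m. d k) = (1 / a m) *\<^sub>R ?X m + (\<Sum>k=n..<m. (1 / a k - 1 / a (Suc k)) *\<^sub>R ?X (Suc k))"
    and f: "(\<Sum>k=n..<m. (1 / a k - 1 / a (Suc k)) * (2 * B)) = (1 / a n - 1 / a m) * (2 * B)" by auto
  have "norm (\<Sum>k=n..<m. (1 / a k - 1 / a (Suc k)) *\<^sub>R ?X (Suc k)) \<le> (1 / a n - 1 / a m) * (2 * B)"
    unfolding f[symmetric]
  proof (rule sum_norm_le)
    fix k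
    show "norm ((1 / a k - 1 / a (Suc k)) *\<^sub>R ?X (Suc k)) \<le> (1 / a k - 1 / a (Suc k)) * (2 * B)"
      using mult_left_mono[OF X[of "Suc k"], of "1 / a k - 1 / a (Suc k)"] dec[of k] by simp
  qed
  moreover have "norm ((1 / a m) *\<^sub>R ?X m) \<le> (1 / a m) * (2 * B)"
    using mult_left_mono[OF X[of m], of "1 / a m"] a(1)[of m] by simp
  ultimately have "norm (\<Sum>k=n..<m. d k) \<le> (1 / a m) * (2 * B) + (1 / a n - 1 / a m) * (2 * B)"
    unfolding e by (intro order_trans[OF norm_triangle_ineq] add_mono)
  also have "\<dots> \<le> 4 * B / a n" using B[of 0] a(1)[of n] by (simp add: field_simps)
  finally show ?thesis .
qed

text \<open>Source of the rate: a bound on the increments of \<rho> summed with weights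
  \<open>a\<close> yields both the limit and the distance \<open>O(1 / a n)\<close> to it.\<close>

lemma convergent_Abel_tail:
  fixes \<rho> :: "nat \<Rightarrow> complex" and a :: "nat \<Rightarrow> real"
  assumes a: "\<And>k. a k > 0" "incseq a" "filterlim a at_top sequentially"
    and B: "\<And>n. norm (\<Sum>k<n. a k *\<^sub>R (\<rho> (Suc k) - \<rho> k)) \<le> B"
  shows "\<exists>l. \<rho> \<longlonglongrightarrow> l \<and> (\<forall>n. norm (\<rho> n - l) \<le> 4 * B / a n)"
proof -
  have d: "norm (\<rho> m - \<rho> n) \<le> 4 * B / a n" if "n \<le> m" for n m
    using Abel_tail_bound[OF a(1,2) B that] sum_Suc_diff'[OF that, of \<rho>] by simp
  have lim: "(\<lambda>n. 4 * B / a n) \<longlonglongrightarrow> 0"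
    by (rule tendsto_divide_0[OF tendsto_const]) (rule filterlim_at_top_imp_at_infinity[OF a(3)])
  have "Cauchy \<rho>"
  proof (rule CauchyI')
    fix e :: real assume "e > 0"
    with lim have "\<forall>\<^sub>F n in sequentially. 4 * B / a n < e" by (auto dest: order_tendstoD)
    then obtain N where N: "\<And>n. n \<ge> N \<Longrightarrow> 4 * B / a n < e" by (auto simp: eventually_sequentially)
    show "\<exists>M. \<forall>m\<ge>M. \<forall>n>m. dist (\<rho> m) (\<rho> n) < e"
    proof (intro exI[of _ N] allI impI)
      fix m n assume "N \<le> m" "m < n"
      then show "dist (\<rho> m) (\<rho> n) < e"
        using N[of m] d[of m n] by (simp add: dist_norm norm_minus_commute)
    qed
  qed
  then obtain l where l: "\<rho> \<longlonglongrightarrow> l" using Cauchy_convergent_iff convergent_def by blast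
  have "norm (\<rho> n - l) \<le> 4 * B / a n" for n
  proof (rule LIMSEQ_le_const2)
    show "(\<lambda>m. norm (\<rho> n - \<rho> m)) \<longlonglongrightarrow> norm (\<rho> n - l)" by (intro tendsto_intros l)
    show "\<exists>N. \<forall>m\<ge>N. norm (\<rho> n - \<rho> m) \<le> 4 * B / a n"
      using d[of n] by (intro exI[of _ n]) (simp add: norm_minus_commute)
  qed
  with l show ?thesis by blast
qed

section \<open>Weighted, Cesaro and logarithmic means\<close>

lemma weighted_Cesaro:
  fixes x :: "nat \<Rightarrow> 'a::real_normed_vector" and w :: "nat \<Rightarrow> real"
  assumes w: "\<And>k. w k \<ge> 0" "filterlim (\<lambda>n. \<Sum>k<n. w k) at_top sequentially" and x: "x \<longlonglongrightarrow> 0"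
  shows "(\<lambda>n. (1 / (\<Sum>k<n. w k)) *\<^sub>R (\<Sum>k<n. w k *\<^sub>R x k)) \<longlonglongrightarrow> 0"
proof (rule LIMSEQ_I)
  fix e :: real assume e: "e > 0"
  obtain N where N: "\<And>n. n \<ge> N \<Longrightarrow> norm (x n) < e / 2"
    using LIMSEQ_D[OF x, of "e / 2"] e by auto
  let ?W = "\<lambda>n. \<Sum>k<n. w k"
  let ?C = "norm (\<Sum>k<N. w k *\<^sub>R x k)"
  have "eventually (\<lambda>n. ?W n > max 0 (2 * ?C / e)) sequentially"
    using w(2) unfolding filterlim_at_top_dense by blast
  then obtain M where M: "\<And>n. n \<ge> M \<Longrightarrow> ?W n > max 0 (2 * ?C / e)"
    by (auto simp: eventually_sequentially)
  show "\<exists>no. \<forall>n\<ge>no. norm ((1 / ?W n) *\<^sub>R (\<Sum>k<n. w k *\<^sub>R x k) - 0) < e"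
  proof (intro exI[of _ "max M N"] allI impI)
    fix n assume n: "n \<ge> max M N"
    have "max 0 (2 * ?C / e) < ?W n" using M[of n] n by simp
    then have W: "?W n > 0" and "2 * ?C / e < ?W n" unfolding max_less_iff_conj by blast+
    then have W': "?C < e / 2 * ?W n" using e by (simp add: pos_divide_less_eq mult.commute)
    have "(\<Sum>k<n. w k *\<^sub>R x k) = (\<Sum>k<N. w k *\<^sub>R x k) + (\<Sum>k=N..<n. w k *\<^sub>R x k)"
      using n sum.atLeastLessThan_concat[of 0 N n "\<lambda>k. w k *\<^sub>R x k"] by (simp add: lessThan_atLeast0)
    then have "norm (\<Sum>k<n. w k *\<^sub>R x k) \<le> ?C + norm (\<Sum>k=N..<n. w k *\<^sub>R x k)"
      by (simp add: norm_triangle_ineq)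
    also have "norm (\<Sum>k=N..<n. w k *\<^sub>R x k) \<le> (\<Sum>k=N..<n. w k * (e / 2))"
    proof (rule sum_norm_le)
      fix k assume "k \<in> {N..<n}"
      then show "norm (w k *\<^sub>R x k) \<le> w k * (e / 2)"
        using w(1)[of k] N[of k] by (simp add: mult_left_mono less_imp_le del: times_divide_eq_right)
    qed
    also have "\<dots> \<le> (\<Sum>k<n. w k * (e / 2))"
      using w(1) e by (intro sum_mono2) auto
    also have "\<dots> = e / 2 * ?W n" by (simp add: sum_distrib_left mult.commute)
    finally have "norm (\<Sum>k<n. w k *\<^sub>R x k) < e * ?W n" using W' by linarith
    then show "norm ((1 / ?W n) *\<^sub>R (\<Sum>k<n. w k *\<^sub>R x k) - 0) < e"
      using W by (simp add: field_simps)
  qed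
qed

lemma Cesaro_null:
  fixes x :: "nat \<Rightarrow> 'a::real_normed_vector"
  assumes "x \<longlonglongrightarrow> 0"
  shows "(\<lambda>n. (\<Sum>k<n. x k) /\<^sub>R real n) \<longlonglongrightarrow> 0"
  using weighted_Cesaro[of "\<lambda>_. 1" x] assms by (simp add: filterlim_real_sequentially inverse_eq_divide)

lemma harmonic_at_top: "filterlim (\<lambda>n. \<Sum>k<n. 1 / real (Suc k)) at_top sequentially"
proof -
  have "(\<lambda>n. \<Sum>k<n. 1 / real (Suc k)) = harm"
    by (auto simp: harm_def fun_eq_iff inverse_eq_divide intro!: sum.reindex_bij_witness[of _ "\<lambda>k. k - 1" Suc])
  then show ?thesis using harm_at_top by simp
qed

lemma harmonic_ln_ratio: "(\<lambda>n. (\<Sum>k<n. 1 / real (Suc k)) / ln (real n)) \<longlonglongrightarrow> 1"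
proof -
  have e: "(\<Sum>k<n. 1 / real (Suc k)) = harm n" for n
    by (auto simp: harm_def inverse_eq_divide intro!: sum.reindex_bij_witness[of _ "\<lambda>k. k - 1" Suc])
  have "(\<lambda>n. (harm n - ln (real n)) / ln (real n) :: real) \<longlonglongrightarrow> 0"
    using euler_mascheroni_LIMSEQ by (rule tendsto_divide_0) real_asymp
  then have "(\<lambda>n. (harm n - ln (real n)) / ln (real n) + 1 :: real) \<longlonglongrightarrow> 0 + 1"
    by (intro tendsto_add tendsto_const)
  moreover have "eventually (\<lambda>n. (harm n - ln (real n)) / ln (real n) + 1 = harm n / ln (real n)) sequentially"
    using eventually_gt_at_top[of 1] by eventually_elim (simp add: field_simps)
  ultimately show ?thesis unfolding e by (simp add: tendsto_cong)
qed

text \<open>With harmonic weights \<open>1 / (k + 1)\<close>, the term \<open>c k\<close> is a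
  weight times a sequence tending to \<open>L\<close>, and the total weight is asymptotic to
  \<open>ln n\<close>.\<close>

lemma weighted_sum_ln_limit:
  fixes c :: "nat \<Rightarrow> real"
  assumes "(\<lambda>k. real (Suc k) * c k) \<longlonglongrightarrow> L"
  shows "(\<lambda>n. (\<Sum>k<n. c k) / ln (real n)) \<longlonglongrightarrow> L"
proof -
  let ?H = "\<lambda>n. \<Sum>k<n. 1 / real (Suc k)"
  have "(1 / real (Suc k)) * (real (Suc k) * c k - L) = c k - L * (1 / real (Suc k))" for k
    by (simp add: field_simps del: of_nat_Suc)
  moreover have "(\<lambda>n. (1 / ?H n) *\<^sub>R (\<Sum>k<n. (1 / real (Suc k)) *\<^sub>R (real (Suc k) * c k - L))) \<longlonglongrightarrow> 0"
    using assms by (intro weighted_Cesaro harmonic_at_top) (auto simp: LIM_zero)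
  ultimately have "(\<lambda>n. 1 / ?H n * (\<Sum>k<n. c k - L * (1 / real (Suc k)))) \<longlonglongrightarrow> 0"
    by (simp only: real_scaleR_def)
  then have l: "(\<lambda>n. ?H n / ln (real n) * (1 / ?H n * (\<Sum>k<n. c k - L * (1 / real (Suc k)))
       + L)) \<longlonglongrightarrow> 1 * (0 + L)"
    by (intro tendsto_mult harmonic_ln_ratio tendsto_add tendsto_const)
  have "eventually (\<lambda>n. ?H n > 0) sequentially"
    using harmonic_at_top by (auto simp: filterlim_at_top_dense)
  then have "eventually (\<lambda>n. ?H n / ln (real n) * (1 / ?H n * (\<Sum>k<n. c k - L * (1 / real (Suc k))) + L)
       = (\<Sum>k<n. c k) / ln (real n)) sequentially"
  proof eventually_elim
    case (elim n)
    have "(\<Sum>k<n. c k - L * (1 / real (Suc k))) = (\<Sum>k<n. c k) - L * ?H n"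
      by (simp only: sum_subtractf sum_distrib_left)
    moreover have "H / y * (1 / H * (C - L * H) + L) = C / y" if "H > 0" for H y C :: real
      using that by (simp add: field_simps)
    ultimately show ?case using elim by simp
  qed
  from Lim_transform_eventually[OF l this] show ?thesis by simp
qed

text \<open>Oscillation is controlled in Cesaro mean, whereas the drift carries a factor
  \<open>1 / k\<close>; this bridges the two.\<close>

lemma Cesaro_null_imp_log_mean_null:
  fixes x :: "nat \<Rightarrow> 'a::real_normed_vector"
  assumes "(\<lambda>n. (\<Sum>k<n. x k) /\<^sub>R real n) \<longlonglongrightarrow> 0"
  shows "(\<lambda>n. (\<Sum>k<n. (1 / real (Suc k)) *\<^sub>R x k) /\<^sub>R ln (real n)) \<longlonglongrightarrow> 0"
proof -
  let ?A = "\<lambda>n. (\<Sum>k<n. x k) /\<^sub>R real n" and ?H = "\<lambda>n. \<Sum>k<n. 1 / real (Suc k)"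
  \<comment> \<open>Exact summation by parts: a harmonic sum of \<open>x\<close> is a Cesaro mean
    plus the harmonic sum of the Cesaro means.\<close>
  have e: "(\<Sum>k<n. (1 / real (Suc k)) *\<^sub>R x k) = ?A n + (\<Sum>k<n. (1 / real (Suc k)) *\<^sub>R ?A k)" for n
  proof (induction n)
    case (Suc n)
    have "?A (Suc n) + (\<Sum>k<Suc n. (1 / real (Suc k)) *\<^sub>R ?A k)
      = (1 / real (Suc n)) *\<^sub>R x n + ((1 / real (Suc n)) *\<^sub>R (\<Sum>k<n. x k) + (1 / real (Suc n)) *\<^sub>R ?A n)
         + (\<Sum>k<n. (1 / real (Suc k)) *\<^sub>R ?A k)"
      by (simp add: algebra_simps inverse_eq_divide)
    also have "(1 / real (Suc n)) *\<^sub>R (\<Sum>k<n. x k) + (1 / real (Suc n)) *\<^sub>R ?A n = ?A n"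
    proof (cases "n = 0")
      case False
      then have "1 / real (Suc n) + 1 / real (Suc n) * (1 / real n) = 1 / real n"
        by (simp add: field_simps add_nonneg_eq_0_iff)
      then show ?thesis
        by (metis (no_types, lifting) inverse_eq_divide scaleR_add_left scaleR_scaleR)
    qed simp
    finally show ?case using Suc by (simp add: add_ac)
  qed simp
  have "(\<lambda>n. (1 / ?H n) *\<^sub>R (\<Sum>k<n. (1 / real (Suc k)) *\<^sub>R ?A k)) \<longlonglongrightarrow> 0"
    using assms by (intro weighted_Cesaro harmonic_at_top) auto
  then have "(\<lambda>n. (?H n / ln (real n)) *\<^sub>R ((1 / ?H n) *\<^sub>R (\<Sum>k<n. (1 / real (Suc k)) *\<^sub>R ?A k))
       + (1 / ln (real n)) *\<^sub>R ?A n) \<longlonglongrightarrow> 1 *\<^sub>R 0 + 0 *\<^sub>R 0"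
    by (intro tendsto_add tendsto_scaleR harmonic_ln_ratio assms) (simp, real_asymp)
  moreover have "eventually (\<lambda>n. ?H n > 0) sequentially"
    using harmonic_at_top by (auto simp: filterlim_at_top_dense)
  then have "eventually (\<lambda>n. (?H n / ln (real n)) *\<^sub>R ((1 / ?H n) *\<^sub>R (\<Sum>k<n. (1 / real (Suc k)) *\<^sub>R ?A k))
       + (1 / ln (real n)) *\<^sub>R ?A n = (\<Sum>k<n. (1 / real (Suc k)) *\<^sub>R x k) /\<^sub>R ln (real n)) sequentially"
  proof eventually_elim
    case (elim n)
    then show ?case by (subst e) (simp add: algebra_simps inverse_eq_divide)
  qed
  ultimately show ?thesis by (simp add: tendsto_cong)
qed

section \<open>Van der Corput's inequality and slowly varying phases\<close>

lemma van_der_Corput: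
  fixes a :: "nat \<Rightarrow> complex"
  assumes bd: "\<And>n. norm (a n) \<le> 1"
    and corr: "\<And>h k. h \<noteq> k \<Longrightarrow> (\<lambda>N. (\<Sum>n<N. a (n + h) * cnj (a (n + k))) /\<^sub>R real N) \<longlonglongrightarrow> 0"
  shows "(\<lambda>N. (\<Sum>n<N. a n) /\<^sub>R real N) \<longlonglongrightarrow> 0"
proof (rule LIMSEQ_I)
  fix e :: real assume e: "e > 0"
  \<comment> \<open>\<open>H > 8 / e^2\<close> makes the diagonal contribution, at most
    \<open>sqrt (1 / H)\<close>, smaller than \<open>e / 2\<close>.\<close>
  define H where "H = Suc (nat \<lceil>8 / e\<^sup>2\<rceil>)"
  have H0: "H > 0" by (simp add: H_def)
  have "8 / e\<^sup>2 < real H" unfolding H_def by linarith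
  then have H: "2 / real H < (e / 2)\<^sup>2" using e H0 by (simp add: field_simps power2_eq_square)
  \<comment> \<open>Replacing \<open>a n\<close> by the window sum \<open>b n\<close> costs only
    boundary terms. Cauchy-Schwarz then leads to the second moment of \<open>b\<close>, whose
    \<open>H\<close> diagonal terms are bounded by 1 and whose off-diagonal terms are the
    correlations assumed to vanish.\<close>
  define b where "b = (\<lambda>n. \<Sum>h<H. a (n + h))"
  have shift: "norm ((\<Sum>n<N. a (n + h)) - (\<Sum>n<N. a n)) \<le> 2 * real h" for N h
  proof (induction h)
    case (Suc h)
    have "(\<Sum>n<N. a (n + Suc h)) - (\<Sum>n<N. a (n + h)) = a (N + h) - a h"
      using sum_lessThan_telescope[of "\<lambda>n. a (n + h)" N] by (simp add: sum_subtractf)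
    then have "norm ((\<Sum>n<N. a (n + Suc h)) - (\<Sum>n<N. a (n + h))) \<le> 2"
      using norm_triangle_ineq4[of "a (N + h)" "a h"] bd[of "N + h"] bd[of h] by simp
    then show ?case
      using norm_triangle_ineq[of "(\<Sum>n<N. a (n + Suc h)) - (\<Sum>n<N. a (n + h))" "(\<Sum>n<N. a (n + h)) - (\<Sum>n<N. a n)"] Suc
      by simp
  qed simp
  have avg: "real H * norm (\<Sum>n<N. a n) \<le> (\<Sum>n<N. norm (b n)) + 2 * (real H)\<^sup>2" for N
  proof -
    have "real H * norm (\<Sum>n<N. a n) = norm (\<Sum>h<H. \<Sum>n<N. a n)" by (simp add: norm_mult)
    also have "(\<Sum>h<H. \<Sum>n<N. a n) = (\<Sum>n<N. b n) - (\<Sum>h<H. (\<Sum>n<N. a (n + h)) - (\<Sum>n<N. a n))"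
      unfolding b_def by (subst sum.swap) (simp add: sum_subtractf)
    also have "norm \<dots> \<le> norm (\<Sum>n<N. b n) + norm (\<Sum>h<H. (\<Sum>n<N. a (n + h)) - (\<Sum>n<N. a n))"
      by (rule norm_triangle_ineq4)
    also have "norm (\<Sum>n<N. b n) \<le> (\<Sum>n<N. norm (b n))" by (rule norm_sum)
    also have "norm (\<Sum>h<H. (\<Sum>n<N. a (n + h)) - (\<Sum>n<N. a n)) \<le> (\<Sum>h<H. 2 * real H)"
    proof (rule sum_norm_le)
      fix h assume "h \<in> {..<H}"
      then show "norm ((\<Sum>n<N. a (n + h)) - (\<Sum>n<N. a n)) \<le> 2 * real H"
        by (intro order.trans[OF shift]) simp
    qed
    finally show ?thesis by (simp add: power2_eq_square)
  qed
  define V where "V = (\<lambda>N. \<Sum>h<H. \<Sum>k\<in>{..<H} - {h}. norm ((\<Sum>n<N. a (n + h) * cnj (a (n + k))) /\<^sub>R real N))"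
  have "(\<lambda>N. norm ((\<Sum>n<N. a (n + h) * cnj (a (n + k))) /\<^sub>R real N)) \<longlonglongrightarrow> 0" if "h \<noteq> k" for h k
    using corr[OF that] by (rule tendsto_norm_zero)
  then have V0: "V \<longlonglongrightarrow> 0" unfolding V_def
    by (intro tendsto_null_sum) auto
  have sq: "(\<Sum>n<N. (norm (b n))\<^sup>2) \<le> real N * (real H + V N)" for N
  proof (cases "N = 0")
    case False
    have scaled: "(\<Sum>k\<in>{..<H} - {h}. norm (\<Sum>n<N. a (n + h) * cnj (a (n + k))))
        = real N * (\<Sum>k\<in>{..<H} - {h}. norm ((\<Sum>n<N. a (n + h) * cnj (a (n + k))) /\<^sub>R real N))" for h
      unfolding sum_distrib_left by (intro sum.cong refl) (use False in simp)
    have "complex_of_real (\<Sum>n<N. (norm (b n))\<^sup>2) = (\<Sum>n<N. b n * cnj (b n))"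
      by (simp add: complex_norm_square[symmetric])
    also have "\<dots> = (\<Sum>n<N. \<Sum>h<H. \<Sum>k<H. a (n + h) * cnj (a (n + k)))"
      by (simp add: b_def sum_product)
    also have "\<dots> = (\<Sum>h<H. \<Sum>n<N. \<Sum>k<H. a (n + h) * cnj (a (n + k)))"
      by (rule sum.swap)
    also have "\<dots> = (\<Sum>h<H. \<Sum>k<H. \<Sum>n<N. a (n + h) * cnj (a (n + k)))"
      by (rule sum.cong[OF refl], rule sum.swap)
    finally have eq: "complex_of_real (\<Sum>n<N. (norm (b n))\<^sup>2)
       = (\<Sum>h<H. \<Sum>k<H. \<Sum>n<N. a (n + h) * cnj (a (n + k)))" .
    have "(\<Sum>n<N. (norm (b n))\<^sup>2) = norm (complex_of_real (\<Sum>n<N. (norm (b n))\<^sup>2))"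
      by (simp add: sum_nonneg del: of_real_sum)
    also have "\<dots> \<le> (\<Sum>h<H. \<Sum>k<H. norm (\<Sum>n<N. a (n + h) * cnj (a (n + k))))"
      unfolding eq by (intro order.trans[OF norm_sum] sum_mono norm_sum)
    also have "\<dots> \<le> (\<Sum>h<H. real N + (\<Sum>k\<in>{..<H} - {h}. norm (\<Sum>n<N. a (n + h) * cnj (a (n + k)))))"
    proof (rule sum_mono)
      fix h assume h: "h \<in> {..<H}"
      have "norm (\<Sum>n<N. a (n + h) * cnj (a (n + h))) \<le> (\<Sum>n<N. 1)"
        using bd by (intro sum_norm_le) (simp add: norm_mult mult_le_one)
      then show "(\<Sum>k<H. norm (\<Sum>n<N. a (n + h) * cnj (a (n + k))))
         \<le> real N + (\<Sum>k\<in>{..<H} - {h}. norm (\<Sum>n<N. a (n + h) * cnj (a (n + k))))"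
        using h by (subst sum.remove[of _ h]) auto
    qed
    also have "\<dots> = (\<Sum>h<H. real N + real N * (\<Sum>k\<in>{..<H} - {h}. norm ((\<Sum>n<N. a (n + h) * cnj (a (n + k))) /\<^sub>R real N)))"
      by (simp only: scaled)
    also have "\<dots> = real N * (real H + V N)"
      by (simp only: V_def sum.distrib sum_distrib_left[symmetric] distrib_left) simp
    finally show ?thesis .
  qed simp
  have main: "norm ((\<Sum>n<N. a n) /\<^sub>R real N) \<le> sqrt ((real H + V N) / (real H)\<^sup>2) + 2 * real H / real N" if "N > 0" for N
  proof -
    have "(\<Sum>n<N. norm (b n))\<^sup>2 \<le> real N * (\<Sum>n<N. (norm (b n))\<^sup>2)"
      using Cauchy_Schwarz_ineq_sum[of "\<lambda>_. 1" "\<lambda>n. norm (b n)" "{..<N}"] by simp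
    also have "\<dots> \<le> real N * (real N * (real H + V N))"
      by (intro mult_left_mono sq) simp
    finally have "(\<Sum>n<N. norm (b n)) \<le> sqrt (real N * (real N * (real H + V N)))"
      using real_le_rsqrt by blast
    then have "real H * norm (\<Sum>n<N. a n) \<le> real N * sqrt (real H + V N) + 2 * (real H)\<^sup>2"
      using avg[of N] by (simp add: real_sqrt_mult mult.assoc[symmetric])
    then have "norm (\<Sum>n<N. a n) / real N \<le> (real N * sqrt (real H + V N) + 2 * (real H)\<^sup>2) / (real H * real N)"
      using H0 that by (simp add: pos_le_divide_eq pos_divide_le_eq mult.commute mult.left_commute)
    also have "\<dots> = sqrt (real H + V N) / real H + 2 * real H / real N"
      using H0 that by (simp add: add_divide_distrib power2_eq_square)
    moreover have "norm (\<Sum>n<N. a n) / real N = norm ((\<Sum>n<N. a n) /\<^sub>R real N)"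
      by (simp add: divide_inverse_commute)
    moreover have "sqrt (real H + V N) / real H = sqrt ((real H + V N) / (real H)\<^sup>2)"
      by (simp add: real_sqrt_divide)
    ultimately show ?thesis by simp
  qed
  have "(\<lambda>N. sqrt ((real H + V N) / (real H)\<^sup>2) + 2 * real H / real N) \<longlonglongrightarrow> sqrt ((real H + 0) / (real H)\<^sup>2) + 0"
    using H0 by (intro tendsto_intros V0 tendsto_divide_0[OF tendsto_const] filterlim_at_top_imp_at_infinity filterlim_real_sequentially) simp
  moreover have "sqrt ((real H + 0) / (real H)\<^sup>2) + 0 < e"
  proof -
    have "(real H + 0) / (real H)\<^sup>2 \<le> 2 / real H" using H0 by (simp add: field_simps power2_eq_square)
    also have "\<dots> < (e / 2)\<^sup>2" by (rule H)
    finally have "sqrt ((real H + 0) / (real H)\<^sup>2) < sqrt ((e / 2)\<^sup>2)" by (rule real_sqrt_less_mono)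
    then show ?thesis using e by simp
  qed
  ultimately have "eventually (\<lambda>N. sqrt ((real H + V N) / (real H)\<^sup>2) + 2 * real H / real N < e) sequentially"
    by (rule order_tendstoD(2))
  then have "eventually (\<lambda>N. norm ((\<Sum>n<N. a n) /\<^sub>R real N) < e) sequentially"
    using eventually_gt_at_top[of 0]
  proof eventually_elim
    case (elim N)
    then show ?case using le_less_trans[OF main[of N]] by blast
  qed
  then show "\<exists>no. \<forall>N\<ge>no. norm ((\<Sum>n<N. a n) /\<^sub>R real N - 0) < e"
    by (simp add: eventually_sequentially)
qed

text \<open>The derivative of \<open>cis\<close> at 0 is \<open>\<i>\<close>. The quotient is
  extended continuously to 0 so that indices with \<open>\<delta> n = 0\<close> need no
  exclusion.\<close>

lemma cis_difference_quotient:
  fixes P \<delta> :: "nat \<Rightarrow> real"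
  assumes "\<delta> \<longlonglongrightarrow> 0" "(\<lambda>n. P n * \<delta> n) \<longlonglongrightarrow> c"
  shows "(\<lambda>n. P n *\<^sub>R (cis (\<delta> n) - 1)) \<longlonglongrightarrow> \<i> * of_real c"
proof -
  define q where "q = (\<lambda>t::real. if t = 0 then \<i> else (cis t - 1) /\<^sub>R t)"
  have "((\<lambda>t::real. Complex ((cos t - 1) / t) (sin t / t)) \<longlongrightarrow> Complex 0 1) (at 0)"
    by (rule tendsto_Complex) real_asymp+
  then have "((\<lambda>t. (cis t - 1) /\<^sub>R t) \<longlongrightarrow> q 0) (at 0)"
    by (simp add: q_def complex_eq_iff tendsto_complex_iff divide_inverse mult.commute)
  then have "isCont q 0"
    unfolding isCont_def by (rule Lim_transform_eventually) (simp add: eventually_at_filter q_def)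
  then have "(\<lambda>n. q (\<delta> n)) \<longlonglongrightarrow> q 0" using assms(1) by (rule isCont_tendsto_compose)
  then have "(\<lambda>n. (P n * \<delta> n) *\<^sub>R q (\<delta> n)) \<longlonglongrightarrow> c *\<^sub>R q 0"
    by (intro tendsto_scaleR assms(2))
  moreover have "(P n * \<delta> n) *\<^sub>R q (\<delta> n) = P n *\<^sub>R (cis (\<delta> n) - 1)" for n
    by (cases "\<delta> n = 0") (simp_all add: q_def)
  ultimately have "(\<lambda>n. P n *\<^sub>R (cis (\<delta> n) - 1)) \<longlonglongrightarrow> c *\<^sub>R q 0" by simp
  then show ?thesis by (simp add: q_def scaleR_conv_of_real mult.commute)
qed

text \<open>With \<^term>\<open>P\<close> of the order of \<open>1 / \<delta>\<close>, the sequence \<open>P n * cis (\<phi> n)\<close> is a discrete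
  antiderivative of \<open>cis \<circ> \<phi>\<close> up to \<open>o(1)\<close>.\<close>

lemma Cesaro_null_cis_slow:
  fixes P \<phi> :: "nat \<Rightarrow> real"
  assumes \<delta>: "(\<lambda>n. \<phi> (Suc n) - \<phi> n) \<longlonglongrightarrow> 0" and P: "(\<lambda>n. P (Suc n) - P n) \<longlonglongrightarrow> 0"
    and c: "(\<lambda>n. P n * (\<phi> (Suc n) - \<phi> n)) \<longlonglongrightarrow> c" and "c \<noteq> 0"
  shows "(\<lambda>N. (\<Sum>n<N. cis (\<phi> n)) /\<^sub>R real N) \<longlonglongrightarrow> 0"
proof -
  let ?w = "\<lambda>n. P n *\<^sub>R cis (\<phi> n)"
  let ?r = "\<lambda>n. ?w (Suc n) - ?w n - (\<i> * of_real c) * cis (\<phi> n)"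
  have cis_eq: "cis (\<phi> (Suc n)) = cis (\<phi> (Suc n) - \<phi> n) * cis (\<phi> n)" for n
    by (simp add: cis_mult)
  \<comment> \<open>Discrete product rule: one term carries the increment of \<open>P\<close>, the
    other the error of the difference quotient, and both vanish in the limit.\<close>
  have r: "?r n = (P (Suc n) - P n) *\<^sub>R cis (\<phi> (Suc n)) + (P n *\<^sub>R (cis (\<phi> (Suc n) - \<phi> n) - 1) - \<i> * of_real c) * cis (\<phi> n)" for n
    by (simp add: cis_eq algebra_simps)
  have z1: "(\<lambda>n. (P (Suc n) - P n) *\<^sub>R cis (\<phi> (Suc n))) \<longlonglongrightarrow> 0"
    by (rule tendsto_norm_zero_cancel) (simp add: tendsto_rabs_zero[OF P])
  have z2: "(\<lambda>n. (P n *\<^sub>R (cis (\<phi> (Suc n) - \<phi> n) - 1) - \<i> * of_real c) * cis (\<phi> n)) \<longlonglongrightarrow> 0"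
    using tendsto_norm_zero[OF LIM_zero[OF cis_difference_quotient[OF \<delta> c]]]
    by - (rule tendsto_norm_zero_cancel, simp add: norm_mult)
  have r0: "?r \<longlonglongrightarrow> 0" unfolding r using tendsto_add[OF z1 z2] by simp
  have vanish: "(\<lambda>N. y /\<^sub>R real N) \<longlonglongrightarrow> 0" for y :: "'b::real_normed_vector"
    using tendsto_scaleR[OF lim_inverse_n tendsto_const[of y]] by simp
  \<comment> \<open>The increments of \<open>P\<close> tend to 0, so \<open>P N = o(N)\<close>; this
    removes the boundary term of the telescoped sum.\<close>
  have "(\<lambda>N. (\<Sum>n<N. P (Suc n) - P n) /\<^sub>R real N + P 0 /\<^sub>R real N) \<longlonglongrightarrow> 0 + 0"
    by (intro tendsto_add Cesaro_null P vanish)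
  then have "(\<lambda>N. P N /\<^sub>R real N) \<longlonglongrightarrow> 0"
    by (simp add: sum_lessThan_telescope algebra_simps)
  then have w0: "(\<lambda>N. ?w N /\<^sub>R real N) \<longlonglongrightarrow> 0"
    by - (rule tendsto_norm_zero_cancel, drule tendsto_norm_zero, simp)
  have w1: "(\<lambda>N. ?w 0 /\<^sub>R real N) \<longlonglongrightarrow> 0"
    by (rule vanish)
  have "(\<lambda>N. (?w N /\<^sub>R real N - ?w 0 /\<^sub>R real N - (\<Sum>n<N. ?r n) /\<^sub>R real N) / (\<i> * of_real c)) \<longlonglongrightarrow> (0 - 0 - 0) / (\<i> * of_real c)"
    using \<open>c \<noteq> 0\<close> by (intro tendsto_divide tendsto_diff w0 w1 Cesaro_null r0 tendsto_const) auto
  moreover have "(?w N /\<^sub>R real N - ?w 0 /\<^sub>R real N - (\<Sum>n<N. ?r n) /\<^sub>R real N) / (\<i> * of_real c)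
      = (\<Sum>n<N. cis (\<phi> n)) /\<^sub>R real N" for N
  proof -
    have "(\<Sum>n<N. ?r n) = ?w N - ?w 0 - (\<i> * of_real c) * (\<Sum>n<N. cis (\<phi> n))"
      by (simp only: sum_subtractf[of _ _ "{..<N}"] sum_lessThan_telescope[symmetric, of ?w] sum_distrib_left)
    then have "?w N /\<^sub>R real N - ?w 0 /\<^sub>R real N - (\<Sum>n<N. ?r n) /\<^sub>R real N = (\<i> * of_real c) * ((\<Sum>n<N. cis (\<phi> n)) /\<^sub>R real N)"
      by (simp only: scaleR_diff_right) (simp add: scaleR_conv_of_real)
    then show ?thesis using \<open>c \<noteq> 0\<close> by (simp only: nonzero_mult_div_cancel_left mult_eq_0_iff of_real_eq_0_iff complex_i_not_zero simp_thms not_False_eq_True)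
  qed
  ultimately show ?thesis by simp
qed

lemma Cesaro_null_diff:
  fixes x y :: "nat \<Rightarrow> 'a::real_normed_vector"
  assumes "(\<lambda>n. x n - y n) \<longlonglongrightarrow> 0" "(\<lambda>N. (\<Sum>n<N. y n) /\<^sub>R real N) \<longlonglongrightarrow> 0"
  shows "(\<lambda>N. (\<Sum>n<N. x n) /\<^sub>R real N) \<longlonglongrightarrow> 0"
  using tendsto_add[OF Cesaro_null[OF assms(1)] assms(2)]
  by (simp add: sum_subtractf scaleR_diff_right)

definition wkb_phase :: "real \<Rightarrow> real \<Rightarrow> real \<Rightarrow> real" where
  "wkb_phase F E x = 2 / (3 * F) * (F * x + E) powr (3/2)"

text \<open>The phase has second derivative asymptotic to \<open>sqrt F / (2 * sqrt x)\<close>. A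
  unit step combined with a shift by \<open>h - k\<close> therefore gives a mixed difference close
  to \<open>h - k\<close> times that value.\<close>

lemma wkb_phase_second_difference:
  assumes "F > 0"
  shows "(\<lambda>n. sqrt (real n) * (wkb_phase F E (real (Suc n + h)) - wkb_phase F E (real (Suc n + k))
     - (wkb_phase F E (real (n + h)) - wkb_phase F E (real (n + k))))) \<longlonglongrightarrow> (real h - real k) * sqrt F / 2"
proof -
  define \<eta> where "\<eta> = (\<lambda>x. wkb_phase F E (x + 1) - wkb_phase F E x)"
  have step: "(\<lambda>n. sqrt (real n) * (\<eta> (real n + r + 1) - \<eta> (real n + r))) \<longlonglongrightarrow> sqrt F / 2" for r :: real
  proof -
    \<comment> \<open>With \<open>e = E / F\<close> the phase is a constant times
      \<open>(x + e) powr (3/2)\<close>, so a single expansion of pure powers suffices.\<close>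
    define e where "e = E / F"
    define S where "S = (\<lambda>x::real. (x + 2) powr (3/2) - 2 * (x + 1) powr (3/2) + x powr (3/2))"
    have "((\<lambda>x. sqrt x * S x) \<longlongrightarrow> 3 / 4) at_top" unfolding S_def by real_asymp
    moreover have at: "filterlim (\<lambda>n. real n + (r + e)) at_top sequentially" by real_asymp
    ultimately have 1: "(\<lambda>n. sqrt (real n + (r + e)) * S (real n + (r + e))) \<longlonglongrightarrow> 3 / 4"
      by (rule filterlim_compose)
    have "(\<lambda>n. sqrt (real n / (real n + (r + e)))) \<longlonglongrightarrow> 1" by real_asymp
    from tendsto_mult[OF tendsto_mult[OF tendsto_const[of "2 / 3 * sqrt F"] this] 1]
    have 2: "(\<lambda>n. 2 / 3 * sqrt F * sqrt (real n / (real n + (r + e))) * (sqrt (real n + (r + e)) * S (real n + (r + e))))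
       \<longlonglongrightarrow> sqrt F / 2" by simp
    have phase: "wkb_phase F E x = 2 / 3 * sqrt F * (x + e) powr (3/2)" if "x + e \<ge> 0" for x
    proof -
      have "F * x + E = F * (x + e)" using assms by (simp add: e_def field_simps)
      moreover have "F powr (3/2) = F * sqrt F"
        using assms powr_add[of F 1 "1/2"] by (simp add: powr_half_sqrt)
      ultimately show ?thesis using that assms
        by (simp add: wkb_phase_def powr_mult)
    qed
    have "eventually (\<lambda>n. real n + (r + e) > 0) sequentially"
      using at by (simp add: filterlim_at_top_dense)
    then have "eventually (\<lambda>n. 2 / 3 * sqrt F * sqrt (real n / (real n + (r + e))) * (sqrt (real n + (r + e)) * S (real n + (r + e)))
       = sqrt (real n) * (\<eta> (real n + r + 1) - \<eta> (real n + r))) sequentially"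
    proof eventually_elim
      case (elim n)
      have "wkb_phase F E (real n + r + 1 + 1) = 2 / 3 * sqrt F * (real n + (r + e) + 2) powr (3/2)"
        "wkb_phase F E (real n + r + 1) = 2 / 3 * sqrt F * (real n + (r + e) + 1) powr (3/2)"
        "wkb_phase F E (real n + r) = 2 / 3 * sqrt F * (real n + (r + e)) powr (3/2)"
        using elim by (simp_all add: phase algebra_simps)
      then have "\<eta> (real n + r + 1) - \<eta> (real n + r) = 2 / 3 * sqrt F * S (real n + (r + e))"
        unfolding \<eta>_def S_def by algebra
      moreover have "sqrt (real n / (real n + (r + e))) * sqrt (real n + (r + e)) = sqrt (real n)"
        using elim by (simp add: real_sqrt_divide)
      then have "2 / 3 * sqrt F * (sqrt (real n / (real n + (r + e))) * sqrt (real n + (r + e))) * S (real n + (r + e))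
          = 2 / 3 * sqrt F * sqrt (real n) * S (real n + (r + e))" by simp
      ultimately show ?case by (simp only: mult.assoc mult.commute[of "sqrt (real n)"] mult.left_commute[of "sqrt (real n)"])
    qed
    from Lim_transform_eventually[OF 2 this] show ?thesis .
  qed
  have L: "(\<lambda>n. sqrt (real n) * (\<eta> (real n + real h) - \<eta> (real n))) \<longlonglongrightarrow> real h * sqrt F / 2" for h
  proof (induction h)
    case (Suc h)
    from tendsto_add[OF Suc step[of "real h"]] show ?case
      by (simp add: algebra_simps add_divide_distrib)
  qed simp
  from tendsto_diff[OF L[of h] L[of k]] show ?thesis
    by (simp add: \<eta>_def algebra_simps diff_divide_distrib)
qed

text \<open>The phase itself varies too fast for direct summation by parts. In the correlations
  demanded by van der Corput only differences of phases remain, with increments of order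
  \<open>n powr (-1/2)\<close>, and the slowly moving factor \<open>c\<close> cancels up to
  \<open>o(1)\<close>.\<close>

lemma Cesaro_null_wkb:
  fixes c :: "nat \<Rightarrow> complex"
  assumes "F > 0" "p \<noteq> 0" and c1: "\<And>n. norm (c n) = 1" and c: "(\<lambda>n. c (Suc n) - c n) \<longlonglongrightarrow> 0"
  shows "(\<lambda>N. (\<Sum>n<N. c n * cis (p * wkb_phase F E (real n))) /\<^sub>R real N) \<longlonglongrightarrow> 0"
proof (rule van_der_Corput[of "\<lambda>n. c n * cis (p * wkb_phase F E (real n))"])
  fix h k :: nat assume "h \<noteq> k"
  define \<phi> where "\<phi> = (\<lambda>n. p * (wkb_phase F E (real (n + h)) - wkb_phase F E (real (n + k))))"
  have "(\<lambda>n. p * (sqrt (real n) * (wkb_phase F E (real (Suc n + h)) - wkb_phase F E (real (Suc n + k))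
     - (wkb_phase F E (real (n + h)) - wkb_phase F E (real (n + k)))))) \<longlonglongrightarrow> p * ((real h - real k) * sqrt F / 2)"
    by (intro tendsto_mult tendsto_const wkb_phase_second_difference assms)
  then have 1: "(\<lambda>n. sqrt (real n) * (\<phi> (Suc n) - \<phi> n)) \<longlonglongrightarrow> p * ((real h - real k) * sqrt F / 2)"
    by (simp add: \<phi>_def algebra_simps)
  have "(\<lambda>n. 1 / sqrt (real n) * (sqrt (real n) * (\<phi> (Suc n) - \<phi> n))) \<longlonglongrightarrow> 0 * (p * ((real h - real k) * sqrt F / 2))"
    by (intro tendsto_mult 1) real_asymp
  then have "(\<lambda>n. 1 / sqrt (real n) * (sqrt (real n) * (\<phi> (Suc n) - \<phi> n))) \<longlonglongrightarrow> 0" by simp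
  then have 2: "(\<lambda>n. \<phi> (Suc n) - \<phi> n) \<longlonglongrightarrow> 0"
    by (rule Lim_transform_eventually) (rule eventually_mono[OF eventually_gt_at_top[of 0]], simp)
  \<comment> \<open>\<open>sqrt n\<close> plays the role of \<open>P\<close>; the limit is nonzero
    because \<open>p \<noteq> 0\<close>, \<open>F > 0\<close> and
    \<open>h \<noteq> k\<close>.\<close>
  have fejer: "(\<lambda>N. (\<Sum>n<N. cis (\<phi> n)) /\<^sub>R real N) \<longlonglongrightarrow> 0"
  proof (rule Cesaro_null_cis_slow[OF 2 _ 1])
    show "(\<lambda>n. sqrt (real (Suc n)) - sqrt (real n)) \<longlonglongrightarrow> 0" by real_asymp
    show "p * ((real h - real k) * sqrt F / 2) \<noteq> 0" using assms \<open>h \<noteq> k\<close> by simp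
  qed
  have ch: "(\<lambda>n. c (n + h) - c n) \<longlonglongrightarrow> 0" for h
  proof (induction h)
    case (Suc h)
    from tendsto_add[OF Suc LIMSEQ_ignore_initial_segment[OF c, of h]] show ?case by simp
  qed simp
  have "(\<lambda>n. c (n + h) - c (n + k)) \<longlonglongrightarrow> 0" using tendsto_diff[OF ch[of h] ch[of k]] by simp
  then have ck: "(\<lambda>n. norm (c (n + h) - c (n + k))) \<longlonglongrightarrow> 0" by (rule tendsto_norm_zero)
  show "(\<lambda>N. (\<Sum>n<N. c (n + h) * cis (p * wkb_phase F E (real (n + h))) *
       cnj (c (n + k) * cis (p * wkb_phase F E (real (n + k))))) /\<^sub>R real N) \<longlonglongrightarrow> 0"
  proof (rule Cesaro_null_diff[OF _ fejer], rule tendsto_norm_zero_cancel, rule Lim_transform_eventually[OF ck], rule always_eventually, rule allI)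
    fix n
    let ?a = "c (n + h)" and ?b = "c (n + k)"
    have bb: "?b * cnj ?b = 1" using c1[of "n + k"] by (simp add: complex_norm_square[symmetric])
    have "?a * cis (p * wkb_phase F E (real (n + h))) * cnj (?b * cis (p * wkb_phase F E (real (n + k)))) - cis (\<phi> n)
      = (?a * cnj ?b - 1) * cis (\<phi> n)"
      by (simp add: \<phi>_def cis_cnj cis_mult cis_divide algebra_simps)
    also have "\<dots> = ((?a - ?b) * cnj ?b) * cis (\<phi> n)" by (simp add: left_diff_distrib bb)
    finally show "norm (?a - ?b) = norm (?a * cis (p * wkb_phase F E (real (n + h))) * cnj (?b * cis (p * wkb_phase F E (real (n + k)))) - cis (\<phi> n))"
      using c1[of "n + k"] by (simp add: norm_mult)
  qed
qed (use c1 in \<open>simp add: norm_mult\<close>)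

section \<open>Growth of the amplitudes\<close>

definition kick :: "complex \<Rightarrow> real \<Rightarrow> complex \<Rightarrow> complex" where
  "kick z x a = a - \<i> * of_real (x * Re (a * z)) * cnj z"

text \<open>Step \<open>n\<close> describes the interval \<open>(n, n + 1)\<close>, so in
  applications \<open>z n\<close> and \<open>x n\<close> belong to the site
  \<open>n + 1\<close>.\<close>

primrec amp :: "(nat \<Rightarrow> complex) \<Rightarrow> (nat \<Rightarrow> real) \<Rightarrow> complex \<Rightarrow> nat \<Rightarrow> complex" where
  "amp z x a 0 = a"
| "amp z x a (Suc n) = kick (z n) (x n) (amp z x a n)"

text \<open>\<open>log_slope\<close> and \<open>log_drift\<close> are the coefficients of \<open>x\<close> and \<open>x\<^sup>2\<close> in the expansion of
  \<open>ln ((norm (kick z x a))\<^sup>2)\<close> at \<open>x = 0\<close>.\<close>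

definition log_slope :: "complex \<Rightarrow> complex \<Rightarrow> real" where
  "log_slope z a = - Im ((sgn a * z)\<^sup>2)"

definition log_drift :: "complex \<Rightarrow> complex \<Rightarrow> real" where
  "log_drift z a = (norm z)\<^sup>2 * (Re (sgn a * z))\<^sup>2 - (log_slope z a)\<^sup>2 / 2"

lemma mult_cnj_sgn: "a * cnj (sgn a) = of_real (norm a)"
proof (cases "a = 0")
  case False
  then show ?thesis
    by (simp add: sgn_eq complex_norm_square[symmetric] power2_eq_square)
qed simp

text \<open>A kick commutes with positive scaling, so its relative effect depends on
  \<open>a\<close> only through the direction \<open>sgn a\<close>. This makes the increments of the
  logarithm bounded functions of the past.\<close>

lemma kick_eq_mult:
  assumes "a \<noteq> 0"
  shows "kick z x a = a * (1 - \<i> * of_real (x * Re (sgn a * z)) * cnj (sgn a * z))"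
proof -
  define e where "e = sgn a * z"
  have "a * z = of_real (norm a) * e" using assms by (simp add: sgn_eq e_def)
  then have 1: "Re (a * z) = norm a * Re e" by simp
  have 2: "a * cnj e = of_real (norm a) * cnj z"
    using mult_cnj_sgn[of a] by (simp add: e_def)
  have "a * (1 - \<i> * of_real (x * Re e) * cnj e) = a - \<i> * of_real (x * Re e) * (a * cnj e)"
    by (simp only: right_diff_distrib mult_1_right) (simp only: ac_simps)
  also have "\<dots> = kick z x a"
    unfolding 2 kick_def 1 by simp
  finally show ?thesis by (simp add: e_def)
qed

lemma norm_sgn_mult: "(a :: complex) \<noteq> 0 \<Longrightarrow> norm (sgn a * z) = norm z"
  by (simp add: norm_mult norm_sgn)

lemma norm_kick:
  assumes "a \<noteq> 0"
  shows "(norm (kick z x a))\<^sup>2 = (norm a)\<^sup>2 * (1 + x * log_slope z a + x\<^sup>2 * ((norm z)\<^sup>2 * (Re (sgn a * z))\<^sup>2))"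
proof -
  have "(norm (1 - \<i> * of_real (x * Re e) * cnj e))\<^sup>2
      = 1 + x * (- Im (e\<^sup>2)) + x\<^sup>2 * ((norm e)\<^sup>2 * (Re e)\<^sup>2)" for e
    unfolding cmod_power2 by (simp add: power2_eq_square algebra_simps)
  then show ?thesis
    unfolding kick_eq_mult[OF assms] norm_mult[of a] power_mult_distrib[of "norm a"] log_slope_def
    by (simp only: norm_sgn_mult[OF assms])
qed

text \<open>The added term is \<open>\<i> * cnj z\<close> times a real number, so it does not change
  \<open>Re (a * z)\<close>, the value of the solution at the site. If the kick vanished, this value
  would be 0, and then \<open>a\<close> itself would be 0.\<close>

lemma kick_nonzero:
  assumes "a \<noteq> 0"
  shows "kick z x a \<noteq> 0"
proof
  assume k: "kick z x a = 0"
  define r where "r = Re (a * z)"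
  have 1: "a = \<i> * of_real (x * r) * cnj z" using k by (simp add: kick_def r_def)
  then have "a * z = \<i> * of_real (x * r) * (z * cnj z)" by (simp only: ac_simps)
  also have "\<dots> = \<i> * of_real (x * r * (norm z)\<^sup>2)" by (simp add: complex_norm_square[symmetric])
  finally have "r = 0" unfolding r_def by simp
  with 1 assms show False by simp
qed

lemma amp_nonzero: "a \<noteq> 0 \<Longrightarrow> amp z x a n \<noteq> 0"
  by (induction n) (auto simp: kick_nonzero)

lemma abs_log_slope_le: "a \<noteq> 0 \<Longrightarrow> \<bar>log_slope z a\<bar> \<le> (norm z)\<^sup>2"
  using abs_Im_le_cmod[of "(sgn a * z)\<^sup>2"]
  by (simp add: log_slope_def norm_power norm_mult norm_sgn)

lemma drift_term_bounds:
  assumes "a \<noteq> 0"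
  shows "0 \<le> (norm z)\<^sup>2 * (Re (sgn a * z))\<^sup>2" "(norm z)\<^sup>2 * (Re (sgn a * z))\<^sup>2 \<le> ((norm z)\<^sup>2)\<^sup>2"
proof -
  have "(Re e)\<^sup>2 \<le> (norm e)\<^sup>2" for e by (simp add: cmod_power2)
  from this[of "sgn a * z"] have "(Re (sgn a * z))\<^sup>2 \<le> (norm z)\<^sup>2" by (simp only: norm_sgn_mult[OF assms])
  then show "(norm z)\<^sup>2 * (Re (sgn a * z))\<^sup>2 \<le> ((norm z)\<^sup>2)\<^sup>2"
    unfolding power2_eq_square[of "(norm z)\<^sup>2"] by (intro mult_left_mono) auto
qed simp

lemma abs_log_drift_le:
  assumes "a \<noteq> 0"
  shows "\<bar>log_drift z a\<bar> \<le> ((norm z)\<^sup>2)\<^sup>2"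
proof -
  have "(log_slope z a)\<^sup>2 \<le> ((norm z)\<^sup>2)\<^sup>2"
    using power_mono[OF abs_log_slope_le[OF assms, of z], of 2] by simp
  then show ?thesis using drift_term_bounds[OF assms, of z] zero_le_power2[of "log_slope z a"]
    unfolding log_drift_def by linarith
qed

text \<open>Splits the drift into harmonics of the phase t of \<open>sgn a * z\<close>:
  \<open>cos(t)^2 - sin(2t)^2 / 2 = 1/4 + cos(2t) / 2 + cos(4t) / 4\<close>. Only the term
  \<open>1/4\<close> survives averaging.\<close>

lemma log_drift_eq:
  assumes "a \<noteq> 0"
  shows "log_drift z a = ((norm z)\<^sup>2)\<^sup>2 / 4 + (norm z)\<^sup>2 * Re ((sgn a)\<^sup>2 * z\<^sup>2) / 2 + Re ((sgn a)^4 * z^4) / 4"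
proof -
  have poly: "(p\<^sup>2 + q\<^sup>2) * p\<^sup>2 - (- (2 * p * q))\<^sup>2 / 2
     = (p\<^sup>2 + q\<^sup>2)\<^sup>2 / 4 + (p\<^sup>2 + q\<^sup>2) * (p\<^sup>2 - q\<^sup>2) / 2 + ((p\<^sup>2 - q\<^sup>2)\<^sup>2 - (2 * p * q)\<^sup>2) / 4" for p q :: real
    by (simp add: power2_eq_square field_simps)
  define e where "e = sgn a * z"
  have n: "(norm z)\<^sup>2 = (Re e)\<^sup>2 + (Im e)\<^sup>2"
    using norm_sgn_mult[OF assms, of z] cmod_power2[of e] by (simp add: e_def)
  have 2: "(sgn a)\<^sup>2 * z\<^sup>2 = e\<^sup>2" and 4: "(sgn a)^4 * z^4 = (e\<^sup>2)\<^sup>2"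
    by (simp_all add: power_mult_distrib e_def)
  have r2: "Re (e\<^sup>2) = (Re e)\<^sup>2 - (Im e)\<^sup>2" "Im (e\<^sup>2) = 2 * Re e * Im e"
    by (simp_all add: power2_eq_square)
  have r4: "Re ((e\<^sup>2)\<^sup>2) = ((Re e)\<^sup>2 - (Im e)\<^sup>2)\<^sup>2 - (2 * Re e * Im e)\<^sup>2"
    unfolding power2_eq_square[of "e\<^sup>2"] times_complex.sel(1) r2 by (simp add: power2_eq_square)
  show ?thesis
    unfolding 2 4 log_drift_def log_slope_def e_def[symmetric] n r4 r2 by (rule poly)
qed

lemma ln_one_plus_third_order:
  fixes y :: real
  assumes "\<bar>y\<bar> \<le> 1/2"
  shows "\<bar>ln (1 + y) - (y - y\<^sup>2 / 2)\<bar> \<le> 2 * \<bar>y\<bar> ^ 3"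
proof -
  define h where "h = (\<lambda>y::real. ln (1 + y) - (y - y\<^sup>2 / 2))"
  have d: "(h has_field_derivative t\<^sup>2 / (1 + t)) (at t)" if "t \<in> {-\<bar>y\<bar>..\<bar>y\<bar>}" for t
    unfolding h_def using that assms
    by (auto intro!: derivative_eq_intros simp: field_simps power2_eq_square)
  have b: "norm (t\<^sup>2 / (1 + t)) \<le> 2 * y\<^sup>2" if "t \<in> {-\<bar>y\<bar>..\<bar>y\<bar>}" for t
  proof -
    have "1 / 2 \<le> 1 + t" "t\<^sup>2 \<le> y\<^sup>2" using that assms by (auto simp: abs_le_square_iff[symmetric])
    then have "t\<^sup>2 / (1 + t) \<le> y\<^sup>2 / (1 / 2)" by (intro frac_le) auto
    then show ?thesis using \<open>1 / 2 \<le> 1 + t\<close> by simp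
  qed
  have "norm (h y - h 0) \<le> 2 * y\<^sup>2 * norm (y - 0)"
  proof (rule field_differentiable_bound[of "{-\<bar>y\<bar>..\<bar>y\<bar>}" h "\<lambda>t. t\<^sup>2 / (1 + t)"])
    show "(h has_field_derivative t\<^sup>2 / (1 + t)) (at t within {-\<bar>y\<bar>..\<bar>y\<bar>})" if "t \<in> {-\<bar>y\<bar>..\<bar>y\<bar>}" for t
      using d[OF that] by (rule has_field_derivative_at_within)
  qed (use b in auto)
  then show ?thesis by (simp add: h_def power3_eq_cube power2_eq_square abs_mult)
qed

text \<open>The factor 18 is 16 + 2: the logarithmic remainder is at most
  \<open>2 * (2 * t) ^ 3\<close>, and the discarded products \<open>p * q\<close> and
  \<open>q^2 / 2\<close> together stay below \<open>2 * t ^ 3\<close>.\<close>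

lemma log_kick:
  assumes "a \<noteq> 0" and t: "\<bar>x\<bar> * (norm z)\<^sup>2 \<le> 1/4"
  shows "\<bar>ln ((norm (kick z x a))\<^sup>2) - ln ((norm a)\<^sup>2) - x * log_slope z a - x\<^sup>2 * log_drift z a\<bar>
    \<le> 18 * (\<bar>x\<bar> * (norm z)\<^sup>2) ^ 3"
proof -
  define S T t where "S = log_slope z a" "T = (norm z)\<^sup>2 * (Re (sgn a * z))\<^sup>2" "t = \<bar>x\<bar> * (norm z)\<^sup>2"
  define p q where "p = x * S" and "q = x\<^sup>2 * T"
  have t0: "0 \<le> t" "t \<le> 1/4" using t by (auto simp: S_T_t_def)
  have p: "\<bar>p\<bar> \<le> t" using abs_log_slope_le[OF assms(1), of z]
    by (simp add: p_def S_T_t_def abs_mult mult_left_mono)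
  have q: "0 \<le> q" "q \<le> t\<^sup>2" using drift_term_bounds[OF assms(1), of z]
    by (simp_all add: q_def S_T_t_def power_mult_distrib mult_left_mono del: times_complex.sel)
  have t2: "t\<^sup>2 \<le> t" using t0 by (simp add: power2_eq_square mult_left_le)
  have y: "\<bar>p + q\<bar> \<le> 2 * t" using p q t2 by linarith
  have k: "ln ((norm (kick z x a))\<^sup>2) = ln ((norm a)\<^sup>2) + ln (1 + (p + q))"
  proof -
    have "1 + (p + q) > 0" using y t0 by linarith
    then show ?thesis unfolding norm_kick[OF assms(1)] using assms(1)
      by (subst ln_mult_pos[symmetric]) (simp_all add: p_def q_def S_T_t_def add.assoc del: times_complex.sel)
  qed
  have "\<bar>ln (1 + (p + q)) - (p + q - (p + q)\<^sup>2 / 2)\<bar> \<le> 2 * \<bar>p + q\<bar> ^ 3"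
    using y t0 by (intro ln_one_plus_third_order) linarith
  also have "\<dots> \<le> 2 * (2 * t) ^ 3" using y by (intro mult_left_mono power_mono) auto
  finally have 1: "\<bar>ln (1 + (p + q)) - (p + q - (p + q)\<^sup>2 / 2)\<bar> \<le> 16 * t ^ 3" by (simp add: power_mult_distrib)
  have "\<bar>p * q\<bar> \<le> t * t\<^sup>2" unfolding abs_mult using p q by (intro mult_mono) auto
  moreover have "q\<^sup>2 \<le> t ^ 3"
  proof -
    have "q\<^sup>2 \<le> (t\<^sup>2)\<^sup>2" using q by (intro power_mono) auto
    also have "\<dots> = t * t ^ 3" by (simp add: power2_eq_square power3_eq_cube)
    also have "\<dots> \<le> 1 * t ^ 3" using t0 by (intro mult_right_mono) auto
    finally show ?thesis by simp
  qed
  moreover have "p + q - (p + q)\<^sup>2 / 2 - (p + (q - p\<^sup>2 / 2)) = - (p * q) - q\<^sup>2 / 2"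
    by (simp add: power2_eq_square algebra_simps)
  moreover have "t * t\<^sup>2 = t ^ 3" by (simp add: power2_eq_square power3_eq_cube)
  ultimately have 2: "\<bar>p + q - (p + q)\<^sup>2 / 2 - (p + (q - p\<^sup>2 / 2))\<bar> \<le> 2 * t ^ 3"
    using zero_le_power2[of q] by linarith
  have "x\<^sup>2 * log_drift z a = q - p\<^sup>2 / 2"
    by (simp add: log_drift_def q_def p_def S_T_t_def power_mult_distrib algebra_simps del: times_complex.sel)
  then show ?thesis using 1 2 unfolding k p_def[symmetric] S_T_t_def(1)[symmetric] S_T_t_def(3)[symmetric] by linarith
qed

text \<open>The quotient of consecutive amplitudes is \<open>1 + O(x n * norm (z n)^2)\<close> and
  tends to 1, so the direction turns by \<open>o(1)\<close> per step, for any coupling path with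
  this smallness.\<close>

lemma sgn_kick_tendsto:
  fixes z :: "nat \<Rightarrow> complex" and x :: "nat \<Rightarrow> real"
  assumes a0: "a0 \<noteq> 0" and xm: "(\<lambda>n. x n * (norm (z n))\<^sup>2) \<longlonglongrightarrow> 0"
  shows "(\<lambda>n. sgn (amp z x a0 (Suc n)) - sgn (amp z x a0 n)) \<longlonglongrightarrow> 0"
proof -
  let ?a = "amp z x a0"
  define u where "u = (\<lambda>n. 1 - \<i> * of_real (x n * Re (sgn (?a n) * z n)) * cnj (sgn (?a n) * z n))"
  have a: "?a n \<noteq> 0" for n using amp_nonzero[OF a0] .
  have au: "?a (Suc n) = ?a n * u n" for n using kick_eq_mult[OF a] by (simp add: u_def)
  have "norm (u n - 1) \<le> \<bar>x n * (norm (z n))\<^sup>2\<bar>" for n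
  proof -
    have "norm (u n - 1) = \<bar>x n\<bar> * (\<bar>Re (sgn (?a n) * z n)\<bar> * norm (sgn (?a n) * z n))"
      by (simp add: u_def norm_mult abs_mult del: times_complex.sel complex_cnj_mult)
    also have "\<dots> \<le> \<bar>x n\<bar> * (norm (sgn (?a n) * z n) * norm (sgn (?a n) * z n))"
      by (intro mult_left_mono mult_right_mono abs_Re_le_cmod) auto
    finally show ?thesis using a by (simp add: norm_sgn_mult power2_eq_square abs_mult)
  qed
  then have "(\<lambda>n. u n - 1) \<longlonglongrightarrow> 0"
    by (intro Lim_null_comparison[OF _ tendsto_rabs_zero[OF xm]]) auto
  then have u: "u \<longlonglongrightarrow> 1" by (simp add: LIM_zero_iff)
  then have "(\<lambda>n. sgn (u n)) \<longlonglongrightarrow> sgn 1" by (intro tendsto_sgn) auto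
  then have 1: "(\<lambda>n. norm (sgn (u n) - 1)) \<longlonglongrightarrow> 0" by (simp add: tendsto_norm_zero LIM_zero)
  have "sgn (?a (Suc n)) - sgn (?a n) = sgn (?a n) * (sgn (u n) - 1)" for n
    unfolding au by (simp add: sgn_mult algebra_simps)
  then have "norm (sgn (?a (Suc n)) - sgn (?a n)) = norm (sgn (u n) - 1)" for n
    using a[of n] by (simp only: norm_mult norm_sgn) simp
  then show ?thesis using 1 by (intro tendsto_norm_zero_cancel[of "\<lambda>n. sgn (amp z x a0 (Suc n)) - sgn (amp z x a0 n)"]) simp
qed

lemma unit_square_diff_tendsto:
  fixes c :: "nat \<Rightarrow> complex"
  assumes "\<And>n. norm (c n) = 1" "(\<lambda>n. c (Suc n) - c n) \<longlonglongrightarrow> 0"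
  shows "(\<lambda>n. (c (Suc n))\<^sup>2 - (c n)\<^sup>2) \<longlonglongrightarrow> 0"
proof (rule Lim_null_comparison)
  show "(\<lambda>n. norm (c (Suc n) - c n) * 2) \<longlonglongrightarrow> 0"
    using tendsto_mult[OF tendsto_norm_zero[OF assms(2)] tendsto_const[of 2]] by simp
  have "norm ((c (Suc n))\<^sup>2 - (c n)\<^sup>2) \<le> norm (c (Suc n) - c n) * 2" for n
  proof -
    have "norm ((c (Suc n))\<^sup>2 - (c n)\<^sup>2) = norm (c (Suc n) - c n) * norm (c (Suc n) + c n)"
      by (simp add: norm_mult[symmetric] power2_eq_square algebra_simps)
    also have "\<dots> \<le> norm (c (Suc n) - c n) * 2"
      using norm_triangle_ineq[of "c (Suc n)" "c n"] assms(1) by (intro mult_left_mono) auto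
    finally show ?thesis .
  qed
  then show "eventually (\<lambda>n. norm ((c (Suc n))\<^sup>2 - (c n)\<^sup>2) \<le> norm (c (Suc n) - c n) * 2) sequentially" by simp
qed

lemma tendsto_Re_mult_unit:
  fixes p b :: "nat \<Rightarrow> complex"
  assumes "p \<longlonglongrightarrow> 0" "\<And>n. norm (b n) = 1"
  shows "(\<lambda>n. Re (p n * b n)) \<longlonglongrightarrow> 0"
proof (rule Lim_null_comparison)
  have "norm (Re (p n * b n)) \<le> norm (p n)" for n
    using abs_Re_le_cmod[of "p n * b n"] assms(2)[of n] by (simp add: norm_mult del: times_complex.sel)
  then show "eventually (\<lambda>n. norm (Re (p n * b n)) \<le> norm (p n)) sequentially" by simp
qed (rule tendsto_norm_zero[OF assms(1)])

text \<open>Normalisation to Wronskian 1 gives modulus \<open>(F * x) powr (-1/4)\<close> to leading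
  order. The phase is read at \<open>n\<close> although \<open>z n\<close> sits at the site
  \<open>n + 1\<close>; that shift is absorbed into \<open>E\<close>.\<close>

locale wkb_sequence =
  fixes F E :: real and z :: "nat \<Rightarrow> complex"
  assumes F: "F > 0"
    and wkb: "(\<lambda>n. of_real (sqrt (sqrt (F * real (Suc n)))) * z n - cis (wkb_phase F E (real n))) \<longlonglongrightarrow> 0"
begin

lemma norm_bound: "\<exists>C>0. \<forall>n. (norm (z n))\<^sup>2 \<le> C / sqrt (real (Suc n))"
proof -
  let ?d = "\<lambda>n. of_real (sqrt (sqrt (F * real (Suc n)))) * z n"
  have "Bseq (\<lambda>n. ?d n - cis (wkb_phase F E (real n)))"
    using wkb by (rule convergentI[THEN convergent_imp_Bseq])
  then obtain B where B: "\<And>n. norm (?d n - cis (wkb_phase F E (real n))) \<le> B" by (auto simp: Bseq_def)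
  have "(norm (z n))\<^sup>2 \<le> (B + 1)\<^sup>2 / sqrt F / sqrt (real (Suc n))" for n
  proof -
    have "norm (?d n) \<le> norm (?d n - cis (wkb_phase F E (real n))) + norm (cis (wkb_phase F E (real n)))"
      using norm_triangle_ineq[of "?d n - cis (wkb_phase F E (real n))" "cis (wkb_phase F E (real n))"] by simp
    then have "norm (?d n) \<le> B + 1" using B[of n] by (simp only: norm_cis)
    then have "(norm (?d n))\<^sup>2 \<le> (B + 1)\<^sup>2" by (intro power_mono) auto
    moreover have "(norm (?d n))\<^sup>2 = sqrt F * sqrt (real (Suc n)) * (norm (z n))\<^sup>2"
      using F by (simp add: norm_mult power_mult_distrib real_sqrt_mult del: of_nat_Suc)
    moreover have "sqrt F > 0" "sqrt (real (Suc n)) > 0" using F by (auto simp del: of_nat_Suc)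
    ultimately show ?thesis by (simp add: pos_le_divide_eq ac_simps del: of_nat_Suc)
  qed
  moreover have "(B + 1)\<^sup>2 / sqrt F > 0"
  proof -
    have "B \<ge> 0" using B[of 0] norm_ge_zero order_trans by blast
    then show ?thesis using F by simp
  qed
  ultimately show ?thesis by blast
qed

text \<open>A statement about one path: after multiplication by \<open>F * (k + 1)\<close> the drift
  is \<open>1/4\<close> plus two harmonics plus \<open>o(1)\<close>. The harmonics have vanishing
  Cesaro means because their coefficients \<open>s^2\<close> and \<open>s^4\<close> vary
  slowly.\<close>

lemma log_drift_average:
  assumes a0: "a0 \<noteq> 0" and xm: "(\<lambda>n. x n * (norm (z n))\<^sup>2) \<longlonglongrightarrow> 0"
  shows "(\<lambda>n. (\<Sum>k<n. log_drift (z k) (amp z x a0 k)) / ln (real n)) \<longlonglongrightarrow> 1 / (4 * F)"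
proof -
  define s where "s = (\<lambda>n. sgn (amp z x a0 n))"
  define r where "r = (\<lambda>n. sqrt (F * real (Suc n)))"
  define w where "w = (\<lambda>n. of_real (sqrt (r n)) * z n * cnj (cis (wkb_phase F E (real n))))"
  \<comment> \<open>\<open>b\<close> is the second harmonic and \<open>b^2\<close> the fourth;
    \<open>D n\<close> tends to follow \<open>1/4 + Re (b n) / 2 + Re ((b n)^2) / 4\<close>.\<close>
  define b where "b = (\<lambda>n. (s n)\<^sup>2 * cis (2 * wkb_phase F E (real n)))"
  define D where "D = (\<lambda>k. F * real (Suc k) * log_drift (z k) (amp z x a0 k))"
  have a: "amp z x a0 n \<noteq> 0" for n using amp_nonzero[OF a0] .
  have s1: "norm (s n) = 1" for n using a by (simp add: s_def norm_sgn)
  have s2: "norm ((s n)\<^sup>2) = 1" for n by (simp add: norm_power s1)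
  have s4: "norm (((s n)\<^sup>2)\<^sup>2) = 1" for n by (simp add: norm_power s1)
  have b1: "norm (b n) = 1" for n using s2[of n] by (simp add: b_def norm_mult)
  have b2: "norm ((b n)\<^sup>2) = 1" for n using b1[of n] by (simp add: norm_power)
  have r0: "r n > 0" for n using F by (simp add: r_def)
  have ds: "(\<lambda>n. s (Suc n) - s n) \<longlonglongrightarrow> 0" unfolding s_def by (rule sgn_kick_tendsto[OF a0 xm])
  have ds2: "(\<lambda>n. (s (Suc n))\<^sup>2 - (s n)\<^sup>2) \<longlonglongrightarrow> 0" by (rule unit_square_diff_tendsto[OF s1 ds])
  have ds4: "(\<lambda>n. ((s (Suc n))\<^sup>2)\<^sup>2 - ((s n)\<^sup>2)\<^sup>2) \<longlonglongrightarrow> 0" by (rule unit_square_diff_tendsto[OF s2 ds2])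
  have cb: "(\<lambda>N. (\<Sum>n<N. b n) /\<^sub>R real N) \<longlonglongrightarrow> 0"
    unfolding b_def by (rule Cesaro_null_wkb[OF F _ s2 ds2]) simp
  have "(b n)\<^sup>2 = ((s n)\<^sup>2)\<^sup>2 * cis (4 * wkb_phase F E (real n))" for n
    by (simp add: b_def power_mult_distrib Complex.DeMoivre)
  then have cb2: "(\<lambda>N. (\<Sum>n<N. (b n)\<^sup>2) /\<^sub>R real N) \<longlonglongrightarrow> 0"
    using Cesaro_null_wkb[OF F _ s4 ds4, of 4] by simp
  have "w n - 1 = (of_real (sqrt (r n)) * z n - cis (wkb_phase F E (real n))) * cnj (cis (wkb_phase F E (real n)))" for n
    by (simp add: w_def left_diff_distrib complex_norm_square[symmetric])
  then have "norm (w n - 1) = norm (of_real (sqrt (r n)) * z n - cis (wkb_phase F E (real n)))" for n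
    by (simp add: norm_mult)
  then have "(\<lambda>n. w n - 1) \<longlonglongrightarrow> 0"
    using tendsto_norm_zero[OF wkb] unfolding r_def by (simp add: tendsto_norm_zero_iff[symmetric, of "\<lambda>n. w n - 1"])
  then have w: "w \<longlonglongrightarrow> 1" by (simp add: LIM_zero_iff)
  have nw: "(\<lambda>n. (norm (w n))^4 / 4 - 1/4) \<longlonglongrightarrow> 0"
    using tendsto_diff[OF tendsto_divide[OF tendsto_power[OF tendsto_norm[OF w], of 4] tendsto_const[of 4]] tendsto_const[of "1/4"]] by simp
  have p1: "(\<lambda>n. of_real ((norm (w n))\<^sup>2) * (w n)\<^sup>2 - 1) \<longlonglongrightarrow> 0"
    using tendsto_diff[OF tendsto_mult[OF tendsto_of_real[OF tendsto_power[OF tendsto_norm[OF w], of 2]] tendsto_power[OF w, of 2]] tendsto_const[of 1]] by simp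
  have p2: "(\<lambda>n. (w n)^4 - 1) \<longlonglongrightarrow> 0"
    using tendsto_diff[OF tendsto_power[OF w, of 4] tendsto_const[of 1]] by simp
  have D: "D n = (norm (w n))^4 / 4 + Re (of_real ((norm (w n))\<^sup>2) * (w n)\<^sup>2 * b n) / 2 + Re ((w n)^4 * (b n)\<^sup>2) / 4" for n
  proof -
    let ?v = "cis (wkb_phase F E (real n))"
    have v: "?v * cnj ?v = 1" by (simp add: complex_norm_square[symmetric])
    have zw: "of_real (sqrt (r n)) * z n = w n * ?v" unfolding w_def using v by (simp add: ac_simps)
    have nz: "norm (w n) = sqrt (r n) * norm (z n)" using r0[of n] by (simp add: w_def norm_mult)
    have rr: "(sqrt (r n))\<^sup>2 = r n" using r0[of n] by simp
    have z2: "of_real (r n) * (z n)\<^sup>2 = (w n)\<^sup>2 * ?v\<^sup>2"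
      using arg_cong[OF zw, of "\<lambda>t. t\<^sup>2"] by (simp add: power_mult_distrib of_real_power[symmetric] rr del: of_real_power)
    have z4: "of_real ((r n)\<^sup>2) * (z n)^4 = (w n)^4 * (?v\<^sup>2)\<^sup>2"
      using arg_cong[OF z2, of "\<lambda>t. t\<^sup>2"] by (simp add: power_mult_distrib)
    have nz2: "(norm (w n))\<^sup>2 = r n * (norm (z n))\<^sup>2" by (simp add: nz power_mult_distrib rr)
    have bv: "b n = (s n)\<^sup>2 * ?v\<^sup>2" by (simp add: b_def Complex.DeMoivre)
    have Fr: "F * real (Suc n) = (r n)\<^sup>2" using F by (simp add: r_def)
    have t2: "of_real ((norm (w n))\<^sup>2) * (w n)\<^sup>2 * b n = of_real ((r n)\<^sup>2 * (norm (z n))\<^sup>2) * ((s n)\<^sup>2 * (z n)\<^sup>2)"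
    proof -
      have "of_real ((norm (w n))\<^sup>2) * (w n)\<^sup>2 * b n = of_real ((norm (w n))\<^sup>2) * ((w n)\<^sup>2 * ?v\<^sup>2) * (s n)\<^sup>2"
        unfolding bv by (simp only: ac_simps)
      also have "\<dots> = of_real ((r n)\<^sup>2 * (norm (z n))\<^sup>2) * ((s n)\<^sup>2 * (z n)\<^sup>2)"
        unfolding z2[symmetric] nz2 by (simp add: power2_eq_square[of "r n"] ac_simps)
      finally show ?thesis .
    qed
    have t4: "(w n)^4 * (b n)\<^sup>2 = of_real ((r n)\<^sup>2) * ((s n)^4 * (z n)^4)"
    proof -
      have "(w n)^4 * (b n)\<^sup>2 = ((w n)^4 * (?v\<^sup>2)\<^sup>2) * (s n)^4"
        unfolding bv by (simp add: power_mult_distrib ac_simps)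
      then show ?thesis unfolding z4[symmetric] by (simp only: ac_simps)
    qed
    have n4: "(norm (w n))^4 = (r n)\<^sup>2 * ((norm (z n))\<^sup>2)\<^sup>2"
      using arg_cong[OF nz2, of "\<lambda>t. t\<^sup>2"] by (simp add: power_mult_distrib)
    have Rr: "Re (of_real t * y) = t * Re y" for t y by simp
    have sn: "sgn (amp z x a0 n) = s n" by (simp add: s_def)
    show ?thesis
      unfolding D_def log_drift_eq[OF a] Fr t2 t4 n4 Rr sn by (simp only: distrib_left times_divide_eq_right mult.assoc)
  qed
  have "(\<lambda>n. ((norm (w n))^4 / 4 - 1/4) + (Re ((of_real ((norm (w n))\<^sup>2) * (w n)\<^sup>2 - 1) * b n) / 2
      + Re (((w n)^4 - 1) * (b n)\<^sup>2) / 4)) \<longlonglongrightarrow> 0 + (0 / 2 + 0 / 4)"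
    by (intro tendsto_add nw tendsto_divide tendsto_const tendsto_Re_mult_unit p1 p2 b1 b2) auto
  moreover have "((norm (w n))^4 / 4 - 1/4) + (Re ((of_real ((norm (w n))\<^sup>2) * (w n)\<^sup>2 - 1) * b n) / 2
      + Re (((w n)^4 - 1) * (b n)\<^sup>2) / 4) = (D n - 1/4) - (Re (b n) / 2 + Re ((b n)\<^sup>2) / 4)" for n
    unfolding D left_diff_distrib minus_complex.sel mult_1 by (simp add: diff_divide_distrib del: times_complex.sel)
  ultimately have lim: "(\<lambda>n. (D n - 1/4) - (Re (b n) / 2 + Re ((b n)\<^sup>2) / 4)) \<longlonglongrightarrow> 0"
    by (simp only: div_0 add_0_right)
  have "(\<lambda>N. Re ((\<Sum>n<N. b n) /\<^sub>R real N) / 2 + Re ((\<Sum>n<N. (b n)\<^sup>2) /\<^sub>R real N) / 4) \<longlonglongrightarrow> Re 0 / 2 + Re 0 / 4"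
    by (intro tendsto_intros cb cb2) auto
  moreover have "Re ((\<Sum>n<N. b n) /\<^sub>R real N) / 2 + Re ((\<Sum>n<N. (b n)\<^sup>2) /\<^sub>R real N) / 4
     = (\<Sum>n<N. Re (b n) / 2 + Re ((b n)\<^sup>2) / 4) /\<^sub>R real N" for N
    by (simp add: sum.distrib sum_divide_distrib[symmetric] distrib_left)
  ultimately have "(\<lambda>N. (\<Sum>n<N. Re (b n) / 2 + Re ((b n)\<^sup>2) / 4) /\<^sub>R real N) \<longlonglongrightarrow> 0" by simp
  from Cesaro_null_imp_log_mean_null[OF Cesaro_null_diff[OF lim this]]
  have l0: "(\<lambda>n. (\<Sum>k<n. 1 / real (Suc k) * (D k - 1/4)) / ln (real n)) \<longlonglongrightarrow> 0"
    by (simp only: real_scaleR_def divide_inverse_commute[symmetric])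
  have l1: "(\<lambda>n. (\<Sum>k<n. 1 / (4 * real (Suc k))) / ln (real n)) \<longlonglongrightarrow> 1/4"
    by (rule weighted_sum_ln_limit) (simp del: of_nat_Suc)
  have "(\<lambda>n. 1 / F * ((\<Sum>k<n. 1 / real (Suc k) * (D k - 1/4)) / ln (real n) + (\<Sum>k<n. 1 / (4 * real (Suc k))) / ln (real n)))
     \<longlonglongrightarrow> 1 / F * (0 + 1/4)"
    by (intro tendsto_intros l0 l1)
  moreover have "1 / F * ((\<Sum>k<n. 1 / real (Suc k) * (D k - 1/4)) / ln (real n) + (\<Sum>k<n. 1 / (4 * real (Suc k))) / ln (real n))
     = (\<Sum>k<n. log_drift (z k) (amp z x a0 k)) / ln (real n)" for n
  proof -
    have "1 / real (Suc k) * (D k - 1/4) + 1 / (4 * real (Suc k)) = F * log_drift (z k) (amp z x a0 k)" for k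
      using F by (simp add: D_def field_simps del: of_nat_Suc)
    then have "(\<Sum>k<n. 1 / real (Suc k) * (D k - 1/4)) + (\<Sum>k<n. 1 / (4 * real (Suc k)))
      = F * (\<Sum>k<n. log_drift (z k) (amp z x a0 k))"
      by (simp only: sum.distrib[symmetric] sum_distrib_left)
    then show ?thesis using F by (simp only: add_divide_distrib[symmetric]) simp
  qed
  ultimately have "(\<lambda>n. (\<Sum>k<n. log_drift (z k) (amp z x a0 k)) / ln (real n)) \<longlonglongrightarrow> 1 / F * (0 + 1/4)"
    by (simp only:)
  then show ?thesis by (simp add: mult.commute)
qed

text \<open>Separates path from probability: \<open>slope\<close> and \<open>drift\<close> are the
  two martingale inputs, \<open>cubic\<close> makes the expansion error summable, and what remains
  is \<open>v\<close> times the averaged drift.\<close>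

lemma amp_growth:
  assumes a0: "a0 \<noteq> 0" and xm: "(\<lambda>n. x n * (norm (z n))\<^sup>2) \<longlonglongrightarrow> 0"
    and slope: "(\<lambda>n. (\<Sum>k<n. x k * log_slope (z k) (amp z x a0 k)) / ln (real n)) \<longlonglongrightarrow> 0"
    and drift: "(\<lambda>n. (\<Sum>k<n. ((x k)\<^sup>2 - v) * log_drift (z k) (amp z x a0 k)) / ln (real n)) \<longlonglongrightarrow> 0"
    and cubic: "summable (\<lambda>k. (\<bar>x k\<bar> * (norm (z k))\<^sup>2) ^ 3)"
  shows "(\<lambda>n. ln ((norm (amp z x a0 n))\<^sup>2) / ln (real n)) \<longlonglongrightarrow> v / (4 * F)"
proof -
  let ?a = "amp z x a0"
  define err where "err = (\<lambda>k. ln ((norm (?a (Suc k)))\<^sup>2) - ln ((norm (?a k))\<^sup>2)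
     - x k * log_slope (z k) (?a k) - (x k)\<^sup>2 * log_drift (z k) (?a k))"
  have a: "?a n \<noteq> 0" for n using amp_nonzero[OF a0] .
  have "eventually (\<lambda>n. \<bar>x n * (norm (z n))\<^sup>2\<bar> < 1/4) sequentially"
    using tendsto_rabs_zero[OF xm] by (rule order_tendstoD) simp
  then have "eventually (\<lambda>n. norm (err n) \<le> 18 * (\<bar>x n\<bar> * (norm (z n))\<^sup>2) ^ 3) sequentially"
  proof eventually_elim
    case (elim n)
    then show ?case unfolding err_def real_norm_def using log_kick[OF a, of "x n" "z n" n]
      by (simp add: abs_mult)
  qed
  then have "summable err"
    by (rule summable_comparison_test_ev) (intro summable_mult cubic)
  then have "(\<lambda>n. \<Sum>k<n. err k) \<longlonglongrightarrow> suminf err" by (rule summable_LIMSEQ)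
  then have e0: "(\<lambda>n. (ln ((norm a0)\<^sup>2) + (\<Sum>k<n. err k)) / ln (real n)) \<longlonglongrightarrow> 0"
    by (rule tendsto_divide_0[OF tendsto_add[OF tendsto_const]]) real_asymp
  have "(\<lambda>n. (\<Sum>k<n. x k * log_slope (z k) (?a k)) / ln (real n)
     + (\<Sum>k<n. ((x k)\<^sup>2 - v) * log_drift (z k) (?a k)) / ln (real n)
     + v * ((\<Sum>k<n. log_drift (z k) (?a k)) / ln (real n))
     + (ln ((norm a0)\<^sup>2) + (\<Sum>k<n. err k)) / ln (real n)) \<longlonglongrightarrow> 0 + 0 + v * (1 / (4 * F)) + 0"
    by (intro tendsto_add slope drift e0 tendsto_mult tendsto_const log_drift_average[OF a0 xm])
  moreover have "(\<Sum>k<n. x k * log_slope (z k) (?a k)) / ln (real n)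
     + (\<Sum>k<n. ((x k)\<^sup>2 - v) * log_drift (z k) (?a k)) / ln (real n)
     + v * ((\<Sum>k<n. log_drift (z k) (?a k)) / ln (real n))
     + (ln ((norm a0)\<^sup>2) + (\<Sum>k<n. err k)) / ln (real n) = ln ((norm (?a n))\<^sup>2) / ln (real n)" for n
  proof -
    have "ln ((norm (?a n))\<^sup>2) = (\<Sum>k<n. x k * log_slope (z k) (?a k))
      + (\<Sum>k<n. ((x k)\<^sup>2 - v) * log_drift (z k) (?a k)) + v * (\<Sum>k<n. log_drift (z k) (?a k))
      + (ln ((norm a0)\<^sup>2) + (\<Sum>k<n. err k))"
    proof (induction n)
      case (Suc n)
      have "ln ((norm (?a (Suc n)))\<^sup>2) = ln ((norm (?a n))\<^sup>2) + x n * log_slope (z n) (?a n) + (x n)\<^sup>2 * log_drift (z n) (?a n) + err n"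
        by (simp add: err_def)
      then show ?case unfolding Suc by (simp add: algebra_simps del: amp.simps)
    qed simp
    then show ?thesis by (simp add: add_divide_distrib)
  qed
  ultimately show ?thesis by simp
qed

end

section \<open>Random couplings: almost sure growth\<close>

lemma summable_inverse_ln_powr: "summable (\<lambda>k. 1 / real (Suc k) / ln (real k + 3) powr (4/3))"
proof -
  \<comment> \<open>The increments of \<open>ln k powr (-1/3)\<close> are of the order of
    \<open>1 / (k * ln k powr (4/3))\<close>, so the series is compared with a telescoping one; the
    shifts keep the logarithms positive.\<close>
  define f where "f = (\<lambda>k. ln (real k + 2) powr (-1/3))"
  have f0: "f \<longlonglongrightarrow> 0" unfolding f_def by real_asymp
  have mono: "f (Suc k) \<le> f k" for k
    unfolding f_def by (intro powr_mono2') auto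
  have "summable (\<lambda>k. f k - f (Suc k))" using telescope_summable'[OF f0] .
  then have "summable (\<lambda>k. norm (f k - f (Suc k)))" using mono by simp
  moreover have "(\<lambda>k. 1 / real (Suc k) / ln (real k + 3) powr (4/3)) \<in> O(\<lambda>k. f k - f (Suc k))"
    unfolding f_def by real_asymp
  ultimately show ?thesis by (rule summable_comparison_test_bigo)
qed

text \<open>Indexed from 0, with \<open>X k\<close> standing for the coupling at the site
  \<open>k + 1\<close>; hence \<open>Suc k\<close> in the moment and decay conditions.\<close>

locale centred_noise = independent_noise +
  fixes lam :: real
  assumes integrable_4: "\<And>k. integrable M (\<lambda>\<omega>. (X k \<omega>) ^ 4)"
    and centred: "\<And>k. expectation (X k) = 0"
    and variance: "\<And>k. expectation (\<lambda>\<omega>. (X k \<omega>)\<^sup>2) = lam\<^sup>2"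
    and summable_4: "summable (\<lambda>k. expectation (\<lambda>\<omega>. (X k \<omega>) ^ 4) / (real (Suc k))\<^sup>2)"
    and small: "AE \<omega> in M. (\<lambda>k. X k \<omega> / real (Suc k) powr (1/4)) \<longlonglongrightarrow> 0"
begin

lemma integrable_2: "integrable M (\<lambda>\<omega>. (X k \<omega>)\<^sup>2)"
proof (rule square_integrable_imp_integrable)
  show "integrable M (\<lambda>\<omega>. ((X k \<omega>)\<^sup>2)\<^sup>2)" using integrable_4[of k] by simp
qed measurable

lemma centred_square:
  "integrable M (\<lambda>\<omega>. ((X k \<omega>)\<^sup>2 - lam\<^sup>2)\<^sup>2)"
  "expectation (\<lambda>\<omega>. (X k \<omega>)\<^sup>2 - lam\<^sup>2) = 0"
  "expectation (\<lambda>\<omega>. ((X k \<omega>)\<^sup>2 - lam\<^sup>2)\<^sup>2) \<le> expectation (\<lambda>\<omega>. (X k \<omega>) ^ 4)"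
proof -
  have e: "((X k \<omega>)\<^sup>2 - lam\<^sup>2)\<^sup>2 = (X k \<omega>)^4 - 2 * lam\<^sup>2 * (X k \<omega>)\<^sup>2 + lam^4" for \<omega>
    by (simp add: power2_diff)
  show "integrable M (\<lambda>\<omega>. ((X k \<omega>)\<^sup>2 - lam\<^sup>2)\<^sup>2)"
    unfolding e using integrable_4 integrable_2 by auto
  show "expectation (\<lambda>\<omega>. (X k \<omega>)\<^sup>2 - lam\<^sup>2) = 0"
    using integrable_2[of k] variance[of k] by (simp add: prob_space)
  have "expectation (\<lambda>\<omega>. ((X k \<omega>)\<^sup>2 - lam\<^sup>2)\<^sup>2) = expectation (\<lambda>\<omega>. (X k \<omega>)^4) - 2 * lam\<^sup>2 * lam\<^sup>2 + lam^4"
    unfolding e using integrable_4[of k] integrable_2[of k] variance[of k] by (simp add: prob_space)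
  also have "\<dots> = expectation (\<lambda>\<omega>. (X k \<omega>)^4) - (lam\<^sup>2)\<^sup>2"
    by (simp add: power2_eq_square power4_eq_xxxx)
  finally show "expectation (\<lambda>\<omega>. ((X k \<omega>)\<^sup>2 - lam\<^sup>2)\<^sup>2) \<le> expectation (\<lambda>\<omega>. (X k \<omega>) ^ 4)" by simp
qed

text \<open>The amplitude at \<open>n\<close> uses the couplings below \<open>n\<close> only, so the
  slope and drift coefficients that multiply functions of \<open>X n\<close> are
  predictable.\<close>

lemma amp_past_measurable: "(\<lambda>\<omega>. amp z (\<lambda>k. X k \<omega>) a n) \<in> borel_measurable (past M X n)"
proof (induction n)
  case (Suc n)
  have [measurable]: "(\<lambda>\<omega>. amp z (\<lambda>k. X k \<omega>) a n) \<in> borel_measurable (past M X (Suc n))"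
    using measurable_past_mono[OF Suc] by simp
  have [measurable]: "X n \<in> borel_measurable (past M X (Suc n))"
    by (rule past_coordinate_measurable) simp
  show ?case unfolding amp.simps kick_def by measurable
qed simp

lemma log_slope_past_measurable: "(\<lambda>\<omega>. log_slope y (amp z (\<lambda>k. X k \<omega>) a n)) \<in> borel_measurable (past M X n)"
proof -
  note [measurable] = amp_past_measurable[of z a n]
  show ?thesis unfolding log_slope_def sgn_div_norm by measurable
qed

lemma log_drift_past_measurable: "(\<lambda>\<omega>. log_drift y (amp z (\<lambda>k. X k \<omega>) a n)) \<in> borel_measurable (past M X n)"
proof -
  note [measurable] = amp_past_measurable[of z a n] log_slope_past_measurable[of y z a n]
  show ?thesis unfolding log_drift_def sgn_div_norm by measurable
qed

lemma AE_summable_square: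
  assumes "\<delta> > 0"
  shows "AE \<omega> in M. summable (\<lambda>k. (X k \<omega>)\<^sup>2 * real (Suc k) powr (- 1 - \<delta>))"
proof (rule AE_summable_nonneg)
  have "summable (\<lambda>k. real k powr (- 1 - \<delta>))" using assms by (simp add: summable_real_powr_iff)
  then have "summable (\<lambda>k. real (Suc k) powr (- 1 - \<delta>))" by (subst summable_Suc_iff)
  then show "summable (\<lambda>k. expectation (\<lambda>\<omega>. (X k \<omega>)\<^sup>2 * real (Suc k) powr (- 1 - \<delta>)))"
    using integrable_2 variance by (simp add: summable_mult)
qed (use integrable_2 in auto)

context
  fixes F E :: real and z :: "nat \<Rightarrow> complex" and a0 :: complex
  assumes wkb_seq: "wkb_sequence F E z" and a0: "a0 \<noteq> 0"
begin

interpretation wkb_sequence F E z by (rule wkb_seq)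

abbreviation (input) "A \<omega> \<equiv> amp z (\<lambda>k. X k \<omega>) a0"

lemma A_nonzero: "A \<omega> k \<noteq> 0"
  by (rule amp_nonzero[OF a0])

text \<open>The coefficients are \<open>O(n powr (-1/2))\<close>, so the variance bounds are of
  order \<open>1 / n\<close> and narrowly fail to be summable. A logarithmic weight repairs this,
  and Abel summation puts it back.\<close>

lemma AE_slope_sum:
  "AE \<omega> in M. (\<lambda>n. (\<Sum>k<n. X k \<omega> * log_slope (z k) (A \<omega> k)) / ln (real n)) \<longlonglongrightarrow> 0"
proof -
  obtain C where C: "C > 0" "\<And>n. (norm (z n))\<^sup>2 \<le> C / sqrt (real (Suc n))" using norm_bound by blast
  \<comment> \<open>An exponent between \<open>1/2\<close> and \<open>1\<close>: the weighted variances are summable, and \<open>w n = o(ln n)\<close>.\<close>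
  define w where "w = (\<lambda>k::nat. ln (real k + 3) powr (2/3))"
  have w0: "w k > 0" for k by (auto simp: w_def)
  have winc: "incseq w" unfolding w_def by (intro incseq_SucI powr_mono2) auto
  have "AE \<omega> in M. summable (\<lambda>k. X k \<omega> * (log_slope (z k) (A \<omega> k) / w k))"
  proof (rule AE_summable_martingale[of "\<lambda>_ x. x" _ "\<lambda>k. C / sqrt (real (Suc k)) / w k"])
    show "(\<lambda>\<omega>. log_slope (z k) (A \<omega> k) / w k) \<in> borel_measurable (past M X k)" for k
      using log_slope_past_measurable by measurable
    show "\<bar>log_slope (z k) (A \<omega> k) / w k\<bar> \<le> C / sqrt (real (Suc k)) / w k" for k \<omega>
      using divide_right_mono[OF order_trans[OF abs_log_slope_le[OF A_nonzero] C(2)], of "w k"] w0[of k]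
      by (simp only: abs_divide abs_of_pos less_imp_le)
    have "(w k)\<^sup>2 = ln (real k + 3) powr (4/3)" for k
      by (simp add: w_def power2_eq_square powr_add[symmetric])
    then have "(C / sqrt (real (Suc k)) / w k)\<^sup>2 = C\<^sup>2 * (1 / real (Suc k) / ln (real k + 3) powr (4/3))" for k
      by (simp add: power_divide power_mult_distrib del: of_nat_Suc)
    then show "summable (\<lambda>k. expectation (\<lambda>\<omega>. (X k \<omega>)\<^sup>2) * (C / sqrt (real (Suc k)) / w k)\<^sup>2)"
      unfolding variance by (simp only:) (intro summable_mult summable_inverse_ln_powr)
  qed (use integrable_2 centred in auto)
  then show ?thesis
  proof eventually_elim
    case (elim \<omega>)
    let ?y = "\<lambda>k. X k \<omega> * (log_slope (z k) (A \<omega> k) / w k)"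
    have "Bseq (\<lambda>n. \<Sum>k<n. ?y k)"
      using summable_LIMSEQ[OF elim] convergentI convergent_imp_Bseq by blast
    then obtain B where B: "\<And>n. norm (\<Sum>k<n. ?y k) \<le> B" by (auto simp: Bseq_def)
    have "w k * ?y k = X k \<omega> * log_slope (z k) (A \<omega> k)" for k using w0[of k] by simp
    then have bd: "norm (\<Sum>k<n. X k \<omega> * log_slope (z k) (A \<omega> k)) \<le> 2 * B * w n" for n
      using Abel_summation_bound[of w ?y B n] w0 winc B by (simp add: less_imp_le)
    show ?case
    proof (rule Lim_null_comparison)
      show "eventually (\<lambda>n. norm ((\<Sum>k<n. X k \<omega> * log_slope (z k) (A \<omega> k)) / ln (real n)) \<le> 2 * B * (w n / ln (real n))) sequentially"
        using eventually_gt_at_top[of 1]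
      proof eventually_elim
        case (elim n)
        then show ?case using divide_right_mono[OF bd[of n], of "ln (real n)"] by simp
      qed
      have "(\<lambda>n. w n / ln (real n)) \<longlonglongrightarrow> 0" unfolding w_def by real_asymp
      from tendsto_mult[OF tendsto_const this, of "2 * B"]
      show "(\<lambda>n. 2 * B * (w n / ln (real n))) \<longlonglongrightarrow> 0" by simp
    qed
  qed
qed

text \<open>The coefficients are \<open>O(1 / n)\<close> and the variance of
  \<open>X^2 - lam^2\<close> is at most the fourth moment, so the variance series is dominated by
  \<open>summable_4\<close> and the sum even converges.\<close>

lemma AE_drift_sum:
  "AE \<omega> in M. (\<lambda>n. (\<Sum>k<n. ((X k \<omega>)\<^sup>2 - lam\<^sup>2) * log_drift (z k) (A \<omega> k)) / ln (real n)) \<longlonglongrightarrow> 0"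
proof -
  obtain C where C: "C > 0" "\<And>n. (norm (z n))\<^sup>2 \<le> C / sqrt (real (Suc n))" using norm_bound by blast
  have "AE \<omega> in M. summable (\<lambda>k. ((X k \<omega>)\<^sup>2 - lam\<^sup>2) * log_drift (z k) (A \<omega> k))"
  proof (rule AE_summable_martingale[of "\<lambda>_ x. x\<^sup>2 - lam\<^sup>2" _ "\<lambda>k. C\<^sup>2 / real (Suc k)"])
    show "\<bar>log_drift (z k) (A \<omega> k)\<bar> \<le> C\<^sup>2 / real (Suc k)" for k \<omega>
    proof -
      have "((norm (z k))\<^sup>2)\<^sup>2 \<le> (C / sqrt (real (Suc k)))\<^sup>2" by (intro power_mono C) simp
      then show ?thesis using abs_log_drift_le[OF A_nonzero, of "z k" \<omega> k]
        by (simp add: power_divide del: of_nat_Suc)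
    qed
    have "summable (\<lambda>k. C^4 * (expectation (\<lambda>\<omega>. (X k \<omega>) ^ 4) / (real (Suc k))\<^sup>2))"
      by (intro summable_mult summable_4)
    then show "summable (\<lambda>k. expectation (\<lambda>\<omega>. ((X k \<omega>)\<^sup>2 - lam\<^sup>2)\<^sup>2) * (C\<^sup>2 / real (Suc k))\<^sup>2)"
    proof (rule summable_comparison_test'[where N=0])
      fix k :: nat
      have "expectation (\<lambda>\<omega>. ((X k \<omega>)\<^sup>2 - lam\<^sup>2)\<^sup>2) \<ge> 0" by (rule Bochner_Integration.integral_nonneg) simp
      then show "norm (expectation (\<lambda>\<omega>. ((X k \<omega>)\<^sup>2 - lam\<^sup>2)\<^sup>2) * (C\<^sup>2 / real (Suc k))\<^sup>2)
         \<le> C^4 * (expectation (\<lambda>\<omega>. (X k \<omega>) ^ 4) / (real (Suc k))\<^sup>2)"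
        using mult_right_mono[OF centred_square(3)[of k], of "(C\<^sup>2 / real (Suc k))\<^sup>2"]
        by (simp add: power_divide abs_mult mult.commute del: of_nat_Suc)
    qed
  qed (use centred_square log_drift_past_measurable in auto)
  then show ?thesis
  proof eventually_elim
    case (elim \<omega>)
    show ?case by (rule tendsto_divide_0[OF summable_LIMSEQ[OF elim]]) real_asymp
  qed
qed

text \<open>In the cube one factor \<open>\<bar>X k\<bar>\<close> is bounded by
  \<open>n powr (1/4)\<close> for large \<open>k\<close>. With \<open>n powr (-3/2)\<close> from
  \<open>z\<close> this leaves \<open>X^2 * n powr (-5/4)\<close>, whose expectations are
  summable.\<close>

lemma AE_noise_small:
  "AE \<omega> in M. (\<lambda>n. X n \<omega> * (norm (z n))\<^sup>2) \<longlonglongrightarrow> 0 \<and> summable (\<lambda>k. (\<bar>X k \<omega>\<bar> * (norm (z k))\<^sup>2) ^ 3)"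
proof -
  obtain C where C: "C > 0" "\<And>n. (norm (z n))\<^sup>2 \<le> C / sqrt (real (Suc n))" using norm_bound by blast
  have "AE \<omega> in M. summable (\<lambda>k. (X k \<omega>)\<^sup>2 * real (Suc k) powr (- 1 - 1/4))"
    by (rule AE_summable_square) simp
  with small show ?thesis
  proof eventually_elim
    case (elim \<omega>)
    have "(\<lambda>k. C * \<bar>X k \<omega> / real (Suc k) powr (1/4)\<bar> * (real (Suc k) powr (1/4) / sqrt (real (Suc k)))) \<longlonglongrightarrow> C * 0 * 0"
      by (intro tendsto_mult tendsto_const tendsto_rabs_zero elim) real_asymp
    then have l: "(\<lambda>k. \<bar>X k \<omega>\<bar> * (C / sqrt (real (Suc k)))) \<longlonglongrightarrow> 0"
      by (simp add: abs_divide del: of_nat_Suc) (simp add: ac_simps)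
    have "(\<lambda>n. X n \<omega> * (norm (z n))\<^sup>2) \<longlonglongrightarrow> 0"
    proof (rule Lim_null_comparison[OF _ l])
      show "eventually (\<lambda>n. norm (X n \<omega> * (norm (z n))\<^sup>2) \<le> \<bar>X n \<omega>\<bar> * (C / sqrt (real (Suc n)))) sequentially"
        using C(2) by (intro always_eventually) (simp add: abs_mult mult_left_mono del: times_divide_eq_right)
    qed
    moreover have "summable (\<lambda>k. (\<bar>X k \<omega>\<bar> * (norm (z k))\<^sup>2) ^ 3)"
    proof (rule summable_comparison_test_ev)
      show "summable (\<lambda>k. C ^ 3 * ((X k \<omega>)\<^sup>2 * real (Suc k) powr (- 1 - 1/4)))"
        by (intro summable_mult elim)
      have "eventually (\<lambda>k. \<bar>X k \<omega> / real (Suc k) powr (1/4)\<bar> < 1) sequentially"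
        using tendsto_rabs_zero[OF elim(1)] by (rule order_tendstoD) simp
      then show "eventually (\<lambda>k. norm ((\<bar>X k \<omega>\<bar> * (norm (z k))\<^sup>2) ^ 3) \<le> C ^ 3 * ((X k \<omega>)\<^sup>2 * real (Suc k) powr (- 1 - 1/4))) sequentially"
      proof eventually_elim
        case (elim k)
        define n where "n = real (Suc k)"
        have n: "n > 0" by (simp add: n_def)
        have x: "\<bar>X k \<omega>\<bar> \<le> n powr (1/4)" using elim n by (simp add: n_def abs_divide pos_divide_less_eq)
        have "(\<bar>X k \<omega>\<bar> * (norm (z k))\<^sup>2) ^ 3 \<le> (\<bar>X k \<omega>\<bar> * (C / sqrt n)) ^ 3"
          using C(2)[of k] by (intro power_mono mult_left_mono) (auto simp: n_def)
        also have "\<dots> = C ^ 3 * ((X k \<omega>)\<^sup>2 * (\<bar>X k \<omega>\<bar> / (sqrt n) ^ 3))"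
        proof -
          have "(y * (C / s)) ^ 3 = C ^ 3 * (y\<^sup>2 * (y / s ^ 3))" for y s :: real
            by (simp add: power_mult_distrib power_divide power3_eq_cube power2_eq_square)
          from this[of "\<bar>X k \<omega>\<bar>" "sqrt n"] show ?thesis by (simp only: power2_abs)
        qed
        also have "\<dots> \<le> C ^ 3 * ((X k \<omega>)\<^sup>2 * (n powr (1/4) / (sqrt n) ^ 3))"
          using C(1) n x by (intro mult_left_mono divide_right_mono) auto
        also have "n powr (1/4) / (sqrt n) ^ 3 = n powr (- 1 - 1/4)"
        proof -
          have "(sqrt n) ^ 3 = n powr (3/2)" using n
            by (simp add: powr_half_sqrt[symmetric] powr_power)
          then show ?thesis by (simp add: powr_diff[symmetric])
        qed
        finally show ?case by (simp add: n_def)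
      qed
    qed
    ultimately show ?case by blast
  qed
qed

lemma AE_amp_growth:
  "AE \<omega> in M. (\<lambda>n. ln ((norm (A \<omega> n))\<^sup>2) / ln (real n)) \<longlonglongrightarrow> lam\<^sup>2 / (4 * F)"
  using AE_slope_sum AE_drift_sum AE_noise_small
proof eventually_elim
  case (elim \<omega>)
  then show ?case using amp_growth[OF a0, of "\<lambda>k. X k \<omega>" "lam\<^sup>2"] by blast
qed

end

end

section \<open>Ratio of two amplitudes\<close>

text \<open>The conserved quantity is the Wronskian of the two solutions; each kick is a real-linear
  shear of determinant 1.\<close>

lemma amp_wronskian:
  "Im (amp z x b n * cnj (amp z x a n)) = Im (b * cnj a)"
proof (induction n)
  case (Suc n)
  have "Im (kick z x b * cnj (kick z x a)) = Im (b * cnj a)" for z x b a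
    by (simp add: kick_def algebra_simps)
  then show ?case using Suc by simp
qed simp

text \<open>For \<open>b \<noteq> 0\<close> this is the quotient
  \<open>kick z x b / b\<close>.\<close>

definition kick_factor :: "complex \<Rightarrow> real \<Rightarrow> complex \<Rightarrow> complex" where
  "kick_factor z x b = 1 - \<i> * of_real (x * Re (sgn b * z)) * cnj (sgn b * z)"

text \<open>Cross-multiplication leaves only the Wronskian in the numerator. Beyond first order the
  coupling enters through the last factor alone, so splitting \<open>1 / kick_factor\<close> as 1
  plus a remainder isolates the martingale part.\<close>

lemma kick_ratio_diff:
  assumes "b \<noteq> 0"
  shows "kick z x a / kick z x b - a / b = of_real (x * Im (b * cnj a)) * (cnj z)\<^sup>2 / b\<^sup>2 * (1 / kick_factor z x b)"
proof -
  define u where "u = kick_factor z x b"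
  have ku: "kick z x b = b * u" using kick_eq_mult[OF assms(1)] by (simp add: u_def kick_factor_def)
  have k0: "kick z x b \<noteq> 0" by (rule kick_nonzero[OF assms(1)])
  have key: "\<i> * (b * of_real (Re (a * z)) - a * of_real (Re (b * z))) = - (of_real (Im (b * cnj a)) * cnj z)"
    by (simp add: complex_eq_iff algebra_simps)
  have "kick z x a / kick z x b - a / b = (b * kick z x a - a * kick z x b) / (b * kick z x b)"
    using k0 assms(1) by (simp add: field_simps)
  also have "b * kick z x a - a * kick z x b
      = - (of_real x * cnj z * (\<i> * (b * of_real (Re (a * z)) - a * of_real (Re (b * z)))))"
    by (simp add: kick_def algebra_simps)
  also have "\<dots> = of_real (x * Im (b * cnj a)) * (cnj z)\<^sup>2"
    unfolding key by (simp add: power2_eq_square)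
  also have "b * kick z x b = b\<^sup>2 * u" unfolding ku by (simp add: power2_eq_square)
  finally show ?thesis by (simp add: u_def)
qed

lemma kick_factor_inverse:
  assumes "b \<noteq> 0" "\<bar>x\<bar> * (norm z)\<^sup>2 \<le> 1/2"
  shows "norm (1 / kick_factor z x b - 1) \<le> 2 * (\<bar>x\<bar> * (norm z)\<^sup>2)"
proof -
  define u where "u = kick_factor z x b"
  define e where "e = sgn b * z"
  have e: "norm e = norm z" using norm_sgn_mult[OF assms(1)] by (simp add: e_def)
  have "norm (1 - u) = \<bar>x\<bar> * (\<bar>Re e\<bar> * norm e)"
    by (simp add: u_def kick_factor_def e_def[symmetric] norm_mult abs_mult del: complex_cnj_mult times_complex.sel)
  also have "\<dots> \<le> \<bar>x\<bar> * (norm e * norm e)"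
    by (intro mult_left_mono mult_right_mono abs_Re_le_cmod) auto
  finally have 1: "norm (1 - u) \<le> \<bar>x\<bar> * (norm z)\<^sup>2" by (simp add: e power2_eq_square)
  have u: "norm u \<ge> 1/2" using norm_triangle_ineq2[of 1 "1 - u"] 1 assms(2) by simp
  then have "u \<noteq> 0" by auto
  then have "1 / u - 1 = (1 - u) / u" by (simp add: field_simps)
  then have "norm (1 / u - 1) = norm (1 - u) / norm u" by (simp add: norm_divide)
  also have "\<dots> \<le> (\<bar>x\<bar> * (norm z)\<^sup>2) / (1/2)" using 1 u by (intro frac_le) auto
  finally show ?thesis by (simp add: u_def)
qed

text \<open>The truncation makes the weight bounded by a deterministic sequence; on the event of interest it is
  eventually inactive.\<close>

definition tail_weight :: "real \<Rightarrow> real \<Rightarrow> (nat \<Rightarrow> complex) \<Rightarrow> nat \<Rightarrow> complex \<Rightarrow> complex" where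
  "tail_weight \<gamma> \<gamma>' z k b =
     (if real (Suc k) powr \<gamma>' \<le> (norm b)\<^sup>2 then of_real (real (Suc k) powr \<gamma>) * (cnj (z k))\<^sup>2 / b\<^sup>2 else 0)"

text \<open>The gap between the exponents pays here: the square of this bound is
  \<open>O(n powr (- 1 - 2 * (\<gamma>' - \<gamma>)))\<close>, hence summable.\<close>

lemma norm_tail_weight_le:
  assumes "(norm (z k))\<^sup>2 \<le> C / sqrt (real (Suc k))"
  shows "norm (tail_weight \<gamma> \<gamma>' z k b) \<le> C * real (Suc k) powr (\<gamma> - \<gamma>' - 1/2)"
proof -
  let ?n = "real (Suc k)"
  have C0: "C \<ge> 0"
    using order_trans[OF zero_le_power2 assms] by (simp add: zero_le_divide_iff del: of_nat_Suc)
  show ?thesis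
  proof (cases "?n powr \<gamma>' \<le> (norm b)\<^sup>2")
    case True
    have "norm (tail_weight \<gamma> \<gamma>' z k b) = ?n powr \<gamma> * (norm (z k))\<^sup>2 / (norm b)\<^sup>2"
      using True by (simp add: tail_weight_def norm_mult norm_divide norm_power del: of_nat_Suc)
    also have "\<dots> \<le> ?n powr \<gamma> * (C / sqrt ?n) / ?n powr \<gamma>'"
      using True assms C0 by (intro frac_le mult_left_mono) (auto simp del: of_nat_Suc)
    also have "\<dots> = C * ?n powr (\<gamma> - \<gamma>' - 1/2)"
      by (simp add: powr_diff powr_half_sqrt mult.commute del: of_nat_Suc)
    finally show ?thesis .
  qed (use C0 in \<open>simp add: tail_weight_def del: of_nat_Suc\<close>)
qed

text \<open>The increments of the ratio, multiplied by \<open>n powr \<gamma>\<close>, are summed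
  and \<open>convergent_Abel_tail\<close> turns the bound into a rate. The growth hypothesis makes
  the truncation in \<open>tail_weight\<close> inactive from some index on.\<close>

lemma ratio_converges:
  fixes x :: "nat \<Rightarrow> real" and z :: "nat \<Rightarrow> complex"
  assumes b0: "b0 \<noteq> 0" and \<gamma>: "0 < \<gamma>" "\<gamma> < \<gamma>'"
    and C: "\<And>n. (norm (z n))\<^sup>2 \<le> C / sqrt (real (Suc n))"
    and xm: "(\<lambda>n. x n * (norm (z n))\<^sup>2) \<longlonglongrightarrow> 0"
    and grow: "eventually (\<lambda>n. real (Suc n) powr \<gamma>' \<le> (norm (amp z x b0 n))\<^sup>2) sequentially"
    and mart: "summable (\<lambda>k. of_real (x k) * tail_weight \<gamma> \<gamma>' z k (amp z x b0 k))"
    and sq: "summable (\<lambda>k. (x k)\<^sup>2 * real (Suc k) powr (- 1 - (\<gamma>' - \<gamma>)))"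
  shows "\<exists>l B. (\<lambda>n. amp z x a0 n / amp z x b0 n) \<longlonglongrightarrow> l \<and>
    (\<forall>n. norm (amp z x a0 n / amp z x b0 n - l) \<le> B / real (Suc n) powr \<gamma>)"
proof -
  define a b where "a = amp z x a0" and "b = amp z x b0"
  define K where "K = Im (b0 * cnj a0)"
  define u where "u = (\<lambda>n. kick_factor (z n) (x n) (b n))"
  define T where "T = (\<lambda>k. tail_weight \<gamma> \<gamma>' z k (b k))"
  let ?w = "\<lambda>k. real (Suc k) powr \<gamma>" and ?\<rho> = "\<lambda>n. a n / b n"
  have bn: "b n \<noteq> 0" for n using amp_nonzero[OF b0] by (simp add: b_def)
  have diff: "?\<rho> (Suc k) - ?\<rho> k = of_real (x k * K) * (cnj (z k))\<^sup>2 / (b k)\<^sup>2 * (1 / u k)" for k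
    using kick_ratio_diff[OF bn, of "z k" "x k" "a k" k]
    unfolding a_def b_def amp.simps amp_wronskian K_def u_def by simp
  have s1: "summable (\<lambda>k. of_real (x k) * T k)" using mart by (simp add: T_def b_def)
  \<comment> \<open>The nonlinear remainder is no martingale but converges absolutely: one more
    factor \<open>\<bar>x k\<bar> * norm (z k)^2\<close> brings it to
    \<open>x^2 * n powr (- 1 - (\<gamma>' - \<gamma>))\<close>.\<close>
  have s2: "summable (\<lambda>k. of_real (x k) * T k * (1 / u k - 1))"
  proof (rule summable_comparison_test_ev)
    show "summable (\<lambda>k. 2 * C\<^sup>2 * ((x k)\<^sup>2 * real (Suc k) powr (- 1 - (\<gamma>' - \<gamma>))))"
      by (intro summable_mult sq)
    have "eventually (\<lambda>n. \<bar>x n * (norm (z n))\<^sup>2\<bar> < 1/2) sequentially"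
      using tendsto_rabs_zero[OF xm] by (rule order_tendstoD) simp
    then show "eventually (\<lambda>k. norm (of_real (x k) * T k * (1 / u k - 1)) \<le> 2 * C\<^sup>2 * ((x k)\<^sup>2 * real (Suc k) powr (- 1 - (\<gamma>' - \<gamma>)))) sequentially"
    proof eventually_elim
      case (elim k)
      let ?n = "real (Suc k)"
      have "norm (1 / u k - 1) \<le> 2 * (\<bar>x k\<bar> * (norm (z k))\<^sup>2)"
        unfolding u_def using elim by (intro kick_factor_inverse bn) (simp add: abs_mult)
      also have "\<dots> \<le> 2 * (\<bar>x k\<bar> * (C / sqrt ?n))"
        by (intro mult_left_mono C) auto
      finally have i: "norm (1 / u k - 1) \<le> 2 * (\<bar>x k\<bar> * (C / sqrt ?n))" .
      have t: "norm (T k) \<le> C * ?n powr (\<gamma> - \<gamma>' - 1/2)"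
        unfolding T_def by (rule norm_tail_weight_le[OF C])
      have "norm (of_real (x k) * T k * (1 / u k - 1)) = \<bar>x k\<bar> * (norm (T k) * norm (1 / u k - 1))"
        by (simp only: norm_mult norm_of_real mult.assoc)
      also have "\<dots> \<le> \<bar>x k\<bar> * ((C * ?n powr (\<gamma> - \<gamma>' - 1/2)) * (2 * (\<bar>x k\<bar> * (C / sqrt ?n))))"
        using t i by (intro mult_left_mono mult_mono order_trans[OF norm_ge_zero t]) auto
      also have "\<dots> = 2 * C\<^sup>2 * ((x k)\<^sup>2 * (?n powr (\<gamma> - \<gamma>' - 1/2) / sqrt ?n))"
        by (simp add: power2_eq_square del: of_nat_Suc)
      also have "?n powr (\<gamma> - \<gamma>' - 1/2) / sqrt ?n = ?n powr (- 1 - (\<gamma>' - \<gamma>))"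
      proof -
        have "\<gamma> - \<gamma>' - 1/2 - 1/2 = - 1 - (\<gamma>' - \<gamma>)" by simp
        then show ?thesis
          by (metis of_nat_0_le_iff powr_diff powr_half_sqrt)
      qed
      finally show ?case .
    qed
  qed
  have "eventually (\<lambda>k. ?w k *\<^sub>R (?\<rho> (Suc k) - ?\<rho> k) = of_real K * (of_real (x k) * T k + of_real (x k) * T k * (1 / u k - 1))) sequentially"
    using grow
  proof eventually_elim
    case (elim k)
    then have "T k = of_real (?w k) * (cnj (z k))\<^sup>2 / (b k)\<^sup>2"
      by (simp add: T_def tail_weight_def b_def)
    then have "?w k *\<^sub>R (?\<rho> (Suc k) - ?\<rho> k) = of_real K * (of_real (x k) * T k * (1 / u k))"
      unfolding diff by (simp add: scaleR_conv_of_real ac_simps)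
    also have "\<dots> = of_real K * (of_real (x k) * T k + of_real (x k) * T k * (1 / u k - 1))"
      by (simp only: right_diff_distrib mult_1_right) simp
    finally show ?case .
  qed
  moreover have "summable (\<lambda>k. of_real K * (of_real (x k) * T k + of_real (x k) * T k * (1 / u k - 1)))"
    by (intro summable_mult summable_add s1 s2)
  ultimately have "summable (\<lambda>k. ?w k *\<^sub>R (?\<rho> (Suc k) - ?\<rho> k))"
    by (simp only: summable_cong)
  then have "Bseq (\<lambda>n. \<Sum>k<n. ?w k *\<^sub>R (?\<rho> (Suc k) - ?\<rho> k))"
    using summable_LIMSEQ convergentI convergent_imp_Bseq by blast
  then obtain B where B: "\<And>n. norm (\<Sum>k<n. ?w k *\<^sub>R (?\<rho> (Suc k) - ?\<rho> k)) \<le> B" by (auto simp: Bseq_def)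
  have "\<exists>l. ?\<rho> \<longlonglongrightarrow> l \<and> (\<forall>n. norm (?\<rho> n - l) \<le> 4 * B / ?w n)"
  proof (rule convergent_Abel_tail[OF _ _ _ B])
    show "incseq ?w" using \<gamma> by (intro incseq_SucI powr_mono2) auto
    show "filterlim ?w at_top sequentially" using \<gamma> by real_asymp
  qed simp
  then show ?thesis unfolding a_def b_def by blast
qed

context centred_noise
begin

text \<open>The martingale theorem is real, so it is applied to the real and the imaginary part of
  the weight with the same bound.\<close>

lemma AE_summable_tail_weight:
  assumes C: "\<And>n. (norm (z n))\<^sup>2 \<le> C / sqrt (real (Suc n))" and \<gamma>: "\<gamma> < \<gamma>'"
  shows "AE \<omega> in M. summable (\<lambda>k. of_real (X k \<omega>) * tail_weight \<gamma> \<gamma>' z k (amp z (\<lambda>k. X k \<omega>) b0 k))"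
proof -
  let ?Y = "\<lambda>k \<omega>. tail_weight \<gamma> \<gamma>' z k (amp z (\<lambda>k. X k \<omega>) b0 k)"
  let ?b = "\<lambda>k. C * real (Suc k) powr (\<gamma> - \<gamma>' - 1/2)"
  have Ym: "?Y k \<in> borel_measurable (past M X k)" for k
  proof -
    note [measurable] = amp_past_measurable[of z b0 k]
    show ?thesis unfolding tail_weight_def by measurable
  qed
  have "summable (\<lambda>k. real k powr (- 1 - 2 * (\<gamma>' - \<gamma>)))" using \<gamma> by (simp add: summable_real_powr_iff)
  then have "summable (\<lambda>k. real (Suc k) powr (- 1 - 2 * (\<gamma>' - \<gamma>)))" by (subst summable_Suc_iff)
  then have "summable (\<lambda>k. lam\<^sup>2 * (C\<^sup>2 * real (Suc k) powr (- 1 - 2 * (\<gamma>' - \<gamma>))))" by (intro summable_mult)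
  moreover have "(?b k)\<^sup>2 = C\<^sup>2 * real (Suc k) powr (- 1 - 2 * (\<gamma>' - \<gamma>))" for k
    by (simp add: power_mult_distrib powr_power algebra_simps del: of_nat_Suc)
  ultimately have sb: "summable (\<lambda>k. expectation (\<lambda>\<omega>. (X k \<omega>)\<^sup>2) * (?b k)\<^sup>2)"
    by (simp only: variance)
  have "AE \<omega> in M. summable (\<lambda>k. X k \<omega> * Re (?Y k \<omega>))"
  proof (rule AE_summable_martingale[of "\<lambda>_ x. x" _ ?b, OF _ _ _ _ _ sb])
    show "(\<lambda>\<omega>. Re (?Y k \<omega>)) \<in> borel_measurable (past M X k)" for k using Ym[of k] by measurable
    show "\<bar>Re (?Y k \<omega>)\<bar> \<le> ?b k" for k \<omega>
      using abs_Re_le_cmod order_trans[OF _ norm_tail_weight_le[of z k, OF C]] by blast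
  qed (use integrable_2 centred in auto)
  moreover have "AE \<omega> in M. summable (\<lambda>k. X k \<omega> * Im (?Y k \<omega>))"
  proof (rule AE_summable_martingale[of "\<lambda>_ x. x" _ ?b, OF _ _ _ _ _ sb])
    show "(\<lambda>\<omega>. Im (?Y k \<omega>)) \<in> borel_measurable (past M X k)" for k using Ym[of k] by measurable
    show "\<bar>Im (?Y k \<omega>)\<bar> \<le> ?b k" for k \<omega>
      using abs_Im_le_cmod order_trans[OF _ norm_tail_weight_le[of z k, OF C]] by blast
  qed (use integrable_2 centred in auto)
  ultimately show ?thesis
    by eventually_elim (simp add: summable_complex_iff)
qed

end

text \<open>With \<open>z = \<sigma> * w + \<tau> * cnj w\<close> one has
  \<open>Re (a * z) = Re ((\<sigma> * a + cnj \<tau> * cnj a) * w)\<close>, so both amplitudes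
  represent the same solution. Determinant 1 of the real-linear map preserves the form of the
  kick.\<close>

lemma amp_intertwine:
  assumes nrm: "(norm \<sigma>)\<^sup>2 - (norm \<tau>)\<^sup>2 = 1" and z: "\<And>n. z n = \<sigma> * w n + \<tau> * cnj (w n)"
  shows "\<sigma> * amp z x a n + cnj \<tau> * cnj (amp z x a n) = amp w x (\<sigma> * a + cnj \<tau> * cnj a) n"
proof (induction n)
  case (Suc n)
  define b where "b = amp z x a n"
  define y where "y = w n"
  have zn: "z n = \<sigma> * y + \<tau> * cnj y" by (simp add: z y_def)
  have re: "Re (b * z n) = Re ((\<sigma> * b + cnj \<tau> * cnj b) * y)"
    unfolding zn by (simp add: algebra_simps)
  have st: "\<sigma> * cnj \<sigma> - \<tau> * cnj \<tau> = 1"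
  proof -
    have "\<sigma> * cnj \<sigma> - \<tau> * cnj \<tau> = complex_of_real ((norm \<sigma>)\<^sup>2 - (norm \<tau>)\<^sup>2)"
      by (simp only: of_real_diff complex_norm_square)
    then show ?thesis unfolding nrm by simp
  qed
  have "\<sigma> * kick (z n) t b + cnj \<tau> * cnj (kick (z n) t b)
      = (\<sigma> * b + cnj \<tau> * cnj b) - \<i> * of_real (t * Re (b * z n)) * (\<sigma> * cnj (z n) - cnj \<tau> * z n)" for t
  proof -
    define s where "s = t * Re (b * z n)"
    have k: "kick (z n) t b = b - \<i> * of_real s * cnj (z n)" by (simp only: kick_def s_def)
    show ?thesis unfolding k s_def[symmetric] by (simp add: algebra_simps)
  qed
  moreover have "\<sigma> * cnj (z n) - cnj \<tau> * z n = (\<sigma> * cnj \<sigma> - \<tau> * cnj \<tau>) * cnj y"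
    unfolding zn by (simp add: algebra_simps)
  ultimately have "\<sigma> * kick (z n) t b + cnj \<tau> * cnj (kick (z n) t b) = kick y t (\<sigma> * b + cnj \<tau> * cnj b)" for t
    unfolding st re by (simp only: kick_def mult_1_left)
  then show ?case using Suc by (simp add: b_def y_def)
qed simp

text \<open>Transfers growth from the WKB frame, where \<open>c\<close> lives, to the original
  amplitude \<open>a\<close>, which is comparable up to the factor \<open>S\<close>.\<close>

lemma growth_imp_lower_bound:
  fixes c a :: "nat \<Rightarrow> complex"
  assumes lim: "(\<lambda>n. ln ((norm (c n))\<^sup>2) / ln (real n)) \<longlonglongrightarrow> L" and "\<gamma> < L"
    and c0: "\<And>n. c n \<noteq> 0" and S: "S > 0" "\<And>n. norm (c n) \<le> S * norm (a n)"
  shows "eventually (\<lambda>n. real (Suc n) powr \<gamma> \<le> (norm (a n))\<^sup>2) sequentially"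
proof -
  \<comment> \<open>The midpoint leaves room for the constant \<open>S\<close> and for
    \<open>Suc n\<close> in place of \<open>n\<close>, both negligible against
    \<open>ln n\<close>.\<close>
  define \<gamma>' where "\<gamma>' = (\<gamma> + L) / 2"
  have g: "\<gamma> < \<gamma>'" "\<gamma>' < L" using \<open>\<gamma> < L\<close> by (auto simp: \<gamma>'_def)
  have "(\<lambda>n. (2 * ln S + \<gamma> * ln (real (Suc n))) / ln (real n)) \<longlonglongrightarrow> \<gamma>" by real_asymp
  then have "eventually (\<lambda>n. (2 * ln S + \<gamma> * ln (real (Suc n))) / ln (real n) < \<gamma>') sequentially"
    using g(1) by (rule order_tendstoD)
  moreover have "eventually (\<lambda>n. \<gamma>' < ln ((norm (c n))\<^sup>2) / ln (real n)) sequentially"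
    using lim g(2) by (rule order_tendstoD)
  ultimately show ?thesis using eventually_gt_at_top[of 1]
  proof eventually_elim
    case (elim n)
    have "ln (real n) > 0" using elim by simp
    then have 1: "2 * ln S + \<gamma> * ln (real (Suc n)) < ln ((norm (c n))\<^sup>2)"
      using elim by (auto simp: divide_less_eq less_divide_eq simp del: of_nat_Suc dest: order.strict_trans)
    have a0: "norm (a n) > 0" using S(2)[of n] c0[of n] by (cases "a n = 0") auto
    have "(norm (c n))\<^sup>2 \<le> S\<^sup>2 * (norm (a n))\<^sup>2"
      using power_mono[OF S(2)[of n], of 2] by (simp add: power_mult_distrib)
    then have "ln ((norm (c n))\<^sup>2) \<le> ln (S\<^sup>2 * (norm (a n))\<^sup>2)"
      using c0[of n] by (intro ln_mono) auto
    also have "\<dots> = 2 * ln S + ln ((norm (a n))\<^sup>2)"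
      using S(1) a0 by (simp add: ln_mult_pos ln_realpow)
    finally have "\<gamma> * ln (real (Suc n)) \<le> ln ((norm (a n))\<^sup>2)" using 1 by linarith
    then have "exp (\<gamma> * ln (real (Suc n))) \<le> exp (ln ((norm (a n))\<^sup>2))" by simp
    also have "exp (ln ((norm (a n))\<^sup>2)) = (norm (a n))\<^sup>2" using a0 by simp
    finally show ?case by (simp add: powr_def)
  qed
qed

section \<open>Almost sure convergence rate of the ratio\<close>

context centred_noise
begin

text \<open>Two frames are in play: growth is proved for the amplitudes with respect to
  \<open>w\<close>, while the ratio is followed with respect to \<open>z\<close>, where its modulus
  is the quotient of Pruefer radii. A real-linear change of frame does not preserve complex
  ratios.\<close>

lemma AE_ratio_rate:
  assumes F: "F > 0" and lam: "lam \<noteq> 0" and wkb: "wkb_sequence F E w"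
    and nrm: "(norm \<sigma>)\<^sup>2 - (norm \<tau>)\<^sup>2 = 1" and z: "\<And>n. z n = \<sigma> * w n + \<tau> * cnj (w n)"
    and a0: "a0 \<noteq> 0" and b0: "b0 \<noteq> 0"
  shows "AE \<omega> in M. \<exists>r>0. \<forall>i::nat. \<exists>B. \<forall>n.
    \<bar>norm (amp z (\<lambda>k. X k \<omega>) a0 n) / norm (amp z (\<lambda>k. X k \<omega>) b0 n) - r\<bar>
      \<le> B / real (Suc n) powr (lam\<^sup>2 / (4 * F) * (1 - 1 / (real i + 2)))"
proof -
  define L where "L = lam\<^sup>2 / (4 * F)"
  have L: "L > 0" using F lam by (simp add: L_def)
  \<comment> \<open>Consecutive members serve as the pair \<gamma>, \<gamma>' of the truncated
    weights, and a countable family lets one almost sure event handle every exponent below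
    \<open>L\<close>.\<close>
  define \<gamma> where "\<gamma> = (\<lambda>i::nat. L * (1 - 1 / (real i + 2)))"
  have \<gamma>: "0 < \<gamma> i" "\<gamma> i < \<gamma> (Suc i)" "\<gamma> i < L" for i
  proof -
    have "1 / (real i + 2) < 1" "1 / (real (Suc i) + 2) < 1 / (real i + 2)" by (simp_all add: frac_less2)
    then show "0 < \<gamma> i" "\<gamma> i < \<gamma> (Suc i)" using L by (simp_all add: \<gamma>_def)
    have "L * (1 - 1 / (real i + 2)) < L * 1" using L by (intro mult_strict_left_mono) auto
    then show "\<gamma> i < L" by (simp add: \<gamma>_def)
  qed
  define S where "S = norm \<sigma> + norm \<tau>"
  define T where "T = (\<lambda>a. \<sigma> * a + cnj \<tau> * cnj a)"
  have lt: "norm \<tau> < norm \<sigma>"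
    using nrm power2_less_imp_less[of "norm \<tau>" "norm \<sigma>"] by simp
  then have S0: "S > 0" using norm_ge_zero[of \<tau>] unfolding S_def by linarith
  have zn: "norm (z n) \<le> S * norm (w n)" for n
    unfolding z S_def using norm_triangle_ineq[of "\<sigma> * w n" "\<tau> * cnj (w n)"] by (simp add: norm_mult distrib_right)
  have Tn: "norm (T a) \<le> S * norm a" for a
    unfolding T_def S_def using norm_triangle_ineq[of "\<sigma> * a" "cnj \<tau> * cnj a"] by (simp add: norm_mult distrib_right)
  have T0: "T a \<noteq> 0" if "a \<noteq> 0" for a
  proof
    assume "T a = 0"
    then have "norm (\<sigma> * a) = norm (cnj \<tau> * cnj a)" unfolding T_def by (metis add_eq_0_iff norm_minus_cancel)
    then show False using lt that by (simp add: norm_mult)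
  qed
  have inter: "T (amp z x a n) = amp w x (T a) n" for x a n
    unfolding T_def by (rule amp_intertwine[OF nrm z])
  obtain C where C: "C > 0" "\<And>n. (norm (w n))\<^sup>2 \<le> C / sqrt (real (Suc n))"
    using wkb_sequence.norm_bound[OF wkb] by blast
  have zw: "(norm (z n))\<^sup>2 \<le> S\<^sup>2 * (norm (w n))\<^sup>2" for n
    using power_mono[OF zn[of n], of 2] by (simp add: power_mult_distrib)
  have Cz: "(norm (z n))\<^sup>2 \<le> (S\<^sup>2 * C) / sqrt (real (Suc n))" for n
    using order_trans[OF zw[of n] mult_left_mono[OF C(2)[of n], of "S\<^sup>2"]] by simp
  let ?x = "\<lambda>\<omega> k. X k \<omega>"
  have growth: "AE \<omega> in M. (\<lambda>n. ln ((norm (amp w (?x \<omega>) (T a) n))\<^sup>2) / ln (real n)) \<longlonglongrightarrow> L" if "a \<noteq> 0" for a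
    unfolding L_def by (rule AE_amp_growth[OF wkb T0[OF that]])
  have small: "AE \<omega> in M. (\<lambda>n. X n \<omega> * (norm (w n))\<^sup>2) \<longlonglongrightarrow> 0"
    using AE_noise_small[OF wkb a0] by eventually_elim blast
  have mart: "AE \<omega> in M. \<forall>i. summable (\<lambda>k. of_real (X k \<omega>) * tail_weight (\<gamma> i) (\<gamma> (Suc i)) z k (amp z (?x \<omega>) b k))" for b
    unfolding AE_all_countable by (intro allI AE_summable_tail_weight[OF Cz] \<gamma>)
  have sq: "AE \<omega> in M. \<forall>i. summable (\<lambda>k. (X k \<omega>)\<^sup>2 * real (Suc k) powr (- 1 - (\<gamma> (Suc i) - \<gamma> i)))"
    unfolding AE_all_countable by (intro allI AE_summable_square) (simp add: \<gamma>)
  show ?thesis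
    using growth[OF a0] growth[OF b0] small mart[of a0] mart[of b0] sq
  proof eventually_elim
    case (elim \<omega>)
    have xm: "(\<lambda>n. X n \<omega> * (norm (z n))\<^sup>2) \<longlonglongrightarrow> 0"
    proof (rule Lim_null_comparison)
      show "(\<lambda>n. S\<^sup>2 * \<bar>X n \<omega> * (norm (w n))\<^sup>2\<bar>) \<longlonglongrightarrow> 0"
        using tendsto_mult[OF tendsto_const tendsto_rabs_zero[OF elim(3)], of "S\<^sup>2"] by simp
      have "norm (X n \<omega> * (norm (z n))\<^sup>2) \<le> S\<^sup>2 * \<bar>X n \<omega> * (norm (w n))\<^sup>2\<bar>" for n
        using mult_left_mono[OF zw[of n], of "\<bar>X n \<omega>\<bar>"] by (simp add: abs_mult ac_simps)
      then show "eventually (\<lambda>n. norm (X n \<omega> * (norm (z n))\<^sup>2) \<le> S\<^sup>2 * \<bar>X n \<omega> * (norm (w n))\<^sup>2\<bar>) sequentially" by simp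
    qed
    have lower: "eventually (\<lambda>n. real (Suc n) powr \<gamma> i \<le> (norm (amp z (?x \<omega>) a n))\<^sup>2) sequentially"
      if "(\<lambda>n. ln ((norm (amp w (?x \<omega>) (T a) n))\<^sup>2) / ln (real n)) \<longlonglongrightarrow> L" "a \<noteq> 0" for a i
    proof (rule growth_imp_lower_bound[OF that(1) \<gamma>(3) _ S0])
      show "amp w (?x \<omega>) (T a) n \<noteq> 0" for n by (rule amp_nonzero[OF T0[OF that(2)]])
      show "norm (amp w (?x \<omega>) (T a) n) \<le> S * norm (amp z (?x \<omega>) a n)" for n
        unfolding inter[symmetric] by (rule Tn)
    qed
    have conv: "\<exists>l B. (\<lambda>n. amp z (?x \<omega>) a n / amp z (?x \<omega>) b n) \<longlonglongrightarrow> l \<and>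
        (\<forall>n. norm (amp z (?x \<omega>) a n / amp z (?x \<omega>) b n - l) \<le> B / real (Suc n) powr \<gamma> i)"
      if "(\<lambda>n. ln ((norm (amp w (?x \<omega>) (T b) n))\<^sup>2) / ln (real n)) \<longlonglongrightarrow> L" "b \<noteq> 0"
        "\<forall>i. summable (\<lambda>k. of_real (X k \<omega>) * tail_weight (\<gamma> i) (\<gamma> (Suc i)) z k (amp z (?x \<omega>) b k))" for a b i
      using that(3) elim(6) by (intro ratio_converges[OF that(2) \<gamma>(1,2) Cz xm lower[OF that(1,2)]]) blast+
    let ?\<rho> = "\<lambda>n. amp z (?x \<omega>) a0 n / amp z (?x \<omega>) b0 n"
    obtain l where l: "?\<rho> \<longlonglongrightarrow> l" using conv[OF elim(2) b0 elim(5), of a0 0] by blast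
    obtain l' where l': "(\<lambda>n. amp z (?x \<omega>) b0 n / amp z (?x \<omega>) a0 n) \<longlonglongrightarrow> l'"
      using conv[OF elim(1) a0 elim(4), of b0 0] by blast
    have "(\<lambda>n. ?\<rho> n * (amp z (?x \<omega>) b0 n / amp z (?x \<omega>) a0 n)) \<longlonglongrightarrow> l * l'" by (intro tendsto_mult l l')
    moreover have "?\<rho> n * (amp z (?x \<omega>) b0 n / amp z (?x \<omega>) a0 n) = 1" for n
      using amp_nonzero[OF a0] amp_nonzero[OF b0] by simp
    ultimately have "l * l' = 1" using LIMSEQ_unique[OF _ tendsto_const[of 1]] by auto
    then have l0: "norm l > 0" by auto
    show ?case
    proof (rule exI[of _ "norm l"], rule conjI[OF l0], rule allI)
      fix i
      obtain l2 B where B: "?\<rho> \<longlonglongrightarrow> l2" "\<And>n. norm (?\<rho> n - l2) \<le> B / real (Suc n) powr \<gamma> i"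
        using conv[OF elim(2) b0 elim(5), of a0 i] by blast
      \<comment> \<open>Each exponent supplies its own limit; uniqueness identifies them, so one
        \<open>r\<close> works for all \<open>i\<close>.\<close>
      have "l2 = l" using LIMSEQ_unique[OF B(1) l] .
      then have "\<bar>norm (amp z (?x \<omega>) a0 n) / norm (amp z (?x \<omega>) b0 n) - norm l\<bar> \<le> B / real (Suc n) powr \<gamma> i" for n
        using norm_triangle_ineq3[of "?\<rho> n" l] B(2)[of n] by (simp add: norm_divide del: of_nat_Suc)
      then show "\<exists>B. \<forall>n. \<bar>norm (amp z (?x \<omega>) a0 n) / norm (amp z (?x \<omega>) b0 n) - norm l\<bar>
          \<le> B / real (Suc n) powr (lam\<^sup>2 / (4 * F) * (1 - 1 / (real i + 2)))"
        unfolding \<gamma>_def L_def by blast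
    qed
  qed
qed

end

section \<open>The Airy functions\<close>

text \<open>The recurrence is that of \<open>y'' = x * y\<close> on exponents congruent to
  \<open>r\<close> modulo 3. Once \<open>k\<close> exceeds the cube of the modulus of
  \<open>x\<close>, the divisor is at least \<open>2 * k\<close> and the term ratio at most
  \<open>1/2\<close>.\<close>

lemma Airy_series_summable:
  fixes a :: "nat \<Rightarrow> real"
  assumes rec: "\<And>k. a (Suc k) * (real (3 * k + r + 3) * real (3 * k + r + 2)) = a k"
  shows "summable (\<lambda>k. a k * x ^ (3 * k + r))"
proof (rule summable_ratio_test[of "1/2" "nat \<lceil>\<bar>x\<bar> ^ 3\<rceil>"])
  fix k assume k: "nat \<lceil>\<bar>x\<bar> ^ 3\<rceil> \<le> k"
  define d where "d = real (3 * k + r + 3) * real (3 * k + r + 2)"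
  have "\<bar>x\<bar> ^ 3 \<le> real k" using k by linarith
  moreover have "2 * real k \<le> d"
  proof -
    have "real k * 2 \<le> real (3 * k + r + 3) * real (3 * k + r + 2)" by (intro mult_mono) auto
    then show ?thesis by (simp add: d_def mult.commute)
  qed
  ultimately have x: "\<bar>x\<bar> ^ 3 \<le> d / 2" by linarith
  have d0: "d > 0" by (simp add: d_def)
  have ak: "a k = a (Suc k) * d" using rec[of k] by (simp add: d_def)
  have "norm (a (Suc k) * x ^ (3 * Suc k + r)) = \<bar>a (Suc k)\<bar> * \<bar>x\<bar> ^ (3 * k + r) * \<bar>x\<bar> ^ 3"
    by (simp add: abs_mult power_abs power_add[symmetric] mult.assoc add_ac)
  also have "\<dots> \<le> \<bar>a (Suc k)\<bar> * \<bar>x\<bar> ^ (3 * k + r) * (d / 2)"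
    by (intro mult_left_mono x) auto
  also have "\<dots> = 1/2 * norm (a k * x ^ (3 * k + r))"
    using d0 by (simp add: ak abs_mult power_abs)
  finally show "norm (a (Suc k) * x ^ (3 * Suc k + r)) \<le> 1/2 * norm (a k * x ^ (3 * k + r))" .
qed simp

text \<open>The sparse series is filled with zeros to an ordinary power series \<open>A\<close>, so
  that termwise differentiation applies. Then \<open>A3\<close> matches the shifted coefficients of
  \<open>y''\<close>, and \<open>A 2 = 0\<close> removes its constant term.\<close>

lemma Airy_series_ODE:
  fixes a :: "nat \<Rightarrow> real"
  assumes rec: "\<And>k. a (Suc k) * (real (3 * k + r + 3) * real (3 * k + r + 2)) = a k" and r: "r < 2"
    and Y_def: "Y = (\<lambda>x. \<Sum>k. a k * x ^ (3 * k + r))"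
  shows "\<exists>Y'. (\<forall>x. (Y has_real_derivative Y' x) (at x) \<and> (Y' has_real_derivative x * Y x) (at x))
    \<and> Y 0 = (if r = 0 then a 0 else 0) \<and> Y' 0 = (if r = 1 then a 0 else 0)"
proof -
  define A where "A = (\<lambda>n. if n mod 3 = r then a (n div 3) else 0)"
  have sums: "(\<lambda>n. A n * x ^ n) sums Y x" for x
  proof -
    have "(\<lambda>k. a k * x ^ (3 * k + r)) sums Y x"
      unfolding Y_def using Airy_series_summable[OF rec] by (rule summable_sums)
    moreover have "A (3 * k + r) = a k" for k using r by (simp add: A_def)
    ultimately have "(\<lambda>k. A (3 * k + r) * x ^ (3 * k + r)) sums Y x" by simp
    moreover have "strict_mono (\<lambda>k::nat. 3 * k + r)" by (rule strict_monoI) simp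
    moreover have "A n * x ^ n = 0" if "n \<notin> range (\<lambda>k. 3 * k + r)" for n
    proof -
      have "n mod 3 \<noteq> r"
      proof
        assume "n mod 3 = r"
        then have "n = 3 * (n div 3) + r" by presburger
        with that show False by blast
      qed
      then show ?thesis by (simp add: A_def)
    qed
    ultimately show ?thesis by (subst (asm) sums_mono_reindex) auto
  qed
  have Asum: "summable (\<lambda>n. A n * x ^ n)" for x using sums by (rule sums_summable)
  have A3: "A (m + 3) * (real (m + 3) * real (m + 2)) = A m" for m
  proof (cases "m mod 3 = r")
    case True
    define k where "k = m div 3"
    have m: "m = 3 * k + r" using True by (simp add: k_def mult_div_mod_eq[symmetric]) presburger
    have "(m + 3) mod 3 = r" "(m + 3) div 3 = Suc k" "m mod 3 = r" "m div 3 = k"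
      using True by (simp_all add: k_def)
    then have "A (m + 3) = a (Suc k)" "A m = a k" by (simp_all add: A_def)
    then show ?thesis using rec[of k] by (simp add: m add_ac)
  qed (simp add: A_def)
  have A2: "A 2 = 0" using r by (simp add: A_def)
  have Y: "Y = (\<lambda>x. \<Sum>n. A n * x ^ n)" using sums sums_unique by (intro ext) blast
  define Y' where "Y' = (\<lambda>x. \<Sum>n. diffs A n * x ^ n)"
  have dY: "(Y has_real_derivative Y' x) (at x)" for x
    unfolding Y Y'_def by (rule termdiffs_strong_converges_everywhere) (rule Asum)
  have dsum: "summable (\<lambda>n. diffs A n * x ^ n)" for x
    by (rule termdiff_converges_all) (rule Asum)
  have "(Y' has_real_derivative (\<Sum>n. diffs (diffs A) n * x ^ n)) (at x)" for x
    unfolding Y'_def by (rule termdiffs_strong_converges_everywhere) (rule dsum)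
  moreover have "(\<Sum>n. diffs (diffs A) n * x ^ n) = x * Y x" for x
  proof -
    have "diffs (diffs A) (Suc m) = A m" for m
      using A3[of m] by (simp add: diffs_def add_ac mult_ac numeral_3_eq_3)
    moreover have "(\<lambda>m. x * (A m * x ^ m)) sums (x * Y x)" by (intro sums_mult sums)
    ultimately have "(\<lambda>m. diffs (diffs A) (Suc m) * x ^ Suc m) sums (x * Y x)" by (simp add: mult_ac)
    moreover have "diffs (diffs A) 0 = 0" using A2 by (simp add: diffs_def numeral_2_eq_2)
    ultimately have "(\<lambda>m. diffs (diffs A) m * x ^ m) sums (x * Y x)"
      by (subst (asm) sums_Suc_iff) simp
    then show ?thesis by (rule sums_unique[symmetric])
  qed
  moreover have "Y 0 = A 0" "Y' 0 = A 1"
    unfolding Y Y'_def by (simp_all add: powser_zero diffs_def)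
  moreover have "A 0 = (if r = 0 then a 0 else 0)" "A 1 = (if r = 1 then a 0 else 0)"
    by (auto simp: A_def)
  ultimately show ?thesis using dY by (intro exI[of _ Y']) auto
qed

text \<open>The Wronskian is constant because the equation has no first-order term; its value is
  read off at 0.\<close>

lemma airy_fg_ODE:
  obtains f' g' where
    "\<And>x. (airy_f has_real_derivative f' x) (at x)" "\<And>x. (f' has_real_derivative x * airy_f x) (at x)"
    "\<And>x. (airy_g has_real_derivative g' x) (at x)" "\<And>x. (g' has_real_derivative x * airy_g x) (at x)"
    "\<And>x. airy_f x * g' x - f' x * airy_g x = 1"
proof -
  define a where "a = (\<lambda>k::nat. 3 ^ k * pochhammer (1/3) k / fact (3 * k) :: real)"
  define b where "b = (\<lambda>k::nat. 3 ^ k * pochhammer (2/3) k / fact (3 * k + 1) :: real)"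
  have cancel: "p * (q * n1) / (n3 * n2 * n1 * m) * (n3 * n2) = p * q / m"
    if "n1 \<noteq> 0" "n2 \<noteq> 0" "n3 \<noteq> 0" for p q n1 n2 n3 m :: real
    using that by (simp add: field_simps)
  have fact3: "fact (m + 3) = real (m + 3) * real (m + 2) * real (m + 1) * fact m" for m
    by (simp add: numeral_3_eq_3 algebra_simps)
  have ra: "a (Suc k) * (real (3 * k + 0 + 3) * real (3 * k + 0 + 2)) = a k" for k
  proof -
    have "fact (3 * Suc k) = real (3 * k + 3) * real (3 * k + 2) * real (3 * k + 1) * fact (3 * k)"
      using fact3[of "3 * k"] by (simp add: add.commute)
    moreover have "pochhammer (1/3) (Suc k) * 3 = pochhammer (1/3) k * real (3 * k + 1)"
      by (simp add: pochhammer_Suc algebra_simps)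
    moreover have "a (Suc k) = 3 ^ k * (pochhammer (1/3) (Suc k) * 3) / fact (3 * Suc k)"
      unfolding a_def by (simp only: power_Suc ac_simps)
    ultimately have "a (Suc k) * (real (3 * k + 3) * real (3 * k + 2)) = 3 ^ k * pochhammer (1/3) k / fact (3 * k)"
      by (simp only:) (rule cancel, auto)
    then show ?thesis by (simp add: a_def)
  qed
  have rb: "b (Suc k) * (real (3 * k + 1 + 3) * real (3 * k + 1 + 2)) = b k" for k
  proof -
    have "fact (3 * Suc k + 1) = real (3 * k + 4) * real (3 * k + 3) * real (3 * k + 2) * fact (3 * k + 1)"
    proof -
      have "3 * Suc k + 1 = (3 * k + 1) + 3" "(3 * k + 1) + 2 = 3 * k + 3" "(3 * k + 1) + 1 = 3 * k + 2"
        "(3 * k + 1) + 3 = 3 * k + 4" by simp_all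
      then show ?thesis using fact3[of "3 * k + 1"] by metis
    qed
    moreover have "pochhammer (2/3) (Suc k) * 3 = pochhammer (2/3) k * real (3 * k + 2)"
      by (simp add: pochhammer_Suc algebra_simps)
    moreover have "b (Suc k) = 3 ^ k * (pochhammer (2/3) (Suc k) * 3) / fact (3 * Suc k + 1)"
      unfolding b_def by (simp only: power_Suc ac_simps)
    ultimately have "b (Suc k) * (real (3 * k + 4) * real (3 * k + 3)) = 3 ^ k * pochhammer (2/3) k / fact (3 * k + 1)"
      by (simp only:) (rule cancel, auto)
    then show ?thesis by (simp only: b_def add.assoc one_plus_numeral numeral_plus_one BitM.simps) (simp add: add.assoc)
  qed
  have f: "airy_f = (\<lambda>x. \<Sum>k. a k * x ^ (3 * k + 0))" and g: "airy_g = (\<lambda>x. \<Sum>k. b k * x ^ (3 * k + 1))"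
    by (simp_all add: airy_f_def airy_g_def a_def b_def fun_eq_iff mult_ac)
  obtain f' where f': "\<And>x. (airy_f has_real_derivative f' x) (at x)" "\<And>x. (f' has_real_derivative x * airy_f x) (at x)"
    "airy_f 0 = 1" "f' 0 = 0"
    using Airy_series_ODE[OF ra _ f] by (auto simp: a_def)
  obtain g' where g': "\<And>x. (airy_g has_real_derivative g' x) (at x)" "\<And>x. (g' has_real_derivative x * airy_g x) (at x)"
    "airy_g 0 = 0" "g' 0 = 1"
    using Airy_series_ODE[OF rb _ g] by (auto simp: b_def)
  have "((\<lambda>x. airy_f x * g' x - f' x * airy_g x) has_real_derivative 0) (at x)" for x
    by (rule DERIV_cong[OF DERIV_diff[OF DERIV_mult[OF f'(1) g'(2)] DERIV_mult[OF f'(2) g'(1)]]]) (simp add: algebra_simps)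
  then have "airy_f x * g' x - f' x * airy_g x = airy_f 0 * g' 0 - f' 0 * airy_g 0" for x
    using DERIV_isconst_all[of "\<lambda>x. airy_f x * g' x - f' x * airy_g x"] by blast
  then show ?thesis using that[OF f'(1,2) g'(1,2)] f'(3,4) g'(3,4) by simp
qed

text \<open>The substitution \<open>y = - k * (x + E / F)\<close> with \<open>k ^ 3 = F\<close>
  turns the Airy equation into the one with potential \<open>- (F * x + E)\<close>, since
  \<open>k * k * y = - (F * x + E)\<close>. Positivity of \<open>Gamma\<close> gives \<kappa> > 0,
  as the later division by \<open>sqrt \<kappa>\<close> requires.\<close>

lemma zeta_ODE:
  assumes "F > 0"
  obtains p q p' q' \<kappa> where
    "\<And>x. zeta F E x = Complex (p x) (q x)"
    "\<And>x. (p has_real_derivative p' x) (at x)" "\<And>x. (p' has_real_derivative - (F * x + E) * p x) (at x)"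
    "\<And>x. (q has_real_derivative q' x) (at x)" "\<And>x. (q' has_real_derivative - (F * x + E) * q x) (at x)"
    "\<And>x. p x * q' x - p' x * q x = \<kappa>" "\<kappa> > 0"
proof -
  obtain f' g' where f': "\<And>x. (airy_f has_real_derivative f' x) (at x)" "\<And>x. (f' has_real_derivative x * airy_f x) (at x)"
    and g': "\<And>x. (airy_g has_real_derivative g' x) (at x)" "\<And>x. (g' has_real_derivative x * airy_g x) (at x)"
    and W: "\<And>x. airy_f x * g' x - f' x * airy_g x = 1" by (rule airy_fg_ODE, rule that)
  define k where "k = F powr (1/3)"
  have k0: "k > 0" using assms by (simp add: k_def)
  have k3: "k * k * k = F" using assms by (simp add: k_def powr_add[symmetric])
  define y where "y = (\<lambda>x. - k * (x + E / F))"
  define c where "c = sqrt (pi / k)"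
  have c0: "c > 0" unfolding c_def by (rule real_sqrt_gt_zero[OF divide_pos_pos[OF pi_gt_zero k0]])
  have sol: "((\<lambda>x. s * airy_f (y x) + t * airy_g (y x)) has_real_derivative - k * (s * f' (y x) + t * g' (y x))) (at x)"
    "((\<lambda>x. - k * (s * f' (y x) + t * g' (y x))) has_real_derivative - (F * x + E) * (s * airy_f (y x) + t * airy_g (y x))) (at x)" for s t x
  proof -
    have dy: "(y has_real_derivative - k) (at x)" unfolding y_def by (auto intro!: derivative_eq_intros)
    note ch = DERIV_chain2[OF _ dy]
    show "((\<lambda>x. s * airy_f (y x) + t * airy_g (y x)) has_real_derivative - k * (s * f' (y x) + t * g' (y x))) (at x)"
      by (rule DERIV_cong[OF DERIV_add[OF DERIV_cmult[OF ch[OF f'(1)]] DERIV_cmult[OF ch[OF g'(1)]]]]) (simp add: algebra_simps)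
    have "k * k * y x = - (F * x + E)"
    proof -
      have "k * k * y x = - (k * k * k) * (x + E / F)" by (simp add: y_def)
      moreover have "F * (x + E / F) = F * x + E" using assms by (simp add: distrib_left)
      ultimately show ?thesis unfolding k3 by simp
    qed
    then have e: "- (F * x + E) * (s * airy_f (y x) + t * airy_g (y x))
      = - k * (s * (y x * airy_f (y x) * - k) + t * (y x * airy_g (y x) * - k))"
      by (simp only: \<open>k * k * y x = - (F * x + E)\<close>[symmetric]) (simp add: algebra_simps)
    show "((\<lambda>x. - k * (s * f' (y x) + t * g' (y x))) has_real_derivative - (F * x + E) * (s * airy_f (y x) + t * airy_g (y x))) (at x)"
      unfolding e by (rule DERIV_cmult[OF DERIV_add[OF DERIV_cmult[OF ch[OF f'(2)]] DERIV_cmult[OF ch[OF g'(2)]]]])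
  qed
  \<comment> \<open>Coefficients over \<open>airy_f\<close> and \<open>airy_g\<close>:
    \<open>s1\<close>, \<open>t1\<close> belong to the real part, which comes from
    \<open>Bi\<close>, and \<open>s2\<close>, \<open>t2\<close> to the imaginary part, which comes
    from \<open>Ai\<close>.\<close>
  define s1 t1 s2 t2 where "s1 = c * sqrt 3 * airy_c1" and "t1 = c * sqrt 3 * airy_c2"
    and "s2 = c * airy_c1" and "t2 = - c * airy_c2"
  have pos: "airy_c1 > 0" "airy_c2 > 0" unfolding airy_c1_def airy_c2_def by (simp_all add: Gamma_real_pos)
  show ?thesis
  proof (rule that[OF _ sol(1)[of s1 t1] sol(2)[of s1 t1] sol(1)[of s2 t2] sol(2)[of s2 t2]])
    show "zeta F E x = Complex (s1 * airy_f (y x) + t1 * airy_g (y x)) (s2 * airy_f (y x) + t2 * airy_g (y x))" for x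
    proof -
      have "- (F powr (1/3)) * (x + E / F) = y x" "sqrt (pi / F powr (1/3)) = c" by (simp_all add: y_def c_def k_def)
      then show ?thesis unfolding zeta_def
        by (simp only:) (simp add: complex_eq_iff Ai_def Bi_def s1_def t1_def s2_def t2_def algebra_simps)
    qed
    show "k * (t1 * s2 - s1 * t2) > 0"
    proof -
      have "k * (t1 * s2 - s1 * t2) = k * (2 * (c * (c * (sqrt 3 * (airy_c1 * airy_c2)))))"
        by (simp add: s1_def t1_def s2_def t2_def)
      then show ?thesis using k0 c0 pos by (simp only:) (intro mult_pos_pos; simp)
    qed
    show "(s1 * airy_f (y x) + t1 * airy_g (y x)) * (- k * (s2 * f' (y x) + t2 * g' (y x)))
      - - k * (s1 * f' (y x) + t1 * g' (y x)) * (s2 * airy_f (y x) + t2 * airy_g (y x)) = k * (t1 * s2 - s1 * t2)" for x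
    proof -
      have "(s1 * u + t1 * v) * (- k * (s2 * u' + t2 * v')) - - k * (s1 * u' + t1 * v') * (s2 * u + t2 * v)
        = k * (t1 * s2 - s1 * t2) * (u * v' - u' * v)" for u v u' v'
        by (simp add: algebra_simps)
      then show ?thesis using W by simp
    qed
  qed
qed

section \<open>WKB asymptotics\<close>

text \<open>The Liouville-Green approximation. The shift \<open>s\<close> covers both modes: 0 gives
  the cosine and \<open>- (pi/2)\<close> the sine.\<close>

definition wkb_mode :: "real \<Rightarrow> real \<Rightarrow> real \<Rightarrow> real \<Rightarrow> real" where
  "wkb_mode F E s x = (F * x + E) powr (-1/4) * cos (wkb_phase F E x + s)"

definition wkb_mode' :: "real \<Rightarrow> real \<Rightarrow> real \<Rightarrow> real \<Rightarrow> real" where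
  "wkb_mode' F E s x = - (F / 4 * (F * x + E) powr (-5/4) * cos (wkb_phase F E x + s))
     - (F * x + E) powr (1/4) * sin (wkb_phase F E x + s)"

lemma DERIV_affine_powr:
  fixes F E p x :: real
  assumes "F * x + E > 0"
  shows "((\<lambda>x. (F * x + E) powr p) has_real_derivative p * (F * x + E) powr (p - 1) * F) (at x)"
  by (rule DERIV_chain2[where f = "\<lambda>z. z powr p" and g = "\<lambda>x. F * x + E", OF has_real_derivative_powr[OF assms]])
    (auto intro!: derivative_eq_intros)

lemma DERIV_wkb_phase:
  assumes "F > 0" "F * x + E > 0"
  shows "(wkb_phase F E has_real_derivative (F * x + E) powr (1/2)) (at x)"
proof -
  have "((\<lambda>x. 2 / (3 * F) * (F * x + E) powr (3/2)) has_real_derivative 2 / (3 * F) * (3/2 * (F * x + E) powr (3/2 - 1) * F)) (at x)"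
    by (rule DERIV_cmult[OF DERIV_affine_powr[OF assms(2)]])
  moreover have "2 / (3 * F) * (3/2 * (F * x + E) powr (3/2 - 1) * F) = (F * x + E) powr (1/2)"
    using assms by simp
  moreover have "wkb_phase F E = (\<lambda>x. 2 / (3 * F) * (F * x + E) powr (3/2))" by (auto simp: wkb_phase_def)
  ultimately show ?thesis by simp
qed

text \<open>The amplitude is the phase derivative to the power \<open>-1/2\<close>, so the sine
  terms cancel in the second derivative. What remains beyond the potential comes from
  differentiating \<open>(F * x + E) powr (-1/4)\<close> twice, whence
  \<open>5 * F^2 / 16\<close>.\<close>

lemma DERIV_wkb_mode:
  assumes "F > 0" "F * x + E > 0"
  shows "(wkb_mode F E s has_real_derivative wkb_mode' F E s x) (at x)"
    and "(wkb_mode' F E s has_real_derivative (5 * F\<^sup>2 / 16 * (F * x + E) powr (-2) - (F * x + E)) * wkb_mode F E s x) (at x)"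
proof -
  define Q where "Q = F * x + E"
  have Q: "Q > 0" using assms by (simp add: Q_def)
  have pw: "Q powr a * Q powr b = Q powr (a + b)" for a b by (simp add: powr_add)
  have c: "((\<lambda>x. cos (wkb_phase F E x + s)) has_real_derivative - sin (wkb_phase F E x + s) * Q powr (1/2)) (at x)"
    and d: "((\<lambda>x. sin (wkb_phase F E x + s)) has_real_derivative cos (wkb_phase F E x + s) * Q powr (1/2)) (at x)"
    using DERIV_chain2[OF DERIV_cos DERIV_add[OF DERIV_wkb_phase[OF assms] DERIV_const[of s]]]
      DERIV_chain2[OF DERIV_sin DERIV_add[OF DERIV_wkb_phase[OF assms] DERIV_const[of s]]]
    by (simp_all add: Q_def)
  note pd = DERIV_affine_powr[OF assms(2), folded Q_def]
  have m: "wkb_mode F E s = (\<lambda>x. (F * x + E) powr (-1/4) * cos (wkb_phase F E x + s))"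
    by (auto simp: wkb_mode_def)
  show "(wkb_mode F E s has_real_derivative wkb_mode' F E s x) (at x)"
    unfolding m
  proof (rule DERIV_cong[OF DERIV_mult[OF pd c]])
    have "Q powr (-1/4 - 1) = Q powr (-5/4)" "Q powr (1/2) * Q powr (-1/4) = Q powr (1/4)"
      by (simp_all add: pw)
    then show "- 1 / 4 * Q powr (- 1 / 4 - 1) * F * cos (wkb_phase F E x + s) +
        - sin (wkb_phase F E x + s) * Q powr (1 / 2) * (F * x + E) powr (- 1 / 4) = wkb_mode' F E s x"
      by (simp add: wkb_mode'_def Q_def[symmetric] mult.assoc)
  qed
  have m': "wkb_mode' F E s = (\<lambda>x. - (F / 4) * ((F * x + E) powr (-5/4) * cos (wkb_phase F E x + s))
     - (F * x + E) powr (1/4) * sin (wkb_phase F E x + s))"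
    by (auto simp: wkb_mode'_def)
  show "(wkb_mode' F E s has_real_derivative (5 * F\<^sup>2 / 16 * (F * x + E) powr (-2) - (F * x + E)) * wkb_mode F E s x) (at x)"
    unfolding m'
  proof (rule DERIV_cong[OF DERIV_diff[OF DERIV_cmult[OF DERIV_mult[OF pd c]] DERIV_mult[OF pd d]]])
    have e1: "Q powr (-5/4 - 1) = Q powr (-2) * Q powr (-1/4)" by (simp add: pw)
    have e2: "Q powr (1/4 - 1) = Q powr (1/2) * Q powr (-5/4)" by (simp add: pw)
    have e3: "Q powr (1/4) = Q powr (1/2) * Q powr (-1/4)" by (simp add: pw)
    have e4: "Q powr (1/2) * Q powr (1/2) = Q" using Q by (simp add: pw)
    have alg: "- (F / 4) * (- 5 / 4 * (q2 * qm) * F * C + - S * h * q5) - (1 / 4 * (h * q5) * F * S + C * h * (h * qm))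
       = (5 * F\<^sup>2 / 16 * q2 - h * h) * (qm * C)" for q2 qm h q5 C S :: real
      by (simp add: power2_eq_square field_simps)
    show "- (F / 4) * (- 5 / 4 * Q powr (- 5 / 4 - 1) * F * cos (wkb_phase F E x + s) +
         - sin (wkb_phase F E x + s) * Q powr (1 / 2) * (F * x + E) powr (- 5 / 4)) -
      (1 / 4 * Q powr (1 / 4 - 1) * F * sin (wkb_phase F E x + s) +
       cos (wkb_phase F E x + s) * Q powr (1 / 2) * (F * x + E) powr (1 / 4)) =
      (5 * F\<^sup>2 / 16 * (F * x + E) powr (- 2) - (F * x + E)) * wkb_mode F E s x"
      unfolding Q_def[symmetric] wkb_mode_def e1 e2 e3 alg e4 by simp
  qed
qed

lemma wkb_mode_wronskian:
  assumes "F * x + E > 0"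
  shows "wkb_mode F E 0 x * wkb_mode' F E (- (pi/2)) x - wkb_mode' F E 0 x * wkb_mode F E (- (pi/2)) x = 1"
proof -
  have "(F * x + E) powr (-1/4) * (F * x + E) powr (1/4) = 1"
    using assms by (simp add: powr_add[symmetric])
  moreover have "cos (t + - (pi/2)) = sin t" "sin (t + - (pi/2)) = - cos t" for t
    by (simp_all add: cos_diff sin_diff del: add_uminus_conv_diff flip: diff_conv_add_uminus)
  moreover have "q * C * (- (k * S) - r * - C) - (- (k * C) - r * S) * (q * S) = q * r * (C\<^sup>2 + S\<^sup>2)" for q C k S r :: real
    by (simp add: power2_eq_square algebra_simps)
  ultimately show ?thesis
    by (simp only: wkb_mode_def wkb_mode'_def add_0_right sin_cos_squared_add2)
qed

context
  fixes F E :: real and f f' :: "real \<Rightarrow> real"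
  assumes F: "F > 0"
    and f: "\<And>x. (f has_real_derivative f' x) (at x)"
    and f': "\<And>x. (f' has_real_derivative - (F * x + E) * f x) (at x)"
begin

lemma solution_bounded: "\<exists>B\<ge>0. \<forall>x\<ge>(1 - E) / F. \<bar>f x\<bar> \<le> B"
proof -
  \<comment> \<open>The point with \<open>F * x + E = 1\<close>; to its right the potential is
    bounded away from 0, so the energy is defined.\<close>
  define x0 where "x0 = (1 - E) / F"
  \<comment> \<open>a nonincreasing energy\<close>
  define W where "W = (\<lambda>x. (f' x)\<^sup>2 / (F * x + E) + (f x)\<^sup>2)"
  have Q: "F * x + E \<ge> 1" if "x \<ge> x0" for x
    using that F by (simp add: x0_def pos_divide_le_eq mult.commute)
  have dW: "(W has_real_derivative - (F * (f' x)\<^sup>2 / (F * x + E)\<^sup>2)) (at x)" if "x \<ge> x0" for x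
  proof -
    have q: "F * x + E \<noteq> 0" using Q[OF that] by linarith
    have "((\<lambda>x. F * x + E) has_real_derivative F) (at x)" by (auto intro!: derivative_eq_intros)
    note d = DERIV_add[OF DERIV_divide[OF DERIV_power[OF f', of 2] this q] DERIV_power[OF f, of 2]]
    define y where "y = F * x + E"
    have "(2 * (- y * f x * f' x) * y - (f' x)\<^sup>2 * F) / (y * y) + 2 * (f' x * f x) = - (F * (f' x)\<^sup>2 / y\<^sup>2)"
    proof -
      have "y \<noteq> 0" unfolding y_def by (rule q)
      then show ?thesis by (simp add: field_simps power2_eq_square)
    qed
    then show ?thesis unfolding W_def
      by (intro DERIV_cong[OF d]) (simp add: y_def)
  qed
  have "(f x)\<^sup>2 \<le> W x0" if "x \<ge> x0" for x
  proof -
    have "W x \<le> W x0"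
    proof (rule DERIV_nonpos_imp_nonincreasing[OF that])
      fix y assume "x0 \<le> y" "y \<le> x"
      then show "\<exists>D. (W has_real_derivative D) (at y) \<and> D \<le> 0"
        using dW[of y] F by (intro exI conjI) auto
    qed
    moreover have "(f x)\<^sup>2 \<le> W x" using Q[OF that] by (simp add: W_def)
    ultimately show ?thesis by linarith
  qed
  then have "\<bar>f x\<bar> \<le> sqrt (W x0)" if "x \<ge> x0" for x
    using that real_sqrt_le_mono[of "(f x)\<^sup>2" "W x0"] by simp
  moreover have "W x0 \<ge> 0" using Q[of x0] by (simp add: W_def)
  ultimately show ?thesis unfolding x0_def by (intro exI[of _ "sqrt (W x0)"]) (auto simp: x0_def)
qed

text \<open>Variation of parameters: against the WKB modes, which solve the equation with a potential
  perturbed by \<open>O(x powr -2)\<close>, the amplitude of a solution has an integrable derivative.\<close>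

lemma wkb_amplitude_converges:
  "\<exists>p. (\<lambda>n. f (real n) * wkb_mode' F E s (real n) - f' (real n) * wkb_mode F E s (real n)) \<longlonglongrightarrow> p"
proof -
  obtain B where B: "B \<ge> 0" "\<And>x. x \<ge> (1 - E) / F \<Longrightarrow> \<bar>f x\<bar> \<le> B" using solution_bounded by blast
  define P where "P = (\<lambda>x. f x * wkb_mode' F E s x - f' x * wkb_mode F E s x)"
  \<comment> \<open>Chosen so that \<open>g' = - r\<close>, where \<open>r\<close> bounds the
    derivative of \<open>P\<close>: \<open>K * (5/4) * F = 5 * F^2 * B / 16\<close>.\<close>
  define K where "K = F * B / 4"
  define g where "g = (\<lambda>x. K * (F * x + E) powr (-5/4))"
  define r where "r = (\<lambda>x. 5 * F\<^sup>2 / 16 * B * (F * x + E) powr (-9/4))"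
  have Q: "F * x + E \<ge> 1" if "x \<ge> (1 - E) / F" for x
    using that F by (simp add: pos_divide_le_eq mult.commute)
  have dP: "(P has_real_derivative 5 * F\<^sup>2 / 16 * (F * x + E) powr (-2) * f x * wkb_mode F E s x) (at x)"
    if "x \<ge> (1 - E) / F" for x
  proof -
    have "F * x + E > 0" using Q[OF that] by linarith
    note d = DERIV_wkb_mode[OF F this, of s]
    show ?thesis unfolding P_def
      by (rule DERIV_cong[OF DERIV_diff[OF DERIV_mult[OF f d(2)] DERIV_mult[OF f' d(1)]]]) (simp add: algebra_simps)
  qed
  have bP: "\<bar>5 * F\<^sup>2 / 16 * (F * x + E) powr (-2) * f x * wkb_mode F E s x\<bar> \<le> r x" if "x \<ge> (1 - E) / F" for x
  proof -
    have "\<bar>wkb_mode F E s x\<bar> \<le> (F * x + E) powr (-1/4)"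
      by (simp add: wkb_mode_def abs_mult mult_left_le)
    then have "\<bar>f x\<bar> * \<bar>wkb_mode F E s x\<bar> \<le> B * (F * x + E) powr (-1/4)"
      using B that by (intro mult_mono) auto
    then have "5 * F\<^sup>2 / 16 * (F * x + E) powr (-2) * (\<bar>f x\<bar> * \<bar>wkb_mode F E s x\<bar>)
       \<le> 5 * F\<^sup>2 / 16 * (F * x + E) powr (-2) * (B * (F * x + E) powr (-1/4))"
      by (intro mult_left_mono) auto
    also have "\<dots> = 5 * F\<^sup>2 / 16 * B * ((F * x + E) powr (-2) * (F * x + E) powr (-1/4))"
      by (simp only: ac_simps)
    also have "(F * x + E) powr (-2) * (F * x + E) powr (-1/4) = (F * x + E) powr (-9/4)"
      by (simp add: powr_add[symmetric])
    also have "5 * F\<^sup>2 / 16 * B * (F * x + E) powr (-9/4) = r x"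
      by (simp only: r_def)
    finally show ?thesis by (simp add: abs_mult mult.assoc)
  qed
  have dg: "(g has_real_derivative - r x) (at x)" if "x \<ge> (1 - E) / F" for x
  proof -
    have "F * x + E > 0" using Q[OF that] by linarith
    note d = DERIV_cmult[OF DERIV_affine_powr[OF this, of "-5/4"], of K]
    show ?thesis unfolding g_def
      by (rule DERIV_cong[OF d]) (simp add: r_def K_def power2_eq_square)
  qed
  \<comment> \<open>Monotonicity of \<open>P + g\<close> and \<open>P - g\<close> replaces
    integration of the bound \<open>r\<close>; the differences of \<open>g\<close> then telescope to
    a convergent majorant.\<close>
  have step: "\<bar>P (x + 1) - P x\<bar> \<le> g x - g (x + 1)" if "x \<ge> (1 - E) / F" for x
  proof -
    have "P (x + 1) + g (x + 1) \<le> P x + g x"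
    proof (rule DERIV_nonpos_imp_nonincreasing[of x "x + 1" "\<lambda>x. P x + g x"])
      fix y assume "x \<le> y" "y \<le> x + 1"
      then have y: "y \<ge> (1 - E) / F" using that by simp
      show "\<exists>D. ((\<lambda>x. P x + g x) has_real_derivative D) (at y) \<and> D \<le> 0"
        using DERIV_add[OF dP[OF y] dg[OF y]] bP[OF y] by (intro exI conjI) auto
    qed simp
    moreover have "P x - g x \<le> P (x + 1) - g (x + 1)"
    proof (rule DERIV_nonneg_imp_nondecreasing[of x "x + 1" "\<lambda>x. P x - g x"])
      fix y assume "x \<le> y" "y \<le> x + 1"
      then have y: "y \<ge> (1 - E) / F" using that by simp
      show "\<exists>D. ((\<lambda>x. P x - g x) has_real_derivative D) (at y) \<and> D \<ge> 0"
        using DERIV_diff[OF dP[OF y] dg[OF y]] bP[OF y] by (intro exI conjI) auto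
    qed simp
    ultimately show ?thesis by linarith
  qed
  have "(\<lambda>n. g (real n)) \<longlonglongrightarrow> 0" unfolding g_def using F by real_asymp
  then have "summable (\<lambda>n. g (real n) - g (real (Suc n)))" by (rule telescope_summable')
  then have "summable (\<lambda>n. P (real (Suc n)) - P (real n))"
  proof (rule summable_comparison_test_ev[rotated])
    have "eventually (\<lambda>n. real n \<ge> (1 - E) / F) sequentially" by real_asymp
    then show "eventually (\<lambda>n. norm (P (real (Suc n)) - P (real n)) \<le> g (real n) - g (real (Suc n))) sequentially"
    proof eventually_elim
      case (elim n)
      then show ?case using step[OF elim] by (simp add: add.commute)
    qed
  qed
  from summable_LIMSEQ[OF this] have "(\<lambda>n. P (real n) - P (real 0)) \<longlonglongrightarrow> (\<Sum>n. P (real (Suc n)) - P (real n))"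
    unfolding sum_lessThan_telescope[of "\<lambda>n. P (real n)"] .
  then have "(\<lambda>n. P (real n) - P (real 0) + P (real 0)) \<longlonglongrightarrow> (\<Sum>n. P (real (Suc n)) - P (real n)) + P (real 0)"
    by (intro tendsto_add tendsto_const)
  then show ?thesis unfolding P_def by auto
qed

end

text \<open>The Wronskians of \<open>p\<close> and \<open>q\<close> with the two modes are their
  coordinates in the WKB basis, and they converge. The limit is a real-linear map of determinant 1,
  written as (\<sigma>, \<tau>); applying its inverse to the solution pair yields
  \<open>w\<close>.\<close>

lemma wkb_frame:
  fixes p q p' q' :: "real \<Rightarrow> real"
  assumes F: "F > 0"
    and p: "\<And>x. (p has_real_derivative p' x) (at x)" "\<And>x. (p' has_real_derivative - (F * x + E) * p x) (at x)"
    and q: "\<And>x. (q has_real_derivative q' x) (at x)" "\<And>x. (q' has_real_derivative - (F * x + E) * q x) (at x)"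
    and W: "\<And>x. p x * q' x - p' x * q x = 1"
  shows "\<exists>w \<sigma> \<tau>. wkb_sequence F (E + F) w \<and> (norm \<sigma>)\<^sup>2 - (norm \<tau>)\<^sup>2 = 1 \<and>
    (\<forall>n. Complex (p (real (Suc n))) (q (real (Suc n))) = \<sigma> * w n + \<tau> * cnj (w n))"
proof -
  define c c' d d' where "c = wkb_mode F E 0" and "c' = wkb_mode' F E 0"
    and "d = wkb_mode F E (- (pi/2))" and "d' = wkb_mode' F E (- (pi/2))"
  define P1 P2 R1 R2 where "P1 = (\<lambda>x. p x * d' x - p' x * d x)" and "P2 = (\<lambda>x. q x * d' x - q' x * d x)"
    and "R1 = (\<lambda>x. - (p x * c' x - p' x * c x))" and "R2 = (\<lambda>x. - (q x * c' x - q' x * c x))"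
  obtain p1 where p1: "(\<lambda>n. P1 (real n)) \<longlonglongrightarrow> p1"
    using wkb_amplitude_converges[OF F p, of "- (pi/2)"] unfolding P1_def d_def d'_def by blast
  obtain p2 where p2: "(\<lambda>n. P2 (real n)) \<longlonglongrightarrow> p2"
    using wkb_amplitude_converges[OF F q, of "- (pi/2)"] unfolding P2_def d_def d'_def by blast
  obtain r1 where r1: "(\<lambda>n. R1 (real n)) \<longlonglongrightarrow> r1"
    using wkb_amplitude_converges[OF F p, of 0] tendsto_minus unfolding R1_def c_def c'_def by blast
  obtain r2 where r2: "(\<lambda>n. R2 (real n)) \<longlonglongrightarrow> r2"
    using wkb_amplitude_converges[OF F q, of 0] tendsto_minus unfolding R2_def c_def c'_def by blast
  \<comment> \<open>Writing cosine and sine through \<open>v\<close> and \<open>cnj v\<close> turns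
    the coordinates into the coefficients of \<open>v\<close> and \<open>cnj v\<close>. The
    difference of their squared moduli is the determinant \<open>P1 * R2 - P2 * R1\<close>.\<close>
  define \<sigma>n \<tau>n where "\<sigma>n = (\<lambda>n. Complex ((P1 (real n) + R2 (real n)) / 2) ((P2 (real n) - R1 (real n)) / 2))"
    and "\<tau>n = (\<lambda>n. Complex ((P1 (real n) - R2 (real n)) / 2) ((P2 (real n) + R1 (real n)) / 2))"
  define \<sigma> \<tau> where "\<sigma> = Complex ((p1 + r2) / 2) ((p2 - r1) / 2)" and "\<tau> = Complex ((p1 - r2) / 2) ((p2 + r1) / 2)"
  have \<sigma>l: "\<sigma>n \<longlonglongrightarrow> \<sigma>" unfolding \<sigma>n_def \<sigma>_def by (intro tendsto_Complex tendsto_intros p1 p2 r1 r2) auto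
  have \<tau>l: "\<tau>n \<longlonglongrightarrow> \<tau>" unfolding \<tau>n_def \<tau>_def by (intro tendsto_Complex tendsto_intros p1 p2 r1 r2) auto
  have pos: "eventually (\<lambda>n. F * real n + E > 0) sequentially" using F by real_asymp
  have cd: "c x * d' x - c' x * d x = 1" if "F * x + E > 0" for x
    unfolding c_def c'_def d_def d'_def by (rule wkb_mode_wronskian[OF that])
  have PR: "P1 x * R2 x - P2 x * R1 x = 1" if "F * x + E > 0" for x
  proof -
    have "P1 x * R2 x - P2 x * R1 x = (p x * q' x - p' x * q x) * (c x * d' x - c' x * d x)"
      unfolding P1_def P2_def R1_def R2_def by (simp add: algebra_simps)
    then show ?thesis using W cd[OF that] by simp
  qed
  have "(\<lambda>n. P1 (real n) * R2 (real n) - P2 (real n) * R1 (real n)) \<longlonglongrightarrow> p1 * r2 - p2 * r1"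
    by (intro tendsto_intros p1 p2 r1 r2)
  moreover have "(\<lambda>n. P1 (real n) * R2 (real n) - P2 (real n) * R1 (real n)) \<longlonglongrightarrow> 1"
    by (rule tendsto_eventually) (rule eventually_mono[OF pos], rule PR)
  ultimately have lim1: "p1 * r2 - p2 * r1 = 1" by (rule LIMSEQ_unique)
  have nrm: "(norm \<sigma>)\<^sup>2 - (norm \<tau>)\<^sup>2 = 1"
    using lim1 unfolding cmod_power2 \<sigma>_def \<tau>_def by (simp add: power2_eq_square field_simps)
  have st: "\<sigma> * cnj \<sigma> - \<tau> * cnj \<tau> = 1"
  proof -
    have "\<sigma> * cnj \<sigma> - \<tau> * cnj \<tau> = complex_of_real ((norm \<sigma>)\<^sup>2 - (norm \<tau>)\<^sup>2)"
      by (simp only: of_real_diff complex_norm_square)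
    then show ?thesis unfolding nrm by simp
  qed
  define \<zeta> where "\<zeta> = (\<lambda>n. Complex (p (real n)) (q (real n)))"
  \<comment> \<open>Inverse of \<open>w \<mapsto> \<sigma> * w + \<tau> * cnj w\<close>, by Cramer's
    rule with determinant 1.\<close>
  define w where "w = (\<lambda>n. cnj \<sigma> * \<zeta> (Suc n) - \<tau> * cnj (\<zeta> (Suc n)))"
  have zw: "\<zeta> (Suc n) = \<sigma> * w n + \<tau> * cnj (w n)" for n
  proof -
    have "\<sigma> * w n + \<tau> * cnj (w n) = (\<sigma> * cnj \<sigma> - \<tau> * cnj \<tau>) * \<zeta> (Suc n)"
      unfolding w_def by (simp add: algebra_simps)
    then show ?thesis using st by simp
  qed
  define v where "v = (\<lambda>n. cis (wkb_phase F E (real n)))"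
  \<comment> \<open>Corrects the modulus \<open>(F * n + E) powr (-1/4)\<close> to the normalisation
    of \<open>wkb_sequence\<close>. With \<open>t\<close> and \<open>A\<close> tending to 1 and
    \<open>B\<close> to 0, only \<open>v\<close> survives.\<close>
  define t where "t = (\<lambda>n. sqrt (sqrt (F * real n)) * (F * real n + E) powr (-1/4))"
  define A where "A = (\<lambda>n. cnj \<sigma> * \<sigma>n n - \<tau> * cnj (\<tau>n n))"
  define B where "B = (\<lambda>n. cnj \<sigma> * \<tau>n n - \<tau> * cnj (\<sigma>n n))"
  have \<zeta>n: "\<zeta> n = of_real ((F * real n + E) powr (-1/4)) * (\<sigma>n n * v n + \<tau>n n * cnj (v n))" if "F * real n + E > 0" for n
  proof -
    let ?x = "real n" and ?a = "(F * real n + E) powr (-1/4)"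
    have cosd: "cos (y - pi/2) = sin y" for y by (simp add: cos_diff)
    have cx: "c ?x = ?a * cos (wkb_phase F E ?x)" "d ?x = ?a * sin (wkb_phase F E ?x)"
      by (simp_all add: c_def d_def wkb_mode_def cosd)
    have pe: "p ?x = P1 ?x * c ?x + R1 ?x * d ?x"
    proof -
      have "P1 ?x * c ?x + R1 ?x * d ?x = p ?x * (c ?x * d' ?x - c' ?x * d ?x)"
        unfolding P1_def R1_def by (simp add: algebra_simps)
      then show ?thesis using cd[OF that] by simp
    qed
    have qe: "q ?x = P2 ?x * c ?x + R2 ?x * d ?x"
    proof -
      have "P2 ?x * c ?x + R2 ?x * d ?x = q ?x * (c ?x * d' ?x - c' ?x * d ?x)"
        unfolding P2_def R2_def by (simp add: algebra_simps)
      then show ?thesis using cd[OF that] by simp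
    qed
    show ?thesis unfolding \<zeta>_def pe qe cx v_def \<sigma>n_def \<tau>n_def complex_eq_iff
      by (simp add: field_simps)
  qed
  have t1: "t \<longlonglongrightarrow> 1"
  proof -
    have "(\<lambda>n. F * real n / (F * real n + E)) \<longlonglongrightarrow> 1" using F by real_asymp
    then have "(\<lambda>n. (F * real n / (F * real n + E)) powr (1/4)) \<longlonglongrightarrow> 1 powr (1/4)"
      by (intro tendsto_powr tendsto_const) auto
    moreover have "eventually (\<lambda>n. (F * real n / (F * real n + E)) powr (1/4) = t n) sequentially"
      using pos
    proof eventually_elim
      case (elim n)
      have "sqrt (sqrt (F * real n)) = (F * real n) powr (1/4)"
        using F by (simp add: powr_half_sqrt[symmetric] powr_powr)
      then show ?case using F elim by (simp add: t_def powr_divide powr_minus_divide)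
    qed
    ultimately show ?thesis using Lim_transform_eventually by force
  qed
  have "A \<longlonglongrightarrow> cnj \<sigma> * \<sigma> - \<tau> * cnj \<tau>" unfolding A_def by (intro tendsto_intros \<sigma>l \<tau>l)
  then have A1: "A \<longlonglongrightarrow> 1" using st by (simp add: mult.commute)
  have "B \<longlonglongrightarrow> cnj \<sigma> * \<tau> - \<tau> * cnj \<sigma>" unfolding B_def by (intro tendsto_intros \<sigma>l \<tau>l)
  then have B0: "B \<longlonglongrightarrow> 0" by simp
  have "(\<lambda>n. norm (of_real (t n) * A n - 1) + norm (of_real (t n) * B n)) \<longlonglongrightarrow> norm (of_real 1 * 1 - 1 :: complex) + norm (of_real 1 * 0 :: complex)"
    by (intro tendsto_intros t1 A1 B0)
  then have lim0: "(\<lambda>n. norm (of_real (t (Suc n)) * A (Suc n) - 1) + norm (of_real (t (Suc n)) * B (Suc n))) \<longlonglongrightarrow> 0"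
    by (subst filterlim_sequentially_Suc) simp
  have "wkb_sequence F (E + F) w"
  proof
    \<comment> \<open>Replacing \<open>E\<close> by \<open>E + F\<close> moves the phase from
      \<open>n\<close> to the site \<open>n + 1\<close>.\<close>
    have ph: "wkb_phase F (E + F) (real n) = wkb_phase F E (real (Suc n))" for n
      by (simp add: wkb_phase_def algebra_simps)
    show "(\<lambda>n. of_real (sqrt (sqrt (F * real (Suc n)))) * w n - cis (wkb_phase F (E + F) (real n))) \<longlonglongrightarrow> 0"
    proof (rule Lim_null_comparison[OF _ lim0])
      have "eventually (\<lambda>n. F * real (Suc n) + E > 0) sequentially" using F by real_asymp
      then show "eventually (\<lambda>n. norm (of_real (sqrt (sqrt (F * real (Suc n)))) * w n - cis (wkb_phase F (E + F) (real n)))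
         \<le> norm (of_real (t (Suc n)) * A (Suc n) - 1) + norm (of_real (t (Suc n)) * B (Suc n))) sequentially"
      proof eventually_elim
        case (elim n)
        let ?m = "Suc n"
        have "w n = of_real ((F * real ?m + E) powr (-1/4)) * (A ?m * v ?m + B ?m * cnj (v ?m))"
          unfolding w_def \<zeta>n[OF elim] A_def B_def by (simp add: algebra_simps del: of_nat_Suc)
        then have "of_real (sqrt (sqrt (F * real ?m))) * w n - v ?m
           = (of_real (t ?m) * A ?m - 1) * v ?m + of_real (t ?m) * B ?m * cnj (v ?m)"
          unfolding t_def by (simp add: algebra_simps del: of_nat_Suc)
        also have "norm \<dots> \<le> norm ((of_real (t ?m) * A ?m - 1) * v ?m) + norm (of_real (t ?m) * B ?m * cnj (v ?m))"
          by (rule norm_triangle_ineq)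
        also have "\<dots> = norm (of_real (t ?m) * A ?m - 1) + norm (of_real (t ?m) * B ?m)"
          by (simp add: norm_mult v_def del: of_nat_Suc)
        finally show ?case unfolding ph v_def .
      qed
    qed
  qed (rule F)
  then show ?thesis using nrm zw unfolding \<zeta>_def by blast
qed

section \<open>Solutions and their amplitudes\<close>

locale normalized_solution_pair =
  fixes F E :: real and P Q P' Q' :: "real \<Rightarrow> real"
  assumes P: "\<And>x. (P has_real_derivative P' x) (at x)" "\<And>x. (P' has_real_derivative - (F * x + E) * P x) (at x)"
    and Q: "\<And>x. (Q has_real_derivative Q' x) (at x)" "\<And>x. (Q' has_real_derivative - (F * x + E) * Q x) (at x)"
    and wronskian: "\<And>x. P x * Q' x - P' x * Q x = 1"
begin

definition Z :: "real \<Rightarrow> complex" where "Z x = Complex (P x) (Q x)"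

definition Z' :: "real \<Rightarrow> complex" where "Z' x = Complex (P' x) (Q' x)"

text \<open>Cramer's rule for the amplitude with value \<open>y0\<close> and slope \<open>y1\<close>
  at \<open>a\<close>, using Wronskian 1. The complex form is linear in \<open>y1\<close> with
  coefficient \<open>- \<i> * cnj (Z a)\<close>, which is where the shape of \<open>kick\<close>
  comes from.\<close>

definition amplitude_of :: "real \<Rightarrow> real \<Rightarrow> real \<Rightarrow> complex" where
  "amplitude_of a y0 y1 = \<i> * (of_real y0 * cnj (Z' a) - of_real y1 * cnj (Z a))"

lemma amplitude_of_eq: "amplitude_of a y0 y1 = Complex (y0 * Q' a - y1 * Q a) (y0 * P' a - y1 * P a)"
  by (simp add: amplitude_of_def Z_def Z'_def complex_eq_iff)

lemma amplitude_of_Re: "amplitude_of a (Re (\<alpha> * Z a)) (Re (\<alpha> * Z' a)) = \<alpha>"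
proof -
  have W: "P a * Q' a = 1 + P' a * Q a" using wronskian[of a] by linarith
  have "(u * P a - v * Q a) * Q' a - (u * P' a - v * Q' a) * Q a = u * (P a * Q' a - P' a * Q a)"
    "(u * P a - v * Q a) * P' a - (u * P' a - v * Q' a) * P a = v * (P a * Q' a - P' a * Q a)" for u v
    by (simp_all add: algebra_simps)
  then show ?thesis unfolding amplitude_of_eq wronskian
    by (simp add: Z_def Z'_def complex_eq_iff wronskian)
qed

lemma Re_amplitude_of: "Re (amplitude_of a y0 y1 * Z a) = y0" "Re (amplitude_of a y0 y1 * Z' a) = y1"
proof -
  have "(y0 * Q' a - y1 * Q a) * P a - (y0 * P' a - y1 * P a) * Q a = y0 * (P a * Q' a - P' a * Q a)"
    "(y0 * Q' a - y1 * Q a) * P' a - (y0 * P' a - y1 * P a) * Q' a = y1 * (P a * Q' a - P' a * Q a)"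
    by (simp_all add: algebra_simps)
  then show "Re (amplitude_of a y0 y1 * Z a) = y0" "Re (amplitude_of a y0 y1 * Z' a) = y1"
    unfolding amplitude_of_eq wronskian by (simp_all add: Z_def Z'_def)
qed

lemma continuous_Z: "isCont (\<lambda>x. Re (\<alpha> * Z x)) a" "isCont (\<lambda>x. Re (\<alpha> * Z' x)) a"
proof -
  have "isCont P a" "isCont Q a" "isCont P' a" "isCont Q' a"
    using P Q DERIV_isCont by blast+
  then show "isCont (\<lambda>x. Re (\<alpha> * Z x)) a" "isCont (\<lambda>x. Re (\<alpha> * Z' x)) a"
    by (simp_all add: Z_def Z'_def)
qed

text \<open>The Wronskians of \<psi> with both reference solutions are constant on the open
  interval, and their right limits at \<open>a\<close> are given by the initial data. Thus the
  amplitude computed at \<open>x\<close> is the one at \<open>a\<close>, although \<psi> need not be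
  differentiable at \<open>a\<close>.\<close>

lemma solution_eq_Re_amplitude:
  assumes "a < b"
    and \<psi>: "\<And>x. x \<in> {a<..<b} \<Longrightarrow> (\<psi> has_real_derivative D x) (at x)"
    and D: "\<And>x. x \<in> {a<..<b} \<Longrightarrow> (D has_real_derivative (- F * x * \<psi> x - E * \<psi> x)) (at x)"
    and y0: "(\<psi> \<longlongrightarrow> y0) (at_right a)" and y1: "(D \<longlongrightarrow> y1) (at_right a)"
    and x: "x \<in> {a<..<b}"
  shows "\<psi> x = Re (amplitude_of a y0 y1 * Z x)" "D x = Re (amplitude_of a y0 y1 * Z' x)"
proof -
  have const: "\<psi> x * U' x - D x * U x = y0 * U' a - y1 * U a"
    if U: "\<And>x. (U has_real_derivative U' x) (at x)" "\<And>x. (U' has_real_derivative - (F * x + E) * U x) (at x)" for U U'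
  proof -
    let ?A = "\<lambda>x. \<psi> x * U' x - D x * U x"
    have "(?A has_real_derivative 0) (at t)" if "t \<in> {a<..<b}" for t
      by (rule DERIV_cong[OF DERIV_diff[OF DERIV_mult[OF \<psi>[OF that] U(2)] DERIV_mult[OF D[OF that] U(1)]]])
        (simp add: algebra_simps)
    then have eq: "?A t = ?A x" if "t \<in> {a<..<b}" for t
      using DERIV_isconst3[OF \<open>a < b\<close> that x, of ?A] by blast
    have "(U \<longlongrightarrow> U a) (at_right a)" "(U' \<longlongrightarrow> U' a) (at_right a)"
      using DERIV_isCont[OF U(1)] DERIV_isCont[OF U(2)] by (auto simp: isCont_def intro: tendsto_within_subset)
    then have "(?A \<longlongrightarrow> y0 * U' a - y1 * U a) (at_right a)" by (intro tendsto_intros y0 y1)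
    moreover have "(?A \<longlongrightarrow> ?A x) (at_right a)"
      by (rule tendsto_eventually) (use eventually_at_right_real[OF \<open>a < b\<close>] eq in \<open>auto elim: eventually_mono\<close>)
    ultimately show ?thesis using tendsto_unique[OF trivial_limit_at_right_real] by blast
  qed
  have e: "amplitude_of a y0 y1 = amplitude_of x (\<psi> x) (D x)"
    unfolding amplitude_of_eq const[OF P] const[OF Q] ..
  show "\<psi> x = Re (amplitude_of a y0 y1 * Z x)" "D x = Re (amplitude_of a y0 y1 * Z' x)"
    unfolding e Re_amplitude_of by simp_all
qed

lemma gen_eig_sol_eq_Re_amp:
  assumes sol: "gen_eig_sol F E g \<theta> \<psi>"
  defines "\<alpha> \<equiv> amp (\<lambda>n. Z (real (Suc n))) (\<lambda>n. g (Suc n)) (amplitude_of 0 (sin \<theta>) (cos \<theta>))"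
  shows "x \<in> {real n<..<real n + 1} \<Longrightarrow> \<psi> x = Re (\<alpha> n * Z x) \<and> deriv \<psi> x = Re (\<alpha> n * Z' x)"
proof (induction n arbitrary: x)
  have cont: "continuous_on {0..} \<psi>"
    and d: "\<And>n x. x \<in> {real n<..<real n + 1} \<Longrightarrow> (\<psi> has_real_derivative deriv \<psi> x) (at x)"
      "\<And>n x. x \<in> {real n<..<real n + 1} \<Longrightarrow> (deriv \<psi> has_real_derivative (- F * x * \<psi> x - E * \<psi> x)) (at x)"
    and jump: "\<And>n. n \<ge> 1 \<Longrightarrow> ((\<lambda>\<epsilon>. deriv \<psi> (real n + \<epsilon>) - deriv \<psi> (real n - \<epsilon>)) \<longlongrightarrow> g n * \<psi> (real n)) (at_right 0)"
    and init: "\<psi> 0 = sin \<theta>" "(deriv \<psi> \<longlongrightarrow> cos \<theta>) (at_right 0)"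
    using sol unfolding gen_eig_sol_def by auto
  have right: "(\<psi> \<longlongrightarrow> \<psi> a) (at_right a)" if "a \<ge> 0" for a
    using cont that by (auto simp: continuous_on_def intro: tendsto_within_subset)
  {
    case 0
    then have x: "x \<in> {0<..<1}" by simp
    have \<alpha>0: "\<alpha> 0 = amplitude_of 0 (sin \<theta>) (cos \<theta>)" by (simp add: \<alpha>_def)
    have r0: "(\<psi> \<longlongrightarrow> sin \<theta>) (at_right 0)" using right[of 0] init by simp
    have d0: "(\<psi> has_real_derivative deriv \<psi> x) (at x)"
      "(deriv \<psi> has_real_derivative (- F * x * \<psi> x - E * \<psi> x)) (at x)" if "x \<in> {0<..<1}" for x
      using d[of x 0] that by simp_all
    show ?case unfolding \<alpha>0
      using solution_eq_Re_amplitude[OF zero_less_one d0 r0 init(2) x] by blast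
  next
    case (Suc n)
    define m where "m = real (Suc n)"
    have m: "m = real n + 1" "m > 0" by (simp_all add: m_def)
    have left: "(f \<longlongrightarrow> h m) (at_left m)" if "\<And>x. x \<in> {real n<..<real n + 1} \<Longrightarrow> f x = h x" "isCont h m" for f h :: "real \<Rightarrow> real"
    proof (rule Lim_transform_eventually)
      show "(h \<longlongrightarrow> h m) (at_left m)" using that(2) by (auto simp: isCont_def intro: tendsto_within_subset)
      have "eventually (\<lambda>x. x \<in> {real n<..<m}) (at_left m)" by (rule eventually_at_left_real) (simp add: m)
      then show "eventually (\<lambda>x. h x = f x) (at_left m)" by eventually_elim (use that(1) m in auto)
    qed
    have "(\<psi> \<longlongrightarrow> Re (\<alpha> n * Z m)) (at_left m)"
      by (rule left[OF _ continuous_Z(1)]) (use Suc.IH in blast)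
    moreover have "(\<psi> \<longlongrightarrow> \<psi> m) (at_left m)"
    proof -
      have "isCont \<psi> m" using continuous_on_interior[OF cont] m by simp
      then show ?thesis by (auto simp: isCont_def intro: tendsto_within_subset)
    qed
    ultimately have \<psi>m: "\<psi> m = Re (\<alpha> n * Z m)" using tendsto_unique[OF trivial_limit_at_left_real] by blast
    have "(deriv \<psi> \<longlongrightarrow> Re (\<alpha> n * Z' m)) (at_left m)"
      by (rule left[OF _ continuous_Z(2)]) (use Suc.IH in blast)
    \<comment> \<open>Only the difference of the one-sided slopes is prescribed. Adding the left
      limit, known from the previous interval, shows that the right limit exists.\<close>
    then have "((\<lambda>\<epsilon>. deriv \<psi> (m - \<epsilon>)) \<longlongrightarrow> Re (\<alpha> n * Z' m)) (at_right 0)"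
      unfolding filterlim_at_left_to_right filterlim_at_right_to_0[of _ _ "- m"] by simp
    from tendsto_add[OF jump[of "Suc n"] this[unfolded m_def]]
    have "((\<lambda>\<epsilon>. deriv \<psi> (\<epsilon> + m)) \<longlongrightarrow> g (Suc n) * \<psi> m + Re (\<alpha> n * Z' m)) (at_right 0)"
      unfolding m_def by (simp add: add.commute)
    then have Dm: "(deriv \<psi> \<longlongrightarrow> g (Suc n) * \<psi> m + Re (\<alpha> n * Z' m)) (at_right m)"
      unfolding filterlim_at_right_to_0[of _ _ m] .
    \<comment> \<open>The value is continuous and the slope jumps by
      \<open>g (Suc n) * \<psi> m\<close>; linearity in the slope turns this jump into the
      kick.\<close>
    have "amplitude_of m (\<psi> m) (g (Suc n) * \<psi> m + Re (\<alpha> n * Z' m))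
      = amplitude_of m (Re (\<alpha> n * Z m)) (Re (\<alpha> n * Z' m)) - \<i> * of_real (g (Suc n) * Re (\<alpha> n * Z m)) * cnj (Z m)"
      unfolding \<psi>m by (simp add: amplitude_of_def algebra_simps)
    then have am: "amplitude_of m (\<psi> m) (g (Suc n) * \<psi> m + Re (\<alpha> n * Z' m)) = \<alpha> (Suc n)"
      unfolding amplitude_of_Re by (simp add: \<alpha>_def kick_def m_def)
    have mm: "m < m + 1" by simp
    have x: "x \<in> {m<..<m + 1}" using Suc.prems by (simp add: m_def)
    have rm: "(\<psi> \<longlongrightarrow> \<psi> m) (at_right m)" using right m by simp
    show ?case
      using solution_eq_Re_amplitude[OF mm d[of _ "Suc n", folded m_def] rm Dm x] unfolding am by blast
  }
qed

text \<open>Since \<open>\<psi> = 2 * Re (\<beta> * zeta)\<close> and \<open>zeta = c * Z\<close>,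
  the amplitude over \<open>Z\<close> is \<open>2 * c * \<beta>\<close>, which gives the factor
  \<open>1 / c\<close>. Radius index \<open>Suc n\<close> corresponds to the interval
  \<open>(n, n + 1)\<close>.\<close>

lemma pruefer_radius_eq:
  assumes sol: "gen_eig_sol F E g \<theta> \<psi>" and zeta: "\<And>x. zeta F E x = of_real c * Z x" and c: "c > 0"
  shows "pruefer_radius F E \<psi> (Suc n) =
    norm (amp (\<lambda>n. Z (real (Suc n))) (\<lambda>n. g (Suc n)) (amplitude_of 0 (sin \<theta>) (cos \<theta>)) n) / c"
proof -
  define \<alpha> where "\<alpha> = amp (\<lambda>n. Z (real (Suc n))) (\<lambda>n. g (Suc n)) (amplitude_of 0 (sin \<theta>) (cos \<theta>)) n"
  define I where "I = {real n<..<real n + 1}"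
  have \<psi>: "\<psi> x = Re (\<alpha> * Z x)" if "x \<in> I" for x
    using gen_eig_sol_eq_Re_amp[OF sol, of x n] that by (simp add: \<alpha>_def I_def)
  have sum: "\<beta> * zeta F E x + cnj \<beta> * cnj (zeta F E x) = of_real (Re (of_real (2 * c) * \<beta> * Z x))" for \<beta> x
    by (simp add: zeta complex_eq_iff algebra_simps)
  have "(THE \<beta>. \<forall>x\<in>I. complex_of_real (\<psi> x) = \<beta> * zeta F E x + cnj \<beta> * cnj (zeta F E x)) = \<alpha> / of_real (2 * c)"
  proof (rule the_equality)
    have "of_real (2 * c) * (\<alpha> / of_real (2 * c)) * Z x = \<alpha> * Z x" for x using c by simp
    then show "\<forall>x\<in>I. complex_of_real (\<psi> x) = \<alpha> / of_real (2 * c) * zeta F E x + cnj (\<alpha> / of_real (2 * c)) * cnj (zeta F E x)"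
      unfolding sum using \<psi> by (intro ballI arg_cong[where f = complex_of_real]) (simp only:)
  next
    fix \<beta> assume "\<forall>x\<in>I. complex_of_real (\<psi> x) = \<beta> * zeta F E x + cnj \<beta> * cnj (zeta F E x)"
    then have b: "Re (\<alpha> * Z x) = Re (of_real (2 * c) * \<beta> * Z x)" if "x \<in> I" for x
      unfolding sum using \<psi> that of_real_eq_iff by metis
    define \<delta> where "\<delta> = \<alpha> - of_real (2 * c) * \<beta>"
    have z: "Re (\<delta> * Z x) = 0" if "x \<in> I" for x
      using b[OF that] by (simp add: \<delta>_def left_diff_distrib)
    \<comment> \<open>For uniqueness in \<open>THE\<close>: a real combination vanishing on the open
      interval has value and slope 0 at an interior point, and these two numbers determine
      \<delta>.\<close>
    define x0 where "x0 = real n + 1/2"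
    have x0: "x0 \<in> I" by (simp add: x0_def I_def)
    have "((\<lambda>x. Re \<delta> * P x - Im \<delta> * Q x) has_real_derivative Re \<delta> * P' x0 - Im \<delta> * Q' x0) (at x0)"
      by (intro DERIV_diff DERIV_cmult P Q)
    moreover have "((\<lambda>x. Re \<delta> * P x - Im \<delta> * Q x) has_real_derivative 0) (at x0)"
    proof (rule has_field_derivative_transform_within_open[of "\<lambda>_. 0" _ _ I])
      show "open I" by (simp add: I_def)
      show "0 = Re \<delta> * P x - Im \<delta> * Q x" if "x \<in> I" for x using z[OF that] by (simp add: Z_def)
    qed (use x0 in auto)
    ultimately have "Re (\<delta> * Z' x0) = 0" using DERIV_unique by (fastforce simp: Z'_def)
    then have "\<delta> = 0" using amplitude_of_Re[of x0 \<delta>] unfolding z[OF x0] by (simp only: amplitude_of_def) simp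
    then show "\<beta> = \<alpha> / of_real (2 * c)" using c by (simp add: \<delta>_def)
  qed
  moreover have "{real (Suc n) - 1<..<real (Suc n)} = I" by (simp add: I_def add.commute)
  ultimately have "pruefer_radius F E \<psi> (Suc n) = 2 * norm (\<alpha> / of_real (2 * c))"
    unfolding pruefer_radius_def by simp
  then show ?thesis using c by (simp add: norm_divide norm_mult \<alpha>_def)
qed

end

section \<open>From power rates to the limsup, and the final assembly\<close>

lemma limsup_log_ratio_le:
  assumes "\<And>i. \<exists>B. \<forall>n. \<bar>d (Suc n)\<bar> \<le> B / real (Suc n) powr \<gamma> i" and "\<gamma> \<longlonglongrightarrow> L"
  shows "limsup (\<lambda>n. log_ratio (d n) n) \<le> ereal (- L)"
proof -
  have bound: "limsup (\<lambda>n. log_ratio (d n) n) \<le> ereal (- \<gamma> i)" for i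
  proof -
    obtain B where B: "\<And>n. \<bar>d (Suc n)\<bar> \<le> B / real (Suc n) powr \<gamma> i" using assms(1) by blast
    \<comment> \<open>Raising \<open>B\<close> to at least 1 makes \<open>ln C\<close> meaningful;
      it disappears after division by \<open>ln n\<close>. Where \<open>d n = 0\<close> the value
      \<open>-\<infinity>\<close> of \<open>log_ratio\<close> satisfies any bound.\<close>
    define C where "C = max B 1"
    have C: "C > 0" by (simp add: C_def)
    have "eventually (\<lambda>n. log_ratio (d n) n \<le> ereal ((ln C - \<gamma> i * ln (real n)) / ln (real n))) sequentially"
      using eventually_gt_at_top[of 1]
    proof eventually_elim
      case (elim n)
      then have n: "real n > 1" "ln (real n) > 0" by simp_all
      show ?case
      proof (cases "d n = 0")
        case False
        have "\<bar>d n\<bar> \<le> B / real n powr \<gamma> i" using B[of "n - 1"] elim by simp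
        also have "\<dots> \<le> C / real n powr \<gamma> i" by (intro divide_right_mono) (auto simp: C_def)
        finally have "ln \<bar>d n\<bar> \<le> ln (C / real n powr \<gamma> i)" using False by (intro ln_mono) auto
        also have "\<dots> = ln C - \<gamma> i * ln (real n)" using C n by (simp add: ln_div ln_powr)
        finally have "ln \<bar>d n\<bar> / ln (real n) \<le> (ln C - \<gamma> i * ln (real n)) / ln (real n)"
          using n by (intro divide_right_mono) auto
        then show ?thesis using False by (simp add: log_ratio_def)
      qed (simp add: log_ratio_def)
    qed
    then have "limsup (\<lambda>n. log_ratio (d n) n) \<le> limsup (\<lambda>n. ereal ((ln C - \<gamma> i * ln (real n)) / ln (real n)))"
      by (rule Limsup_mono)
    also have "\<dots> = ereal (- \<gamma> i)"
    proof (rule lim_imp_Limsup)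
      have "(\<lambda>n. (ln C - \<gamma> i * ln (real n)) / ln (real n)) \<longlonglongrightarrow> - \<gamma> i" by real_asymp
      then show "(\<lambda>n. ereal ((ln C - \<gamma> i * ln (real n)) / ln (real n))) \<longlonglongrightarrow> ereal (- \<gamma> i)" by simp
    qed simp
    finally show ?thesis .
  qed
  have "(\<lambda>i. ereal (- \<gamma> i)) \<longlonglongrightarrow> ereal (- L)" using tendsto_minus[OF assms(2)] by simp
  then show ?thesis by (rule LIMSEQ_le_const) (use bound in auto)
qed

theorem theorem4p5:
  fixes M :: "'a measure" and g :: "nat \<Rightarrow> 'a \<Rightarrow> real"
    and lam F E \<theta>p \<theta>m :: real
  assumes "prob_space M"
    and "lam \<noteq> 0"
    and "\<And>n. n \<ge> 1 \<Longrightarrow> g n \<in> borel_measurable M"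
    and "prob_space.indep_vars M (\<lambda>_. borel) g {1..}"
    and "\<And>n. n \<ge> 1 \<Longrightarrow> integrable M (\<lambda>\<omega>. g n \<omega> ^ 4)"
    and "\<And>n. n \<ge> 1 \<Longrightarrow> integrable M (g n)"
    and "\<And>n. n \<ge> 1 \<Longrightarrow> integrable M (\<lambda>\<omega>. g n \<omega> ^ 2)"
    and "\<And>n. n \<ge> 1 \<Longrightarrow> prob_space.expectation M (g n) = 0"
    and "\<And>n. n \<ge> 1 \<Longrightarrow> prob_space.expectation M (\<lambda>\<omega>. g n \<omega> ^ 2) = lam\<^sup>2"
    and "summable (\<lambda>n. prob_space.expectation M (\<lambda>\<omega>. g (Suc n) \<omega> ^ 4) / (real (Suc n))\<^sup>2)"
    and "AE \<omega> in M. ((\<lambda>n. g n \<omega> / real n powr (1/4)) \<longlonglongrightarrow> 0)"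
    and "F > 0"
    and "\<theta>p \<in> {0..<pi}" and "\<theta>m \<in> {0..<pi}" and "\<theta>p \<noteq> \<theta>m"
  shows "AE \<omega> in M. \<forall>\<psi>p \<psi>m.
           gen_eig_sol F E (\<lambda>n. g n \<omega>) \<theta>p \<psi>p \<longrightarrow>
           gen_eig_sol F E (\<lambda>n. g n \<omega>) \<theta>m \<psi>m \<longrightarrow>
           (\<exists>\<rho>>0. limsup (\<lambda>n. log_ratio
                (pruefer_radius F E \<psi>p n / pruefer_radius F E \<psi>m n - \<rho>) n)
              \<le> ereal (- (lam\<^sup>2) / (4 * F)))"
proof -
  interpret prob_space M by (rule assms(1))
  \<comment> \<open>Moves the index set from \<open>{1..}\<close> to all naturals: the singleton
    blocks \<open>{Suc j}\<close> are disjoint, and each is then projected to its one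
    coordinate.\<close>
  have ind: "indep_vars (\<lambda>_. borel) (\<lambda>n. g (Suc n)) UNIV"
  proof -
    have "indep_vars (\<lambda>j. PiM {Suc j} (\<lambda>_. borel)) (\<lambda>j \<omega>. restrict (\<lambda>i. g i \<omega>) {Suc j}) UNIV"
      by (rule indep_vars_restrict[OF assms(4)]) (auto simp: disjoint_family_on_def)
    from indep_vars_compose2[OF this, of "\<lambda>j f. f (Suc j)" "\<lambda>_. borel"]
    show ?thesis by simp
  qed
  interpret centred_noise M "\<lambda>n. g (Suc n)" lam
  proof unfold_locales
    show "AE \<omega> in M. (\<lambda>k. g (Suc k) \<omega> / real (Suc k) powr (1/4)) \<longlonglongrightarrow> 0"
      using assms(11) by eventually_elim (rule LIMSEQ_Suc)
  qed (use ind assms in auto)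
  obtain p q p' q' \<kappa> where pq: "\<And>x. zeta F E x = Complex (p x) (q x)"
    "\<And>x. (p has_real_derivative p' x) (at x)" "\<And>x. (p' has_real_derivative - (F * x + E) * p x) (at x)"
    "\<And>x. (q has_real_derivative q' x) (at x)" "\<And>x. (q' has_real_derivative - (F * x + E) * q x) (at x)"
    "\<And>x. p x * q' x - p' x * q x = \<kappa>" "\<kappa> > 0"
    using zeta_ODE[OF \<open>F > 0\<close>, of E] by blast
  \<comment> \<open>Rescales the pair to Wronskian 1; the scale cancels in the ratio of the
    radii.\<close>
  define s where "s = 1 / sqrt \<kappa>"
  have s0: "s > 0" and s2: "s * s * \<kappa> = 1" using \<open>\<kappa> > 0\<close> by (auto simp: s_def)
  interpret normalized_solution_pair F E "\<lambda>x. s * p x" "\<lambda>x. s * q x" "\<lambda>x. s * p' x" "\<lambda>x. s * q' x"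
  proof
    show "((\<lambda>x. s * p' x) has_real_derivative - (F * x + E) * (s * p x)) (at x)" for x
      using DERIV_cmult[OF pq(3), of s x] by (simp add: algebra_simps)
    show "((\<lambda>x. s * q' x) has_real_derivative - (F * x + E) * (s * q x)) (at x)" for x
      using DERIV_cmult[OF pq(5), of s x] by (simp add: algebra_simps)
    have "s * p x * (s * q' x) - s * p' x * (s * q x) = s * s * (p x * q' x - p' x * q x)" for x
      by (simp add: algebra_simps)
    then show "s * p x * (s * q' x) - s * p' x * (s * q x) = 1" for x using s2 pq(6) by simp
  qed (intro DERIV_cmult pq)+
  have zeta: "zeta F E x = of_real (1 / s) * Z x" for x
    using s0 by (simp add: pq(1) Z_def complex_eq_iff)
  obtain w \<sigma> \<tau> where w: "wkb_sequence F (E + F) w" "(norm \<sigma>)\<^sup>2 - (norm \<tau>)\<^sup>2 = 1"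
    "\<And>n. Z (real (Suc n)) = \<sigma> * w n + \<tau> * cnj (w n)"
    using wkb_frame[OF \<open>F > 0\<close> P Q wronskian] unfolding Z_def by blast
  define A where "A = (\<lambda>\<theta> \<omega>. amp (\<lambda>n. Z (real (Suc n))) (\<lambda>n. g (Suc n) \<omega>) (amplitude_of 0 (sin \<theta>) (cos \<theta>)))"
  have nz: "amplitude_of 0 (sin \<theta>) (cos \<theta>) \<noteq> 0" for \<theta>
  proof
    assume "amplitude_of 0 (sin \<theta>) (cos \<theta>) = 0"
    then have "sin \<theta> = 0" "cos \<theta> = 0" using Re_amplitude_of[of 0 "sin \<theta>" "cos \<theta>"] by simp_all
    then show False using sin_cos_squared_add[of \<theta>] by simp
  qed
  define L where "L = lam\<^sup>2 / (4 * F)"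
  have rate: "AE \<omega> in M. \<exists>r>0. \<forall>i::nat. \<exists>B. \<forall>n.
      \<bar>norm (A \<theta>p \<omega> n) / norm (A \<theta>m \<omega> n) - r\<bar> \<le> B / real (Suc n) powr (L * (1 - 1 / (real i + 2)))"
    unfolding A_def L_def by (rule AE_ratio_rate[OF \<open>F > 0\<close> \<open>lam \<noteq> 0\<close> w nz nz])
  have lim: "(\<lambda>i. L * (1 - 1 / (real i + 2))) \<longlonglongrightarrow> L"
  proof -
    have "(\<lambda>i::nat. 1 - 1 / (real i + 2)) \<longlonglongrightarrow> 1" by real_asymp
    from tendsto_mult[OF tendsto_const this, of L] show ?thesis by simp
  qed
  from rate show ?thesis
  proof eventually_elim
    case (elim \<omega>)
    then obtain r where r: "r > 0" "\<And>i::nat. \<exists>B. \<forall>n.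
      \<bar>norm (A \<theta>p \<omega> n) / norm (A \<theta>m \<omega> n) - r\<bar> \<le> B / real (Suc n) powr (L * (1 - 1 / (real i + 2)))" by blast
    \<comment> \<open>The exceptional null set comes from the amplitudes alone, so the solutions may
      be chosen after \<omega>.\<close>
    show ?case
    proof (intro allI impI)
      fix \<psi>p \<psi>m
      assume sols: "gen_eig_sol F E (\<lambda>n. g n \<omega>) \<theta>p \<psi>p" "gen_eig_sol F E (\<lambda>n. g n \<omega>) \<theta>m \<psi>m"
      have "1 / s > 0" using s0 by simp
      note radius = pruefer_radius_eq[OF _ zeta this]
      have ratio: "pruefer_radius F E \<psi>p (Suc n) / pruefer_radius F E \<psi>m (Suc n) = norm (A \<theta>p \<omega> n) / norm (A \<theta>m \<omega> n)" for n
        unfolding radius[OF sols(1)] radius[OF sols(2)] A_def using s0 by simp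
      have "limsup (\<lambda>n. log_ratio (pruefer_radius F E \<psi>p n / pruefer_radius F E \<psi>m n - r) n) \<le> ereal (- L)"
        by (rule limsup_log_ratio_le[OF _ lim]) (unfold ratio, rule r(2))
      then show "\<exists>\<rho>>0. limsup (\<lambda>n. log_ratio
                (pruefer_radius F E \<psi>p n / pruefer_radius F E \<psi>m n - \<rho>) n)
              \<le> ereal (- (lam\<^sup>2) / (4 * F))"
        using r(1) by (auto simp: L_def)
    qed
  qed
qed

end
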